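(* Let $G$ be a simply connected, nilpotent Lie group of dimension $2n+1$ endowed with a left-invariant quasi-Sasakian structure $(\varphi,\xi,\eta,g)$ of maximal rank. Then $G$ is isomorphic to a weighted Heisenberg Lie group $H^{2n+1}_\lambda$, for some weights $\lambda\in\mathbb{R}^n$.
   Context: An almost contact metric structure $(\varphi,\xi,\eta,g)$ on a smooth manifold of dimension $2n+1$ consists of a $(1,1)$-tensor field $\varphi$, a vector field $\xi$, a $1$-form $\eta$ and a Riemannian metric $g$ with $\varphi^2=-I+\eta\otimes\xi$, $\eta(\xi)=1$, and $g(\varphi X,\varphi Y)=g(X,Y)-\eta(X)\eta(Y)$. Its fundamental $2$-form is $\Phi(X,Y)=g(X,\varphi Y)$. Put $N_\varphi=[\varphi,\varphi]+d\eta\otimes\xi$, where $[\varphi,\varphi](X,Y)=[\varphi X,\varphi Y]+\varphi^2[X,Y]-\varphi[X,\varphi Y]-\varphi[\varphi X,Y]$ and $d\eta(X,Y)=X\eta(Y)-Y\eta(X)-\eta([X,Y])$. The structure is quasi-Sasakian if $d\Phi=0$ and $N_\varphi=0$. It has maximal rank if $\eta\wedge(d\eta)^n$ vanishes nowhere. On a Lie group, it is left-invariant if $\varphi,\xi,\eta,g$ are all left-invariant. Simply connected includes connected. For $\lambda=(\lambda_1,\dots,\lambda_n)\in\mathbb{R}^n$, the weighted Heisenberg Lie algebra $\mathfrak{h}^{2n+1}_\lambda$ is the $(2n+1)$-dimensional real Lie algebra with basis $\{\xi,\tau_r,\tau_{n+r} : r=1,\dots,n\}$ whose only possibly nonvanishing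 brackets of basis elements (up to skew-symmetry) are $[\tau_r,\tau_{n+r}]=2\lambda_r\xi$, $r=1,\dots,n$. The weighted Heisenberg Lie group $H^{2n+1}_\lambda$ is the simply connected Lie group with Lie algebra $\mathfrak{h}^{2n+1}_\lambda$. *)

theory Defs
  imports
    "HOL-Analysis.Analysis"
    "HOL-Algebra.Group"
    "HOL-Library.Function_Algebras"
begin

section \<open>Smooth manifolds and Lie groups\<close>

text \<open>Only meaningful for open \<open>S\<close>: the derivatives are two-sided ones at the points of \<open>S\<close>.\<close>

primrec Ck_on :: "nat \<Rightarrow> 'a::euclidean_space set \<Rightarrow> ('a \<Rightarrow> 'b::real_normed_vector) \<Rightarrow> bool" where
  "Ck_on 0 = (\<lambda>S f. continuous_on S f)"
| "Ck_on (Suc k) = (\<lambda>S f. (\<forall>x\<in>S. f differentiable (at x)) \<and>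
      (\<forall>v. Ck_on k S (\<lambda>x. frechet_derivative f (at x) v)))"

definition smooth_on :: "'a::euclidean_space set \<Rightarrow> ('a \<Rightarrow> 'b::real_normed_vector) \<Rightarrow> bool" where
  "smooth_on S f \<longleftrightarrow> (\<forall>k. Ck_on k S f)"

text \<open>A chart \<open>(U, x)\<close> is a coordinate map \<open>x\<close> with domain \<open>U\<close>; the values of \<open>x\<close> outside \<open>U\<close>
  are irrelevant. A smooth manifold is a Hausdorff, second countable type together with a smooth
  atlas (not required to be maximal); its dimension is that of the model space \<open>'e\<close>.\<close>

type_synonym ('g, 'e) chart = "'g set \<times> ('g \<Rightarrow> 'e)"

definition smooth_atlas ::
  "('g::{t2_space,second_countable_topology}, 'e::euclidean_space) chart set \<Rightarrow> bool" where
  "smooth_atlas A \<longleftrightarrow>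
     (\<Union>(U, x)\<in>A. U) = UNIV \<and>
     (\<forall>(U, x)\<in>A. open U \<and> open (x ` U) \<and> homeomorphism U (x ` U) x (inv_into U x)) \<and>
     (\<forall>(U, x)\<in>A. \<forall>(V, y)\<in>A. smooth_on (x ` (U \<inter> V)) (y \<circ> inv_into U x))"

definition smooth_map ::
  "('g::topological_space, 'e::euclidean_space) chart set \<Rightarrow>
   ('h::topological_space, 'f::euclidean_space) chart set \<Rightarrow> ('g \<Rightarrow> 'h) \<Rightarrow> bool" where
  "smooth_map A B F \<longleftrightarrow>
     continuous_on UNIV F \<and>
     (\<forall>(U, x)\<in>A. \<forall>(V, y)\<in>B. smooth_on (x ` (U \<inter> F -` V)) (y \<circ> F \<circ> inv_into U x))"

definition euclidean_atlas :: "('e, 'e::euclidean_space) chart set" where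
  "euclidean_atlas = {(UNIV, id)}"

definition prod_atlas ::
  "('g, 'e) chart set \<Rightarrow> ('h, 'f) chart set \<Rightarrow> ('g \<times> 'h, 'e \<times> 'f) chart set" where
  "prod_atlas A B = {(U \<times> V, map_prod x y) | U x V y. (U, x) \<in> A \<and> (V, y) \<in> B}"

definition smooth_functions ::
  "('g::topological_space, 'e::euclidean_space) chart set \<Rightarrow> ('g \<Rightarrow> real) set" where
  "smooth_functions A = {f. smooth_map A euclidean_atlas f}"

record ('g, 'e) smooth_group = "'g monoid" +
  atlas :: "('g, 'e) chart set"

definition lie_group ::
  "('g::{t2_space,second_countable_topology}, 'e::euclidean_space) smooth_group \<Rightarrow> bool" where
  "lie_group G \<longleftrightarrow>
     group G \<and> carrier G = UNIV \<and> smooth_atlas (atlas G) \<and>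
     smooth_map (prod_atlas (atlas G) (atlas G)) (atlas G) (\<lambda>(a, b). a \<otimes>\<^bsub>G\<^esub> b) \<and>
     smooth_map (atlas G) (atlas G) (\<lambda>a. inv\<^bsub>G\<^esub> a)"

definition lie_group_isomorphic ::
  "('g::topological_space, 'e::euclidean_space) smooth_group \<Rightarrow>
   ('h::topological_space, 'f::euclidean_space) smooth_group \<Rightarrow> bool" where
  "lie_group_isomorphic G H \<longleftrightarrow>
     (\<exists>F \<in> iso G H. smooth_map (atlas G) (atlas H) F \<and>
        smooth_map (atlas H) (atlas G) (inv_into (carrier G) F))"

section \<open>Vector fields and tensor fields\<close>

text \<open>Vector fields are the derivations of the algebra of smooth functions, extended by \<open>0\<close> to
  all functions so that equality of fields is equality of HOL functions. Sums, differences and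
  products of functions and fields are the pointwise ones of \<^theory>\<open>HOL-Library.Function_Algebras\<close>.\<close>

type_synonym 'g vfield = "('g \<Rightarrow> real) \<Rightarrow> ('g \<Rightarrow> real)"

definition vector_fields ::
  "('g::topological_space, 'e::euclidean_space) chart set \<Rightarrow> 'g vfield set" where
  "vector_fields A = {X.
     (\<forall>f\<in>smooth_functions A. X f \<in> smooth_functions A) \<and>
     (\<forall>f. f \<notin> smooth_functions A \<longrightarrow> X f = 0) \<and>
     (\<forall>f\<in>smooth_functions A. \<forall>h\<in>smooth_functions A.
        X (f + h) = X f + X h \<and> X (f * h) = X f * h + f * X h) \<and>
     (\<forall>c. \<forall>f\<in>smooth_functions A. X (\<lambda>p. c * f p) = (\<lambda>p. c * X f p))}"

definition fun_scale :: "('g \<Rightarrow> real) \<Rightarrow> 'g vfield \<Rightarrow> 'g vfield" where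
  "fun_scale h X = (\<lambda>f. h * X f)"

definition vf_scale :: "real \<Rightarrow> 'g vfield \<Rightarrow> 'g vfield" where
  "vf_scale c = fun_scale (\<lambda>p. c)"

interpretation vf: vector_space "vf_scale :: real \<Rightarrow> 'g vfield \<Rightarrow> 'g vfield"
  by unfold_locales (auto simp: vf_scale_def fun_scale_def fun_eq_iff algebra_simps)

definition lie_bracket :: "'g vfield \<Rightarrow> 'g vfield \<Rightarrow> 'g vfield" where
  "lie_bracket X Y = (\<lambda>f. X (Y f) - Y (X f))"

definition nonzero_at ::
  "('g::topological_space, 'e::euclidean_space) chart set \<Rightarrow> 'g vfield \<Rightarrow> 'g \<Rightarrow> bool" where
  "nonzero_at A X p \<longleftrightarrow> (\<exists>f\<in>smooth_functions A. X f p \<noteq> 0)"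

text \<open>Tensor fields are maps on vector fields that are linear over the smooth functions in each
  argument. Their values on arguments that are not vector fields are irrelevant.\<close>

definition endomorphism_field ::
  "('g::topological_space, 'e::euclidean_space) chart set \<Rightarrow> ('g vfield \<Rightarrow> 'g vfield) \<Rightarrow> bool" where
  "endomorphism_field A T \<longleftrightarrow>
     (\<forall>X\<in>vector_fields A. T X \<in> vector_fields A \<and>
        (\<forall>Y\<in>vector_fields A. T (X + Y) = T X + T Y) \<and>
        (\<forall>h\<in>smooth_functions A. T (fun_scale h X) = fun_scale h (T X)))"

definition one_form ::
  "('g::topological_space, 'e::euclidean_space) chart set \<Rightarrow> ('g vfield \<Rightarrow> 'g \<Rightarrow> real) \<Rightarrow> bool" where
  "one_form A \<alpha> \<longleftrightarrow>
     (\<forall>X\<in>vector_fields A. \<alpha> X \<in> smooth_functions A \<and>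
        (\<forall>Y\<in>vector_fields A. \<alpha> (X + Y) = \<alpha> X + \<alpha> Y) \<and>
        (\<forall>h\<in>smooth_functions A. \<alpha> (fun_scale h X) = h * \<alpha> X))"

definition riemannian_metric ::
  "('g::topological_space, 'e::euclidean_space) chart set \<Rightarrow>
   ('g vfield \<Rightarrow> 'g vfield \<Rightarrow> 'g \<Rightarrow> real) \<Rightarrow> bool" where
  "riemannian_metric A g \<longleftrightarrow>
     (\<forall>X\<in>vector_fields A. one_form A (g X)) \<and>
     (\<forall>X\<in>vector_fields A. \<forall>Y\<in>vector_fields A. g X Y = g Y X) \<and>
     (\<forall>X\<in>vector_fields A. \<forall>p. nonzero_at A X p \<longrightarrow> g X X p > 0)"

section \<open>Exterior calculus\<close>

definition ext_deriv1 :: "('g vfield \<Rightarrow> 'g \<Rightarrow> real) \<Rightarrow> 'g vfield \<Rightarrow> 'g vfield \<Rightarrow> 'g \<Rightarrow> real" where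
  "ext_deriv1 \<alpha> X Y = X (\<alpha> Y) - Y (\<alpha> X) - \<alpha> (lie_bracket X Y)"

definition ext_deriv2 :: "('g vfield \<Rightarrow> 'g vfield \<Rightarrow> 'g \<Rightarrow> real) \<Rightarrow>
    'g vfield \<Rightarrow> 'g vfield \<Rightarrow> 'g vfield \<Rightarrow> 'g \<Rightarrow> real" where
  "ext_deriv2 \<omega> X Y Z =
     X (\<omega> Y Z) - Y (\<omega> X Z) + Z (\<omega> X Y)
     - \<omega> (lie_bracket X Y) Z + \<omega> (lie_bracket X Z) Y - \<omega> (lie_bracket Y Z) X"

text \<open>For wedge products, a \<open>k\<close>-form takes a sequence of vector fields of which it uses the
  entries with indices \<open>0, \<dots>, k - 1\<close>. The wedge product is normalised as in
  \<open>(\<alpha> \<and> \<beta>)(X, Y) = \<alpha> X * \<beta> Y - \<alpha> Y * \<beta> X\<close>, in accordance with \<^const>\<open>ext_deriv1\<close>.\<close>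

type_synonym 'g form = "(nat \<Rightarrow> 'g vfield) \<Rightarrow> 'g \<Rightarrow> real"

definition wedge :: "nat \<Rightarrow> nat \<Rightarrow> 'g form \<Rightarrow> 'g form \<Rightarrow> 'g form" where
  "wedge k l \<alpha> \<beta> Z p =
     (\<Sum>\<sigma> | \<sigma> permutes {..<k + l}.
        of_int (sign \<sigma>) * \<alpha> (\<lambda>i. Z (\<sigma> i)) p * \<beta> (\<lambda>i. Z (\<sigma> (k + i))) p) / (fact k * fact l)"

primrec wedge_power :: "nat \<Rightarrow> 'g form \<Rightarrow> nat \<Rightarrow> 'g form" where
  "wedge_power k \<alpha> 0 = (\<lambda>Z p. 1)"
| "wedge_power k \<alpha> (Suc m) = wedge k (m * k) \<alpha> (wedge_power k \<alpha> m)"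

definition maximal_rank ::
  "('g::topological_space, 'e::euclidean_space) chart set \<Rightarrow> nat \<Rightarrow> ('g vfield \<Rightarrow> 'g \<Rightarrow> real) \<Rightarrow> bool"
  where
  "maximal_rank A n \<eta> \<longleftrightarrow>
     (\<forall>p. \<exists>Z. (\<forall>i. Z i \<in> vector_fields A) \<and>
        wedge 1 (2 * n) (\<lambda>Z. \<eta> (Z 0))
          (wedge_power 2 (\<lambda>Z. ext_deriv1 \<eta> (Z 0) (Z 1)) n) Z p \<noteq> 0)"

section \<open>Almost contact metric and quasi-Sasakian structures\<close>

definition almost_contact_metric ::
  "('g::topological_space, 'e::euclidean_space) chart set \<Rightarrow> ('g vfield \<Rightarrow> 'g vfield) \<Rightarrow>
   'g vfield \<Rightarrow> ('g vfield \<Rightarrow> 'g \<Rightarrow> real) \<Rightarrow> ('g vfield \<Rightarrow> 'g vfield \<Rightarrow> 'g \<Rightarrow> real) \<Rightarrow> bool" where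
  "almost_contact_metric A \<phi> \<xi> \<eta> g \<longleftrightarrow>
     odd DIM('e) \<and>
     endomorphism_field A \<phi> \<and> \<xi> \<in> vector_fields A \<and> one_form A \<eta> \<and> riemannian_metric A g \<and>
     (\<forall>X\<in>vector_fields A. \<phi> (\<phi> X) = - X + fun_scale (\<eta> X) \<xi>) \<and>
     \<eta> \<xi> = 1 \<and>
     (\<forall>X\<in>vector_fields A. \<forall>Y\<in>vector_fields A. g (\<phi> X) (\<phi> Y) = g X Y - \<eta> X * \<eta> Y)"

definition fundamental_form :: "('g vfield \<Rightarrow> 'g vfield) \<Rightarrow>
    ('g vfield \<Rightarrow> 'g vfield \<Rightarrow> 'g \<Rightarrow> real) \<Rightarrow> 'g vfield \<Rightarrow> 'g vfield \<Rightarrow> 'g \<Rightarrow> real" where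
  "fundamental_form \<phi> g X Y = g X (\<phi> Y)"

definition nijenhuis :: "('g vfield \<Rightarrow> 'g vfield) \<Rightarrow> 'g vfield \<Rightarrow> 'g vfield \<Rightarrow> 'g vfield" where
  "nijenhuis \<phi> X Y =
     lie_bracket (\<phi> X) (\<phi> Y) + \<phi> (\<phi> (lie_bracket X Y))
     - \<phi> (lie_bracket X (\<phi> Y)) - \<phi> (lie_bracket (\<phi> X) Y)"

definition quasi_sasakian ::
  "('g::topological_space, 'e::euclidean_space) chart set \<Rightarrow> ('g vfield \<Rightarrow> 'g vfield) \<Rightarrow>
   'g vfield \<Rightarrow> ('g vfield \<Rightarrow> 'g \<Rightarrow> real) \<Rightarrow> ('g vfield \<Rightarrow> 'g vfield \<Rightarrow> 'g \<Rightarrow> real) \<Rightarrow> bool" where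
  "quasi_sasakian A \<phi> \<xi> \<eta> g \<longleftrightarrow>
     almost_contact_metric A \<phi> \<xi> \<eta> g \<and>
     (\<forall>X\<in>vector_fields A. \<forall>Y\<in>vector_fields A. \<forall>Z\<in>vector_fields A.
        ext_deriv2 (fundamental_form \<phi> g) X Y Z = 0) \<and>
     (\<forall>X\<in>vector_fields A. \<forall>Y\<in>vector_fields A.
        nijenhuis \<phi> X Y + fun_scale (ext_deriv1 \<eta> X Y) \<xi> = 0)"

section \<open>Left-invariance and the Lie algebra of a Lie group\<close>

text \<open>\<open>left_push G a X\<close> is the push-forward of \<open>X\<close> along the left translation by \<open>a\<close>. On tensor
  fields, invariance under left translations is expressed by compatibility with push-forward.\<close>

definition left_push :: "('g, 'm) monoid_scheme \<Rightarrow> 'g \<Rightarrow> 'g vfield \<Rightarrow> 'g vfield" where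
  "left_push G a X = (\<lambda>f p. X (\<lambda>x. f (a \<otimes>\<^bsub>G\<^esub> x)) (inv\<^bsub>G\<^esub> a \<otimes>\<^bsub>G\<^esub> p))"

definition left_invariant_structure ::
  "('g::topological_space, 'e::euclidean_space) smooth_group \<Rightarrow> ('g vfield \<Rightarrow> 'g vfield) \<Rightarrow>
   'g vfield \<Rightarrow> ('g vfield \<Rightarrow> 'g \<Rightarrow> real) \<Rightarrow> ('g vfield \<Rightarrow> 'g vfield \<Rightarrow> 'g \<Rightarrow> real) \<Rightarrow> bool" where
  "left_invariant_structure G \<phi> \<xi> \<eta> g \<longleftrightarrow>
     (\<forall>a. left_push G a \<xi> = \<xi>) \<and>
     (\<forall>a. \<forall>X\<in>vector_fields (atlas G).
        \<phi> (left_push G a X) = left_push G a (\<phi> X) \<and>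
        (\<forall>p. \<eta> (left_push G a X) (a \<otimes>\<^bsub>G\<^esub> p) = \<eta> X p) \<and>
        (\<forall>Y\<in>vector_fields (atlas G). \<forall>p.
           g (left_push G a X) (left_push G a Y) (a \<otimes>\<^bsub>G\<^esub> p) = g X Y p))"

definition lie_algebra ::
  "('g::topological_space, 'e::euclidean_space) smooth_group \<Rightarrow> 'g vfield set" where
  "lie_algebra G = {X \<in> vector_fields (atlas G). \<forall>a. left_push G a X = X}"

primrec lower_central :: "'g vfield set \<Rightarrow> nat \<Rightarrow> 'g vfield set" where
  "lower_central L 0 = L"
| "lower_central L (Suc k) = vf.span {lie_bracket X Y | X Y. X \<in> L \<and> Y \<in> lower_central L k}"

definition nilpotent_lie_group ::
  "('g::topological_space, 'e::euclidean_space) smooth_group \<Rightarrow> bool" where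
  "nilpotent_lie_group G \<longleftrightarrow> (\<exists>k. lower_central (lie_algebra G) k = {0})"

section \<open>Weighted Heisenberg groups\<close>

text \<open>The basis \<open>\<xi>, \<tau>\<^sub>1, \<dots>, \<tau>\<^sub>2\<^sub>n\<close> is written \<open>\<tau> 0, \<tau> 1, \<dots>, \<tau> (2 * n)\<close>; only the entries
  \<open>w 1, \<dots>, w n\<close> of the weight sequence are used.\<close>

definition weighted_heisenberg_algebra :: "nat \<Rightarrow> (nat \<Rightarrow> real) \<Rightarrow> 'g vfield set \<Rightarrow> bool" where
  "weighted_heisenberg_algebra n w L \<longleftrightarrow>
     (\<exists>\<tau>. inj_on \<tau> {0..2 * n} \<and> vf.independent (\<tau> ` {0..2 * n}) \<and>
          vf.span (\<tau> ` {0..2 * n}) = L \<and>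
          (\<forall>r\<in>{1..n}. lie_bracket (\<tau> r) (\<tau> (n + r)) = vf_scale (2 * w r) (\<tau> 0)) \<and>
          (\<forall>i\<in>{0..2 * n}. \<forall>j\<in>{0..2 * n}.
             (\<forall>r\<in>{1..n}. (i, j) \<noteq> (r, n + r) \<and> (i, j) \<noteq> (n + r, r)) \<longrightarrow>
             lie_bracket (\<tau> i) (\<tau> j) = 0))"

definition weighted_heisenberg_lie_group :: "nat \<Rightarrow> (nat \<Rightarrow> real) \<Rightarrow>
    ('h::{t2_space,second_countable_topology}, 'e::euclidean_space) smooth_group \<Rightarrow> bool" where
  "weighted_heisenberg_lie_group n w H \<longleftrightarrow>
     lie_group H \<and> simply_connected (UNIV :: 'h set) \<and>
     weighted_heisenberg_algebra n w (lie_algebra H)"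

text \<open>A concrete representative of the isomorphism class: the \<open>(2n+1)\<close>-dimensional Lie algebra
  itself, with \<open>\<xi>, \<tau>\<^sub>1, \<dots>, \<tau>\<^sub>2\<^sub>n\<close> the standard basis, under the Baker-Campbell-Hausdorff product
  \<open>x + y + [x, y] / 2\<close>.\<close>

definition std_basis :: "nat \<Rightarrow> 'e::euclidean_space" where
  "std_basis = (SOME b. bij_betw b {..<DIM('e)} Basis)"

definition heisenberg_group ::
  "nat \<Rightarrow> (nat \<Rightarrow> real) \<Rightarrow> ('e, 'e::euclidean_space) smooth_group" where
  "heisenberg_group n w =
     \<lparr> carrier = UNIV,
       mult = (\<lambda>x y. x + y +
         (\<Sum>r\<in>{1..n}. w r * ((x \<bullet> std_basis r) * (y \<bullet> std_basis (n + r))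
             - (x \<bullet> std_basis (n + r)) * (y \<bullet> std_basis r))) *\<^sub>R std_basis 0),
       one = 0,
       atlas = euclidean_atlas \<rparr>"

end

theory Submission
  imports Defs
begin

text \<open>Left-invariance turns the structure into algebra on the Lie algebra. Normality and \<open>d\<Phi> = 0\<close> make
  \<open>ad \<xi>\<close> skew-symmetric; being nilpotent as well, it vanishes, so \<open>\<xi>\<close> is central. The quotient by \<open>\<xi>\<close>
  is a nilpotent Kaehler Lie algebra and hence abelian. So the bracket is \<open>[X, Y] = - d\<eta>(X, Y) \<xi>\<close>,
  and a Darboux basis for this alternating form provides the weights. By the Maurer-Cartan equation,
  the components of the Maurer-Cartan form transversal to \<open>\<xi>\<close> are closed near the unit, and so is the
  remaining one after a quadratic correction. Their primitives form a local isomorphism of \<open>G\<close> with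
  the Heisenberg group. Its inverse extends to a homomorphism from the whole Heisenberg group,
  which is onto because \<open>G\<close> is connected and injective because \<open>G\<close> is simply connected.\<close>

section \<open>Smooth functions on open subsets of Euclidean spaces\<close>

text \<open>The isomorphism is built by hand from the shape
  \<open>\<omega> v w *\<^sub>R \<xi>\<close> of the bracket. For a central \<xi> the
  Baker-Campbell-Hausdorff series stops after the first commutator, so the target group law is an
  explicit polynomial (\<open>hmul\<close>). Integrating the Maurer-Cartan equation is a Frobenius
  problem in general; here it is triangular and splits into two applications of the Poincare lemma.

  Vector fields are derivations of the algebra of globally defined smooth functions. Their tangent
  vectors become visible only through cutoff coordinate functions, which is what bump functions and
  Hadamard's lemma are for.

  The vanishing of the Kaehler bracket comes from traces: the operators \<open>br x\<close> are
  nilpotent, hence traceless, and a sum of squares turns out to be such a trace.\<close>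

lemma Ck_on_cong:
  assumes "open S" "\<And>x. x \<in> S \<Longrightarrow> f x = g x" "Ck_on k S f"
  shows "Ck_on k S g"
  using assms(2,3)
proof (induction k arbitrary: f g)
  case 0
  then show ?case by (auto intro: continuous_on_eq)
next
  case (Suc k)
  have d: "(g has_derivative frechet_derivative f (at x)) (at x)" if "x \<in> S" for x
    using has_derivative_transform_within_open[OF _ assms(1) that, where f = f and g = g] Suc.prems that
    by (auto simp: frechet_derivative_works)
  have "frechet_derivative f (at x) = frechet_derivative g (at x)" if "x \<in> S" for x
    using frechet_derivative_at[OF d[OF that]] .
  then have "Ck_on k S (\<lambda>x. frechet_derivative g (at x) v)" for v
    using Suc.IH[of "\<lambda>x. frechet_derivative f (at x) v" "\<lambda>x. frechet_derivative g (at x) v"]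
      Suc.prems(2) by simp
  then show ?case using d by (auto simp: differentiable_def)
qed

text \<open>Lets an explicit derivative \<open>f'\<close> replace the Hilbert choice in
  \<open>frechet_derivative\<close>; at the points of \<open>S\<close> the two agree.\<close>

lemma Ck_on_SucI:
  assumes "open S" "\<And>x. x \<in> S \<Longrightarrow> (f has_derivative f' x) (at x)"
    "\<And>v. Ck_on k S (\<lambda>x. f' x v)"
  shows "Ck_on (Suc k) S f"
proof -
  have "Ck_on k S (\<lambda>x. frechet_derivative f (at x) v)" for v
    by (rule Ck_on_cong[OF assms(1) _ assms(3)[of v]])
      (metis assms(2) frechet_derivative_at)
  then show ?thesis using assms(2) by (auto simp: differentiable_def)
qed

lemma Ck_on_SucE:
  assumes "Ck_on (Suc k) S f"
  obtains f' where "\<And>x. x \<in> S \<Longrightarrow> (f has_derivative f' x) (at x)"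
    "\<And>v. Ck_on k S (\<lambda>x. f' x v)"
  using assms that[of "\<lambda>x. frechet_derivative f (at x)"] by (auto simp: frechet_derivative_works)

lemma Ck_on_Suc_imp: "Ck_on (Suc k) S f \<Longrightarrow> Ck_on k S f"
proof (induction k arbitrary: f)
  case 0
  then show ?case
    by (auto intro!: continuous_at_imp_continuous_on differentiable_imp_continuous_within)
next
  case (Suc k)
  then show ?case by (metis Ck_on.simps(2))
qed

lemma Ck_on_subset: "Ck_on k S f \<Longrightarrow> T \<subseteq> S \<Longrightarrow> Ck_on k T f"
  by (induction k arbitrary: f) (auto intro: continuous_on_subset)

lemma Ck_on_local:
  assumes "\<And>x. x \<in> S \<Longrightarrow> \<exists>T. open T \<and> x \<in> T \<and> Ck_on k T f"
  shows "Ck_on k S f"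
  using assms
proof (induction k arbitrary: f)
  case 0
  then show ?case
    by (auto intro!: continuous_at_imp_continuous_on simp: continuous_on_eq_continuous_at)
      (metis continuous_on_eq_continuous_at)
next
  case (Suc k)
  have "f differentiable at x" if "x \<in> S" for x
    using Suc.prems[OF that] by auto
  moreover have "Ck_on k S (\<lambda>x. frechet_derivative f (at x) v)" for v
    by (rule Suc.IH) (use Suc.prems in force)
  ultimately show ?case by simp
qed

lemma Ck_on_const: "open S \<Longrightarrow> Ck_on k S (\<lambda>x. c)"
proof (induction k arbitrary: c)
  case (Suc k)
  show ?case by (rule Ck_on_SucI[where f' = "\<lambda>x v. 0"]) (use Suc in auto)
qed simp

lemma Ck_on_bounded_linear:
  assumes "bounded_linear L" "open S" "Ck_on k S f"
  shows "Ck_on k S (\<lambda>x. L (f x))"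
  using assms(3)
proof (induction k arbitrary: f)
  case 0
  then show ?case using assms(1) by (auto intro: bounded_linear.continuous_on)
next
  case (Suc k)
  from Suc.prems obtain f' where f': "\<And>x. x \<in> S \<Longrightarrow> (f has_derivative f' x) (at x)"
    "\<And>v. Ck_on k S (\<lambda>x. f' x v)" by (rule Ck_on_SucE) blast
  show ?case
    by (rule Ck_on_SucI[where f' = "\<lambda>x v. L (f' x v)"])
      (use f' Suc.IH assms bounded_linear.has_derivative[OF assms(1) f'(1)] in auto)
qed

lemma Ck_on_add:
  assumes "open S" "Ck_on k S f" "Ck_on k S g"
  shows "Ck_on k S (\<lambda>x. f x + g x)"
  using assms(2,3)
proof (induction k arbitrary: f g)
  case 0
  then show ?case by (auto intro: continuous_intros)
next
  case (Suc k)
  from Suc.prems(1) obtain f' where f': "\<And>x. x \<in> S \<Longrightarrow> (f has_derivative f' x) (at x)"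
    "\<And>v. Ck_on k S (\<lambda>x. f' x v)" by (rule Ck_on_SucE) blast
  from Suc.prems(2) obtain g' where g': "\<And>x. x \<in> S \<Longrightarrow> (g has_derivative g' x) (at x)"
    "\<And>v. Ck_on k S (\<lambda>x. g' x v)" by (rule Ck_on_SucE) blast
  show ?case
    by (rule Ck_on_SucI[where f' = "\<lambda>x v. f' x v + g' x v"])
      (use f' g' Suc.IH assms in \<open>auto intro: has_derivative_add\<close>)
qed

lemma Ck_on_bounded_bilinear:
  assumes "bounded_bilinear B" "open S" "Ck_on k S f" "Ck_on k S g"
  shows "Ck_on k S (\<lambda>x. B (f x) (g x))"
  using assms(3,4)
proof (induction k arbitrary: f g)
  case 0
  then show ?case using assms(1) by (auto intro: bounded_bilinear.continuous_on)
next
  case (Suc k)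
  from Suc.prems(1) obtain f' where f': "\<And>x. x \<in> S \<Longrightarrow> (f has_derivative f' x) (at x)"
    "\<And>v. Ck_on k S (\<lambda>x. f' x v)" by (rule Ck_on_SucE) blast
  from Suc.prems(2) obtain g' where g': "\<And>x. x \<in> S \<Longrightarrow> (g has_derivative g' x) (at x)"
    "\<And>v. Ck_on k S (\<lambda>x. g' x v)" by (rule Ck_on_SucE) blast
  show ?case
  proof (rule Ck_on_SucI[where f' = "\<lambda>x v. B (f x) (g' x v) + B (f' x v) (g x)"])
    show "((\<lambda>x. B (f x) (g x)) has_derivative (\<lambda>v. B (f x) (g' x v) + B (f' x v) (g x))) (at x)"
      if "x \<in> S" for x
      using bounded_bilinear.FDERIV[OF assms(1) f'(1) g'(1)] that by blast
    show "Ck_on k S (\<lambda>x. B (f x) (g' x v) + B (f' x v) (g x))" for v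
      by (intro Ck_on_add Suc.IH) (use assms f' g' Suc.prems Ck_on_Suc_imp in blast)+
  qed (use assms in auto)
qed

lemma Ck_on_sum:
  assumes "open S" "\<And>i. i \<in> I \<Longrightarrow> Ck_on k S (f i)"
  shows "Ck_on k S (\<lambda>x. \<Sum>i\<in>I. f i x)"
  using assms(2)
  by (induction I rule: infinite_finite_induct) (auto intro: Ck_on_const Ck_on_add assms(1))

lemma linear_sum_Basis:
  fixes y :: "'a::euclidean_space"
  assumes "linear L"
  shows "L y = (\<Sum>b\<in>Basis. (y \<bullet> b) *\<^sub>R L b)"
  by (subst euclidean_representation[symmetric, of y], subst linear_sum[OF assms])
    (simp add: linear_cmul[OF assms])

text \<open>Operator-valued maps are handled through their values on fixed vectors only. Expanding
  \<open>y p\<close> in the standard basis turns the application into a sum of products of scalar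
  and vector functions.\<close>

lemma Ck_on_linear_apply:
  fixes y :: "'a::euclidean_space \<Rightarrow> 'b::euclidean_space"
  assumes "open S" "\<And>p. p \<in> S \<Longrightarrow> linear (B p)" "\<And>z. Ck_on k S (\<lambda>p. B p z)" "Ck_on k S y"
  shows "Ck_on k S (\<lambda>p. B p (y p))"
proof (rule Ck_on_cong[OF assms(1)])
  show "Ck_on k S (\<lambda>p. \<Sum>b\<in>Basis. (y p \<bullet> b) *\<^sub>R B p b)"
    by (intro Ck_on_sum Ck_on_bounded_bilinear[OF bounded_bilinear_scaleR]
        Ck_on_bounded_linear[OF bounded_linear_inner_left] assms)
qed (rule linear_sum_Basis[symmetric], rule assms(2))

lemma has_derivative_linear_apply:
  fixes y :: "'a::euclidean_space \<Rightarrow> 'b::euclidean_space"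
  assumes "open S" "p \<in> S" "\<And>p. p \<in> S \<Longrightarrow> linear (B p)"
    "\<And>z. ((\<lambda>p. B p z) has_derivative B' z) (at p)" "(y has_derivative y') (at p)"
  shows "((\<lambda>p. B p (y p)) has_derivative (\<lambda>u. B' (y p) u + B p (y' u))) (at p)"
proof -
  \<comment> \<open>\<open>B'\<close> is given separately for each vector \<open>z\<close>;
    uniqueness of derivatives shows that it depends linearly on \<open>z\<close>.\<close>
  have B': "B' (y p) u = (\<Sum>b\<in>Basis. (y p \<bullet> b) *\<^sub>R B' b u)" for u
  proof -
    have "((\<lambda>q. \<Sum>b\<in>Basis. (y p \<bullet> b) *\<^sub>R B q b) has_derivative
        (\<lambda>u. \<Sum>b\<in>Basis. (y p \<bullet> b) *\<^sub>R B' b u)) (at p)"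
      by (intro has_derivative_sum has_derivative_scaleR_right assms)
    then have "((\<lambda>q. B q (y p)) has_derivative (\<lambda>u. \<Sum>b\<in>Basis. (y p \<bullet> b) *\<^sub>R B' b u)) (at p)"
      by (rule has_derivative_transform_within_open[OF _ assms(1,2)])
        (rule linear_sum_Basis[symmetric], rule assms(3))
    from has_derivative_unique[OF assms(4)[of "y p"] this] show ?thesis by (rule fun_cong)
  qed
  have "((\<lambda>q. \<Sum>b\<in>Basis. (y q \<bullet> b) *\<^sub>R B q b) has_derivative
        (\<lambda>u. \<Sum>b\<in>Basis. (y p \<bullet> b) *\<^sub>R B' b u + (y' u \<bullet> b) *\<^sub>R B p b)) (at p)"
    by (intro has_derivative_sum has_derivative_scaleR has_derivative_inner_left assms)
  then have "((\<lambda>q. B q (y q)) has_derivative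
        (\<lambda>u. \<Sum>b\<in>Basis. (y p \<bullet> b) *\<^sub>R B' b u + (y' u \<bullet> b) *\<^sub>R B p b)) (at p)"
    by (rule has_derivative_transform_within_open[OF _ assms(1,2)])
      (rule linear_sum_Basis[symmetric], rule assms(3))
  then show ?thesis
    unfolding sum.distrib B'[symmetric] linear_sum_Basis[OF assms(3)[OF assms(2)], symmetric] .
qed

text \<open>The derivative \<open>g' (f x) (f' x v)\<close> applies a point-dependent linear map to
  a vector, so \<open>Ck_on_linear_apply\<close> closes the induction. \<open>g\<close> has to vary
  because the induction hypothesis is used for \<open>\<lambda>y. g' y z\<close>.\<close>

lemma Ck_on_compose:
  fixes f :: "'a::euclidean_space \<Rightarrow> 'b::euclidean_space"
  assumes "open S" "open T" "f ` S \<subseteq> T" "Ck_on k S f" "Ck_on k T g"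
  shows "Ck_on k S (\<lambda>x. g (f x))"
  using assms(4,5)
proof (induction k arbitrary: g)
  case 0
  then show ?case using assms(3) by (auto intro: continuous_on_compose2)
next
  case (Suc k)
  from Suc.prems(1) obtain f' where f': "\<And>x. x \<in> S \<Longrightarrow> (f has_derivative f' x) (at x)"
    "\<And>v. Ck_on k S (\<lambda>x. f' x v)" by (rule Ck_on_SucE) blast
  from Suc.prems(2) obtain g' where g': "\<And>x. x \<in> T \<Longrightarrow> (g has_derivative g' x) (at x)"
    "\<And>v. Ck_on k T (\<lambda>x. g' x v)" by (rule Ck_on_SucE) blast
  show ?case
  proof (rule Ck_on_SucI[where f' = "\<lambda>x v. g' (f x) (f' x v)"])
    show "((\<lambda>x. g (f x)) has_derivative (\<lambda>v. g' (f x) (f' x v))) (at x)" if "x \<in> S" for x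
      using f'(1)[OF that] g'(1)[of "f x"] that assms(3)
      by (intro has_derivative_compose[of f _ _ _ g]) (auto)
    show "Ck_on k S (\<lambda>x. g' (f x) (f' x v))" for v
    proof (rule Ck_on_linear_apply[OF assms(1)])
      show "linear (g' (f p))" if "p \<in> S" for p
        using g'(1)[of "f p"] that assms(3) has_derivative_linear by blast
      show "Ck_on k S (\<lambda>p. g' (f p) z)" for z
        using Suc.IH[OF Ck_on_Suc_imp[OF Suc.prems(1)] g'(2)] .
    qed (rule f')
  qed (use assms in auto)
qed

lemma smooth_onI:
  assumes "open S" "\<And>x. x \<in> S \<Longrightarrow> (f has_derivative f' x) (at x)"
    "\<And>v. smooth_on S (\<lambda>x. f' x v)"
  shows "smooth_on S f"
  unfolding smooth_on_def
proof
  fix k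
  have "Ck_on (Suc k) S f" for k
    by (rule Ck_on_SucI) (use assms in \<open>auto simp: smooth_on_def\<close>)
  then show "Ck_on k S f" using Ck_on_Suc_imp by blast
qed

lemma smooth_onE:
  assumes "smooth_on S f"
  obtains f' where "\<And>x. x \<in> S \<Longrightarrow> (f has_derivative f' x) (at x)"
    "\<And>v. smooth_on S (\<lambda>x. f' x v)"
proof (rule that[of "\<lambda>x. frechet_derivative f (at x)"])
  have *: "Ck_on (Suc k) S f" for k using assms unfolding smooth_on_def ..
  show "(f has_derivative frechet_derivative f (at x)) (at x)" if "x \<in> S" for x
    using *[of 0] that by (simp add: frechet_derivative_works)
  show "smooth_on S (\<lambda>x. frechet_derivative f (at x) v)" for v
    using * by (simp add: smooth_on_def)
qed

lemma smooth_on_has_derivative: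
  assumes "smooth_on S f" "x \<in> S"
  shows "(f has_derivative frechet_derivative f (at x)) (at x)"
  using assms by (metis smooth_onE frechet_derivative_works differentiable_def)

lemma smooth_on_frechet_derivative:
  assumes "smooth_on S f"
  shows "smooth_on S (\<lambda>x. frechet_derivative f (at x) v)"
  using assms unfolding smooth_on_def by (metis Ck_on.simps(2))

lemma smooth_on_continuous_on: "smooth_on S f \<Longrightarrow> continuous_on S f"
  unfolding smooth_on_def by (metis Ck_on.simps(1))

lemma smooth_on_cong:
  "open S \<Longrightarrow> (\<And>x. x \<in> S \<Longrightarrow> f x = g x) \<Longrightarrow> smooth_on S f \<Longrightarrow> smooth_on S g"
  unfolding smooth_on_def using Ck_on_cong by metis

lemma smooth_on_subset: "smooth_on S f \<Longrightarrow> T \<subseteq> S \<Longrightarrow> smooth_on T f"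
  unfolding smooth_on_def using Ck_on_subset by blast

lemma smooth_on_local:
  "(\<And>x. x \<in> S \<Longrightarrow> \<exists>T. open T \<and> x \<in> T \<and> smooth_on T f) \<Longrightarrow> smooth_on S f"
  unfolding smooth_on_def by (intro allI Ck_on_local) blast

lemma smooth_on_const: "open S \<Longrightarrow> smooth_on S (\<lambda>x. c)"
  unfolding smooth_on_def using Ck_on_const by blast

lemma smooth_on_bounded_linear:
  "bounded_linear L \<Longrightarrow> open S \<Longrightarrow> smooth_on S f \<Longrightarrow> smooth_on S (\<lambda>x. L (f x))"
  unfolding smooth_on_def using Ck_on_bounded_linear by blast

lemma smooth_on_add:
  "open S \<Longrightarrow> smooth_on S f \<Longrightarrow> smooth_on S g \<Longrightarrow> smooth_on S (\<lambda>x. f x + g x)"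
  unfolding smooth_on_def using Ck_on_add by blast

lemma smooth_on_bounded_bilinear:
  "bounded_bilinear B \<Longrightarrow> open S \<Longrightarrow> smooth_on S f \<Longrightarrow> smooth_on S g \<Longrightarrow>
    smooth_on S (\<lambda>x. B (f x) (g x))"
  unfolding smooth_on_def using Ck_on_bounded_bilinear by blast

lemma smooth_on_compose:
  fixes f :: "'a::euclidean_space \<Rightarrow> 'b::euclidean_space"
  shows "open S \<Longrightarrow> open T \<Longrightarrow> f ` S \<subseteq> T \<Longrightarrow> smooth_on S f \<Longrightarrow> smooth_on T g \<Longrightarrow>
    smooth_on S (\<lambda>x. g (f x))"
  unfolding smooth_on_def using Ck_on_compose by blast

lemma smooth_on_sum:
  "open S \<Longrightarrow> (\<And>i. i \<in> I \<Longrightarrow> smooth_on S (f i)) \<Longrightarrow> smooth_on S (\<lambda>x. \<Sum>i\<in>I. f i x)"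
  unfolding smooth_on_def by (intro allI Ck_on_sum) auto

lemma smooth_on_id: "open S \<Longrightarrow> smooth_on S (\<lambda>x. x)"
  by (rule smooth_onI[where f' = "\<lambda>x v. v"]) (auto intro: smooth_on_const)

lemmas smooth_on_linear = smooth_on_bounded_linear[OF _ _ smooth_on_id]
lemmas smooth_on_scaleR = smooth_on_bounded_bilinear[OF bounded_bilinear_scaleR]
lemmas smooth_on_mult = smooth_on_bounded_bilinear[OF bounded_bilinear_mult]
lemmas smooth_on_inner = smooth_on_bounded_bilinear[OF bounded_bilinear_inner]

lemma smooth_on_diff:
  assumes "open S" "smooth_on S f" "smooth_on S g"
  shows "smooth_on S (\<lambda>x. f x - g x)"
  using smooth_on_add[OF assms(1,2) smooth_on_bounded_linear[OF
      bounded_linear_minus[OF bounded_linear_ident] assms(1,3)]] by simp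

lemma smooth_on_Pair:
  assumes "open S" "smooth_on S f" "smooth_on S g"
  shows "smooth_on S (\<lambda>x. (f x, g x))"
proof -
  have "bounded_linear (\<lambda>x. (x, 0))" "bounded_linear (\<lambda>x. (0, x))"
    by (auto intro: bounded_linear_Pair bounded_linear_ident bounded_linear_zero)
  then have "smooth_on S (\<lambda>x. (f x, 0) + (0, g x))"
    by (intro smooth_on_add[OF assms(1)])
      (use assms smooth_on_bounded_linear[of "\<lambda>x. (x, 0)" S f]
        smooth_on_bounded_linear[of "\<lambda>x. (0, x)" S g] in auto)
  then show ?thesis by simp
qed

lemmas smooth_intros = smooth_on_const smooth_on_id smooth_on_add smooth_on_diff smooth_on_scaleR
  smooth_on_mult smooth_on_inner smooth_on_sum smooth_on_Pair

text \<open>The derivative is a polynomial in \<open>inverse\<close> itself, which closes the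
  induction on \<open>k\<close>.\<close>

lemma smooth_on_inverse:
  "smooth_on {x. x \<noteq> (0::real)} inverse"
  unfolding smooth_on_def
proof
  fix k
  have o: "open {x. x \<noteq> (0::real)}" by (simp add: open_Collect_neq)
  show "Ck_on k {x. x \<noteq> (0::real)} inverse"
  proof (induction k)
    case 0
    then show ?case by (auto intro!: continuous_intros)
  next
    case (Suc k)
    show ?case
    proof (rule Ck_on_SucI[OF o, where f' = "\<lambda>x v. - v * (inverse x * inverse x)"])
      show "(inverse has_derivative (\<lambda>v. - v * (inverse x * inverse x))) (at x)"
        if "x \<in> {x. x \<noteq> (0::real)}" for x
        using that by (auto intro!: derivative_eq_intros)
      show "Ck_on k {x. x \<noteq> (0::real)} (\<lambda>x. - v * (inverse x * inverse x))" for v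
        by (intro Ck_on_bounded_bilinear[OF bounded_bilinear_mult o] Ck_on_const[OF o] Suc)
    qed
  qed
qed

section \<open>Bump functions\<close>

text \<open>This family is closed under differentiation, so that its smoothness follows by induction.\<close>

definition psi :: "real poly \<Rightarrow> real \<Rightarrow> real" where
  "psi P x = (if x > 0 then poly P (1 / x) * exp (- (1 / x)) else 0)"

lemma psi_tendsto_0: "psi P \<midarrow>0\<rightarrow> 0"
proof -
  have "((\<lambda>y. \<Sum>i\<le>degree P. coeff P i * (y ^ i / exp y)) \<longlongrightarrow> (\<Sum>i\<le>degree P. coeff P i * 0)) at_top"
    by (intro tendsto_sum tendsto_mult tendsto_const tendsto_power_div_exp_0)
  then have "((\<lambda>y. poly P y * exp (- y)) \<longlongrightarrow> 0) at_top"
    by (simp add: poly_altdef exp_minus field_simps sum_divide_distrib)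
  from filterlim_compose[OF this filterlim_inverse_at_top_right]
  have "((\<lambda>x. poly P (1 / x) * exp (- (1 / x))) \<longlongrightarrow> 0) (at_right 0)"
    by (simp add: inverse_eq_divide)
  moreover have "\<forall>\<^sub>F x in at_right 0. poly P (1 / x) * exp (- (1 / x)) = psi P x"
    by (auto simp: eventually_at_filter psi_def)
  ultimately have "(psi P \<longlongrightarrow> 0) (at_right 0)"
    by (rule Lim_transform_eventually)
  moreover have "(psi P \<longlongrightarrow> 0) (at_left 0)"
    by (rule Lim_transform_eventually[OF tendsto_const])
      (auto simp: eventually_at_filter psi_def)
  ultimately show ?thesis by (simp add: filterlim_split_at)
qed

text \<open>With y = 1/x, the derivative of P(y) exp(-y) in x is y^2 (P(y) - P'(y)) exp(-y), and
  \<open>[:0, 0, 1:]\<close> is the polynomial y^2. At 0 the difference quotient is again a member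
  of the family, so \<open>psi_tendsto_0\<close> gives its limit.\<close>

lemma psi_has_derivative:
  "(psi P has_real_derivative psi ([:0, 0, 1:] * (P - pderiv P)) x) (at x)"
proof (rule linorder_cases[of x 0])
  assume x: "x < 0"
  have "((\<lambda>x. 0) has_real_derivative psi ([:0, 0, 1:] * (P - pderiv P)) x) (at x)"
    using x by (simp add: psi_def)
  then show ?thesis
    by (rule DERIV_cong_ev[THEN iffD1, rotated -1, OF _ refl _ refl])
      (use x eventually_nhds_in_open[of "{..<0}" x] in
        \<open>auto simp: psi_def elim!: eventually_mono\<close>)
next
  assume x: "x > 0"
  have "((\<lambda>x. poly P (1 / x) * exp (- (1 / x))) has_real_derivative
      psi ([:0, 0, 1:] * (P - pderiv P)) x) (at x)"
    using x by (auto intro!: derivative_eq_intros simp: psi_def field_simps power2_eq_square)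
  then show ?thesis
    by (rule DERIV_cong_ev[THEN iffD1, rotated -1, OF _ refl _ refl])
      (use x eventually_nhds_in_open[of "{0<..}" x] in
        \<open>auto simp: psi_def elim!: eventually_mono\<close>)
next
  assume x: "x = 0"
  have "(\<lambda>h. psi P h / h) = psi ([:0, 1:] * P)"
    by (auto simp: psi_def fun_eq_iff)
  then show ?thesis
    using psi_tendsto_0[of "[:0, 1:] * P"] x by (simp add: DERIV_def psi_def)
qed

lemma smooth_on_psi: "smooth_on UNIV (psi P)"
  unfolding smooth_on_def
proof
  fix k
  show "Ck_on k UNIV (psi P)"
  proof (induction k arbitrary: P)
    case 0
    show ?case
      by (simp add: DERIV_isCont[OF psi_has_derivative] continuous_at_imp_continuous_on)
  next
    case (Suc k)
    show ?case
      by (rule Ck_on_SucI[where f' = "\<lambda>x v. psi ([:0, 0, 1:] * (P - pderiv P)) x * v"])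
        (use psi_has_derivative Suc in \<open>auto simp: has_field_derivative_def
          intro!: Ck_on_bounded_bilinear[OF bounded_bilinear_mult] Ck_on_const\<close>)
  qed
qed

lemma bump_function:
  fixes r s :: real
  assumes "0 < r" "r < s"
  obtains \<rho> :: "'a::euclidean_space \<Rightarrow> real" where "smooth_on UNIV \<rho>"
    "\<And>p. norm p \<le> r \<Longrightarrow> \<rho> p = 1" "\<And>p. norm p \<ge> s \<Longrightarrow> \<rho> p = 0"
proof -
  \<comment> \<open>\<open>psi 1\<close> is exp(-1/x) on the positive axis. So \<open>u\<close>
    lives inside radius \<open>s\<close>, \<open>v\<close> outside radius \<open>r\<close>, and they
    have no common zero because \<open>r < s\<close>. Squared norms keep both smooth at the
    origin.\<close>
  define u v w where "u p = psi 1 (s\<^sup>2 - p \<bullet> p)" and "v p = psi 1 (p \<bullet> p - r\<^sup>2)"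
    and "w p = u p + v p" for p :: 'a
  have nn: "psi 1 x \<ge> 0" "psi 1 x > 0 \<longleftrightarrow> x > 0" for x by (auto simp: psi_def)
  have rs: "r\<^sup>2 < s\<^sup>2" using assms by (simp add: power_strict_mono)
  have u: "smooth_on UNIV u" unfolding u_def
    by (rule smooth_on_compose[OF open_UNIV open_UNIV _ _ smooth_on_psi])
      (auto intro!: smooth_intros)
  have v: "smooth_on UNIV v" unfolding v_def
    by (rule smooth_on_compose[OF open_UNIV open_UNIV _ _ smooth_on_psi])
      (auto intro!: smooth_intros)
  have w: "smooth_on UNIV w" unfolding w_def by (intro smooth_intros u v) auto
  have w0: "w p \<noteq> 0" for p
  proof -
    have "u p > 0 \<or> v p > 0" using rs by (auto simp: u_def v_def nn)
    then show ?thesis using nn(1) by (smt (verit) u_def v_def w_def)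
  qed
  show thesis
  proof
    show "smooth_on UNIV (\<lambda>p. u p * inverse (w p))"
      by (intro smooth_intros u smooth_on_compose[OF _ _ _ w smooth_on_inverse])
        (auto simp: w0 open_Collect_neq)
    show "u p * inverse (w p) = 1" if "norm p \<le> r" for p
    proof -
      have "p \<bullet> p \<le> r\<^sup>2" using that by (simp add: dot_square_norm power_mono)
      then have "v p = 0" by (simp add: v_def psi_def)
      then show ?thesis using w0[of p] by (simp add: w_def)
    qed
    show "u p * inverse (w p) = 0" if "norm p \<ge> s" for p
    proof -
      have "p \<bullet> p \<ge> s\<^sup>2" using that assms by (simp add: dot_square_norm power_mono)
      then show ?thesis by (simp add: u_def psi_def)
    qed
  qed
qed

section \<open>Integration along rays\<close>

text \<open>Differentiating in \<open>p\<close> brings out one factor \<open>t\<close>, so the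
  weights \<open>t ^ j\<close> make the family closed under differentiation. The case
  \<open>j = 0\<close> averages \<open>f\<close> over the segment from the origin to
  \<open>p\<close>.\<close>

definition ray_integral :: "nat \<Rightarrow> ('a::euclidean_space \<Rightarrow> 'b::euclidean_space) \<Rightarrow> 'a \<Rightarrow> 'b" where
  "ray_integral j f p = integral {0..1} (\<lambda>t. t ^ j *\<^sub>R f (t *\<^sub>R p))"

lemma ray_in_ball:
  fixes p :: "'a::real_normed_vector"
  shows "p \<in> ball 0 R \<Longrightarrow> t \<in> {0..1} \<Longrightarrow> t *\<^sub>R p \<in> ball 0 R"
  using mult_left_le_one_le[of "norm p" t] by auto

lemma ray_continuous_on:
  fixes f :: "'a::euclidean_space \<Rightarrow> 'b::real_normed_vector"
  assumes "continuous_on (ball 0 R) f"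
  shows "continuous_on (ball 0 R \<times> {0..1::real}) (\<lambda>(p, t). t ^ j *\<^sub>R f (t *\<^sub>R p))"
proof -
  have "continuous_on (ball 0 R \<times> {0..1::real}) (\<lambda>z. f (snd z *\<^sub>R fst z))"
  proof (rule continuous_on_compose2[OF assms])
    show "(\<lambda>z. snd z *\<^sub>R fst z) ` (ball 0 R \<times> {0..1::real}) \<subseteq> (ball 0 R :: 'a set)"
    proof (rule image_subsetI)
      fix z :: "'a \<times> real" assume "z \<in> ball 0 R \<times> {0..1}"
      then show "snd z *\<^sub>R fst z \<in> ball 0 R"
        by (intro ray_in_ball) (simp_all add: mem_Times_iff)
    qed
  qed (auto intro!: continuous_intros)
  then show ?thesis by (auto simp: split_beta intro!: continuous_intros)
qed

lemma ray_integrable: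
  fixes f :: "'a::euclidean_space \<Rightarrow> 'b::euclidean_space"
  assumes "continuous_on (ball 0 R) f" "p \<in> ball 0 R"
  shows "(\<lambda>t. t ^ j *\<^sub>R f (t *\<^sub>R p)) integrable_on {0..1::real}"
proof -
  have "continuous_on {0..1} (\<lambda>t::real. (\<lambda>(p, t). t ^ j *\<^sub>R f (t *\<^sub>R p)) (p, t))"
    by (rule continuous_on_compose2[OF ray_continuous_on[OF assms(1)]])
      (use assms(2) in \<open>auto intro!: continuous_intros\<close>)
  then show ?thesis by (simp add: integrable_continuous_interval)
qed

lemma continuous_on_ray_integral:
  fixes f :: "'a::euclidean_space \<Rightarrow> 'b::euclidean_space"
  assumes "continuous_on (ball 0 R) f"
  shows "continuous_on (ball 0 R) (ray_integral j f)"
  using integral_continuous_on_param[of "ball 0 R" 0 1 "\<lambda>p t. t ^ j *\<^sub>R f (t *\<^sub>R p)"]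
    ray_continuous_on[OF assms] by (simp add: ray_integral_def[abs_def])

lemma ray_integral_has_derivative:
  fixes f :: "'a::euclidean_space \<Rightarrow> 'b::euclidean_space"
  assumes f': "\<And>x. x \<in> ball 0 R \<Longrightarrow> (f has_derivative f' x) (at x)"
    and cont: "\<And>v. continuous_on (ball 0 R) (\<lambda>x. f' x v)" and p: "p \<in> ball 0 R"
  shows "(ray_integral j f has_derivative (\<lambda>v. ray_integral (Suc j) (\<lambda>x. f' x v) p)) (at p)"
proof -
  \<comment> \<open>Differentiation under the integral wants the derivative as a continuous map into
    bounded linear functions; in finite dimension, continuity of its values on fixed vectors is
    enough for that.\<close>
  define D where "D x = Blinfun (f' x)" for x
  have D: "blinfun_apply (D x) = f' x" if "x \<in> ball 0 R" for x
    unfolding D_def using f'[OF that] by (simp add: bounded_linear_Blinfun_apply has_derivative_bounded_linear)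
  have cD: "continuous_on (ball 0 R) D"
  proof (rule continuous_on_blinfun_componentwise)
    show "continuous_on (ball 0 R) (\<lambda>x. blinfun_apply (D x) i)" for i
      using cont[of i] by (rule continuous_on_eq) (simp add: D)
  qed
  have cf: "continuous_on (ball 0 R) f"
    by (intro continuous_at_imp_continuous_on ballI) (rule has_derivative_continuous[OF f'])
  have "((\<lambda>x. integral (cbox 0 1) (\<lambda>t. t ^ j *\<^sub>R f (t *\<^sub>R x))) has_derivative
      blinfun_apply (integral (cbox 0 1) (\<lambda>t. t ^ Suc j *\<^sub>R D (t *\<^sub>R p)))) (at p within ball 0 R)"
  proof (rule leibniz_rule[where fx = "\<lambda>x t. t ^ Suc j *\<^sub>R D (t *\<^sub>R x)"])
    show "continuous_on (ball 0 R \<times> cbox 0 1) (\<lambda>(x, t::real). t ^ Suc j *\<^sub>R D (t *\<^sub>R x))"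
      using ray_continuous_on[OF cD, of "Suc j"] by simp
    show "(\<lambda>t. t ^ j *\<^sub>R f (t *\<^sub>R x)) integrable_on cbox 0 1" if "x \<in> ball 0 R" for x
      using ray_integrable[OF cf that] by simp
    fix x :: 'a and t :: real assume x: "x \<in> ball 0 R" "t \<in> cbox 0 1"
    then have tx: "t *\<^sub>R x \<in> ball 0 R" using ray_in_ball[of x R t] by simp
    have "((\<lambda>x. t ^ j *\<^sub>R f (t *\<^sub>R x)) has_derivative (\<lambda>v. t ^ j *\<^sub>R f' (t *\<^sub>R x) (t *\<^sub>R v))) (at x)"
      by (intro has_derivative_scaleR_right has_derivative_compose[of "(*\<^sub>R) t" _ _ _ f])
        (auto intro!: derivative_eq_intros f' tx)
    moreover have "linear (f' (t *\<^sub>R x))" using f'[OF tx] has_derivative_linear by blast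
    then have "(\<lambda>v. t ^ j *\<^sub>R f' (t *\<^sub>R x) (t *\<^sub>R v)) = blinfun_apply (t ^ Suc j *\<^sub>R D (t *\<^sub>R x))"
      by (auto simp: fun_eq_iff D[OF tx] linear_cmul blinfun.scaleR_left mult.commute)
    ultimately show "((\<lambda>x. t ^ j *\<^sub>R f (t *\<^sub>R x)) has_derivative
        blinfun_apply (t ^ Suc j *\<^sub>R D (t *\<^sub>R x))) (at x within ball 0 R)"
      by (metis has_derivative_at_withinI)
  qed (use p in auto)
  then have "(ray_integral j f has_derivative
      blinfun_apply (integral {0..1} (\<lambda>t. t ^ Suc j *\<^sub>R D (t *\<^sub>R p)))) (at p)"
    using p at_within_open[of p "ball 0 R"] by (simp add: ray_integral_def[abs_def])
  note * = this
  have **: "blinfun_apply (integral {0..1} (\<lambda>t. t ^ Suc j *\<^sub>R D (t *\<^sub>R p))) v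
      = ray_integral (Suc j) (\<lambda>x. f' x v) p" for v
  proof -
    have "continuous_on {0..1} (\<lambda>t::real. (\<lambda>(p, t). t ^ Suc j *\<^sub>R D (t *\<^sub>R p)) (p, t))"
      by (rule continuous_on_compose2[OF ray_continuous_on[OF cD]])
        (use p in \<open>auto intro!: continuous_intros\<close>)
    then have "(\<lambda>t. t ^ Suc j *\<^sub>R D (t *\<^sub>R p)) integrable_on {0..1}"
      by (simp add: integrable_continuous_interval)
    from integral_linear[OF this blinfun.bounded_linear_left[of v]]
    have "blinfun_apply (integral {0..1} (\<lambda>t. t ^ Suc j *\<^sub>R D (t *\<^sub>R p))) v
      = integral {0..1} (\<lambda>t. blinfun_apply (t ^ Suc j *\<^sub>R D (t *\<^sub>R p)) v)" by (simp add: o_def)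
    also have "\<dots> = integral {0..1} (\<lambda>t. t ^ Suc j *\<^sub>R f' (t *\<^sub>R p) v)"
      by (rule integral_cong) (simp only: blinfun.scaleR_left D[OF ray_in_ball[OF p]])
    finally show ?thesis by (simp add: ray_integral_def)
  qed
  show ?thesis by (rule has_derivative_eq_rhs[OF *]) (rule ext, rule **)
qed

lemma Ck_on_ray_integral:
  fixes f :: "'a::euclidean_space \<Rightarrow> 'b::euclidean_space"
  shows "Ck_on k (ball 0 R) f \<Longrightarrow> Ck_on k (ball 0 R) (ray_integral j f)"
proof (induction k arbitrary: f j)
  case 0
  then show ?case by (simp add: continuous_on_ray_integral)
next
  case (Suc k)
  from Suc.prems obtain f' where f': "\<And>x. x \<in> ball 0 R \<Longrightarrow> (f has_derivative f' x) (at x)"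
    "\<And>v. Ck_on k (ball 0 R) (\<lambda>x. f' x v)" by (rule Ck_on_SucE) blast
  have c: "continuous_on (ball 0 R) (\<lambda>x. f' x v)" for v
    using f'(2)[of v] Ck_on_Suc_imp by (induction k) auto
  show ?case
    by (rule Ck_on_SucI[OF _ ray_integral_has_derivative[OF f'(1) c]])
      (use Suc.IH[OF f'(2)] in auto)
qed

lemma smooth_on_ray_integral:
  fixes f :: "'a::euclidean_space \<Rightarrow> 'b::euclidean_space"
  shows "smooth_on (ball 0 R) f \<Longrightarrow> smooth_on (ball 0 R) (ray_integral j f)"
  unfolding smooth_on_def by (auto intro: Ck_on_ray_integral)

text \<open>The fundamental theorem of calculus on the ray to \<open>p\<close> gives f(p) - f(0) as
  the integral of f'(tp) p. Expanding \<open>p\<close> in the basis exhibits \<open>h b\<close> as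
  the ray integral of the partial derivative along \<open>b\<close>.\<close>

lemma hadamard:
  fixes f :: "'a::euclidean_space \<Rightarrow> real"
  assumes "smooth_on (ball 0 R) f" "R > 0"
  obtains h where "\<And>b. smooth_on (ball 0 R) (h b)"
    "\<And>p. p \<in> ball 0 R \<Longrightarrow> f p = f 0 + (\<Sum>b\<in>Basis. (p \<bullet> b) * h b p)"
    "(f has_derivative (\<lambda>v. \<Sum>b\<in>Basis. (v \<bullet> b) * h b 0)) (at 0)"
proof -
  from assms(1) obtain f' where f': "\<And>x. x \<in> ball 0 R \<Longrightarrow> (f has_derivative f' x) (at x)"
    "\<And>v. smooth_on (ball 0 R) (\<lambda>x. f' x v)" by (rule smooth_onE) blast
  have lin: "linear (f' x)" if "x \<in> ball 0 R" for x
    using f'(1)[OF that] has_derivative_linear by blast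
  show thesis
  proof
    show "smooth_on (ball 0 R) (ray_integral 0 (\<lambda>x. f' x b))" for b
      by (rule smooth_on_ray_integral[OF f'(2)])
    have "ray_integral 0 (\<lambda>x. f' x b) 0 = f' 0 b" for b
      by (simp add: ray_integral_def)
    then have "f' 0 v = (\<Sum>b\<in>Basis. (v \<bullet> b) * ray_integral 0 (\<lambda>x. f' x b) 0)" for v
      using linear_sum_Basis[OF lin[of 0], of v] assms(2) by simp
    then show "(f has_derivative (\<lambda>v. \<Sum>b\<in>Basis. (v \<bullet> b) * ray_integral 0 (\<lambda>x. f' x b) 0)) (at 0)"
      using assms(2) by (intro has_derivative_eq_rhs[OF f'(1)] ext) auto
    fix p :: 'a assume p: "p \<in> ball 0 R"
    have "((\<lambda>t. f (t *\<^sub>R p)) has_vector_derivative f' (t *\<^sub>R p) p) (at t within {0..1})"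
      if t: "t \<in> {0..1}" for t
    proof -
      have "((\<lambda>t. f (t *\<^sub>R p)) has_derivative (\<lambda>s. f' (t *\<^sub>R p) (s *\<^sub>R p))) (at t)"
        by (rule has_derivative_compose[of "\<lambda>t. t *\<^sub>R p" _ _ _ f])
          (auto intro!: derivative_eq_intros f' ray_in_ball[OF p t, simplified])
      then show ?thesis
        using linear_cmul[OF lin[OF ray_in_ball[OF p t]]]
        by (auto simp: has_vector_derivative_def intro: has_derivative_at_withinI)
    qed
    from fundamental_theorem_of_calculus[OF _ this]
    have FTC: "((\<lambda>t. f' (t *\<^sub>R p) p) has_integral f p - f 0) {0..1}" by simp
    have i: "(\<lambda>t. f' (t *\<^sub>R p) b) integrable_on {0..1}" for b
      using ray_integrable[OF smooth_on_continuous_on[OF f'(2)] p, of 0] by simp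
    from FTC have "f p - f 0 = integral {0..1} (\<lambda>t. f' (t *\<^sub>R p) p)" by (simp add: integral_unique)
    also have "\<dots> = integral {0..1} (\<lambda>t. \<Sum>b\<in>Basis. (p \<bullet> b) *\<^sub>R f' (t *\<^sub>R p) b)"
      by (rule integral_cong) (rule linear_sum_Basis[OF lin[OF ray_in_ball[OF p]]])
    also have "\<dots> = (\<Sum>b\<in>Basis. integral {0..1} (\<lambda>t. (p \<bullet> b) *\<^sub>R f' (t *\<^sub>R p) b))"
      by (rule integral_sum) (rule finite_Basis, intro integrable_cmul i)
    finally show "f p = f 0 + (\<Sum>b\<in>Basis. (p \<bullet> b) * ray_integral 0 (\<lambda>x. f' x b) p)"
      by (simp add: ray_integral_def)
  qed
qed

text \<open>The candidate is f(p), the integral of \<beta>(tp) p over t in [0,1]. Closedness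
  exchanges the two vector arguments of the derivative of \<beta>, so that the integrand of the
  derivative of f in direction v becomes d/dt of t \<beta>(tp) v.\<close>

lemma poincare:
  fixes \<beta> :: "'a::euclidean_space \<Rightarrow> 'a \<Rightarrow> 'b::euclidean_space"
  assumes lin: "\<And>p. p \<in> ball 0 R \<Longrightarrow> linear (\<beta> p)"
    and smooth: "\<And>v. smooth_on (ball 0 R) (\<lambda>p. \<beta> p v)"
    and deriv: "\<And>v p. p \<in> ball 0 R \<Longrightarrow> ((\<lambda>p. \<beta> p v) has_derivative \<beta>' v p) (at p)"
    and closed: "\<And>u v p. p \<in> ball 0 R \<Longrightarrow> \<beta>' v p u = \<beta>' u p v"
  obtains f where "f 0 = 0" "smooth_on (ball 0 R) f"
    "\<And>p. p \<in> ball 0 R \<Longrightarrow> (f has_derivative \<beta> p) (at p)"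
proof -
  define f where "f p = (\<Sum>b\<in>Basis. (p \<bullet> b) *\<^sub>R ray_integral 0 (\<lambda>q. \<beta> q b) p)" for p
  have c\<beta>: "continuous_on (ball 0 R) (\<lambda>p. \<beta> p v)" for v
    using smooth smooth_on_continuous_on by blast
  have c\<beta>': "continuous_on (ball 0 R) (\<lambda>p. \<beta>' v p u)" for u v
  proof -
    have "smooth_on (ball 0 R) (\<lambda>x. frechet_derivative (\<lambda>p. \<beta> p v) (at x) u)"
      by (rule smooth_on_frechet_derivative[OF smooth])
    then have "continuous_on (ball 0 R) (\<lambda>x. frechet_derivative (\<lambda>p. \<beta> p v) (at x) u)"
      by (rule smooth_on_continuous_on)
    then show ?thesis
      by (rule continuous_on_eq) (simp add: frechet_derivative_at[OF deriv, symmetric])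
  qed
  have lin': "linear (\<beta>' v p)" if "p \<in> ball 0 R" for p v
    using deriv[OF that] has_derivative_linear by blast
  have df: "(f has_derivative \<beta> p) (at p)" if p: "p \<in> ball 0 R" for p
  proof -
    have "(f has_derivative (\<lambda>v. \<Sum>b\<in>Basis. (p \<bullet> b) *\<^sub>R ray_integral (Suc 0) (\<lambda>q. \<beta>' b q v) p
         + (v \<bullet> b) *\<^sub>R ray_integral 0 (\<lambda>q. \<beta> q b) p)) (at p)"
      unfolding f_def
      by (intro has_derivative_sum has_derivative_scaleR ray_integral_has_derivative)
        (use deriv c\<beta>' p in \<open>auto intro!: derivative_eq_intros\<close>)
    then show ?thesis
    proof (rule has_derivative_eq_rhs, intro ext)
      fix v
      have i: "(\<lambda>t. \<beta> (t *\<^sub>R p) v) integrable_on {0..1}"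
        "(\<lambda>t. t *\<^sub>R \<beta>' v (t *\<^sub>R p) u) integrable_on {0..1}" for u v
        using ray_integrable[OF c\<beta> p, of 0] ray_integrable[OF c\<beta>' p, of 1] by auto
      have "(\<Sum>b\<in>Basis. (p \<bullet> b) *\<^sub>R ray_integral (Suc 0) (\<lambda>q. \<beta>' b q v) p)
          = (\<Sum>b\<in>Basis. integral {0..1} (\<lambda>t. (p \<bullet> b) *\<^sub>R t *\<^sub>R \<beta>' b (t *\<^sub>R p) v))"
        by (simp only: ray_integral_def integral_cmul power_Suc0_right)
      also have "\<dots> = integral {0..1} (\<lambda>t. \<Sum>b\<in>Basis. (p \<bullet> b) *\<^sub>R t *\<^sub>R \<beta>' b (t *\<^sub>R p) v)"
        by (rule integral_sum[symmetric]) (rule finite_Basis, intro integrable_cmul i)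
      also have "\<dots> = integral {0..1} (\<lambda>t. t *\<^sub>R \<beta>' v (t *\<^sub>R p) p)"
      proof (rule integral_cong)
        fix t :: real assume t: "t \<in> {0..1}"
        note q = ray_in_ball[OF p t]
        have "(\<Sum>b\<in>Basis. (p \<bullet> b) *\<^sub>R t *\<^sub>R \<beta>' b (t *\<^sub>R p) v)
            = (\<Sum>b\<in>Basis. t *\<^sub>R (p \<bullet> b) *\<^sub>R \<beta>' v (t *\<^sub>R p) b)"
          by (rule sum.cong) (auto simp: closed[OF q, of _ v] algebra_simps)
        then show "(\<Sum>b\<in>Basis. (p \<bullet> b) *\<^sub>R t *\<^sub>R \<beta>' b (t *\<^sub>R p) v) = t *\<^sub>R \<beta>' v (t *\<^sub>R p) p"
          by (simp add: linear_sum_Basis[OF lin'[OF q], of v p] scaleR_sum_right)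
      qed
      finally have 1: "(\<Sum>b\<in>Basis. (p \<bullet> b) *\<^sub>R ray_integral (Suc 0) (\<lambda>q. \<beta>' b q v) p)
        = integral {0..1} (\<lambda>t. t *\<^sub>R \<beta>' v (t *\<^sub>R p) p)" .
      have "(\<Sum>b\<in>Basis. (v \<bullet> b) *\<^sub>R ray_integral 0 (\<lambda>q. \<beta> q b) p)
          = (\<Sum>b\<in>Basis. integral {0..1} (\<lambda>t. (v \<bullet> b) *\<^sub>R \<beta> (t *\<^sub>R p) b))"
        by (simp add: ray_integral_def)
      also have "\<dots> = integral {0..1} (\<lambda>t. \<Sum>b\<in>Basis. (v \<bullet> b) *\<^sub>R \<beta> (t *\<^sub>R p) b)"
        by (rule integral_sum[symmetric]) (rule finite_Basis, intro integrable_cmul i)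
      also have "\<dots> = integral {0..1} (\<lambda>t. \<beta> (t *\<^sub>R p) v)"
        by (rule integral_cong) (rule linear_sum_Basis[OF lin[OF ray_in_ball[OF p]], symmetric])
      finally have 2: "(\<Sum>b\<in>Basis. (v \<bullet> b) *\<^sub>R ray_integral 0 (\<lambda>q. \<beta> q b) p)
        = integral {0..1} (\<lambda>t. \<beta> (t *\<^sub>R p) v)" .
      have "((\<lambda>t. t *\<^sub>R \<beta> (t *\<^sub>R p) v) has_vector_derivative
          t *\<^sub>R \<beta>' v (t *\<^sub>R p) p + \<beta> (t *\<^sub>R p) v) (at t within {0..1})" if t: "t \<in> {0..1}" for t
      proof -
        note q = ray_in_ball[OF p t]
        have "((\<lambda>t. \<beta> (t *\<^sub>R p) v) has_derivative (\<lambda>s. \<beta>' v (t *\<^sub>R p) (s *\<^sub>R p))) (at t)"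
          by (rule has_derivative_compose[of "\<lambda>t. t *\<^sub>R p" _ _ _ "\<lambda>q. \<beta> q v"])
            (auto intro!: derivative_eq_intros deriv q[simplified])
        then have "((\<lambda>t. \<beta> (t *\<^sub>R p) v) has_vector_derivative \<beta>' v (t *\<^sub>R p) p) (at t)"
          using linear_cmul[OF lin'[OF q]] by (simp add: has_vector_derivative_def)
        then have "((\<lambda>t. t *\<^sub>R \<beta> (t *\<^sub>R p) v) has_vector_derivative
          t *\<^sub>R \<beta>' v (t *\<^sub>R p) p + 1 *\<^sub>R \<beta> (t *\<^sub>R p) v) (at t)"
          by (intro has_vector_derivative_scaleR) (auto intro!: derivative_eq_intros)
        then show ?thesis by (simp add: has_vector_derivative_at_within)
      qed
      from fundamental_theorem_of_calculus[OF _ this]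
      have "((\<lambda>t. t *\<^sub>R \<beta>' v (t *\<^sub>R p) p + \<beta> (t *\<^sub>R p) v) has_integral \<beta> p v) {0..1}" by simp
      then show "(\<Sum>b\<in>Basis. (p \<bullet> b) *\<^sub>R ray_integral (Suc 0) (\<lambda>q. \<beta>' b q v) p
         + (v \<bullet> b) *\<^sub>R ray_integral 0 (\<lambda>q. \<beta> q b) p) = \<beta> p v"
        unfolding sum.distrib 1 2 using i by (simp add: integral_add[symmetric] integral_unique)
    qed
  qed
  show thesis
  proof
    show "smooth_on (ball 0 R) f" by (rule smooth_onI[OF _ df smooth]) auto
  qed (use df in \<open>auto simp: f_def\<close>)
qed

section \<open>Nilpotent operators and traces\<close>

definition op_trace :: "('a::euclidean_space \<Rightarrow> 'a) \<Rightarrow> real" where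
  "op_trace D = (\<Sum>b\<in>Basis. D b \<bullet> b)"

lemma op_trace_commute:
  fixes D E :: "'a::euclidean_space \<Rightarrow> 'a"
  assumes "linear D" "linear E"
  shows "op_trace (\<lambda>x. D (E x)) = op_trace (\<lambda>x. E (D x))"
proof -
  have *: "op_trace (\<lambda>x. D (E x)) = (\<Sum>b\<in>Basis. \<Sum>c\<in>Basis. (E b \<bullet> c) * (D c \<bullet> b))"
    if "linear D" for D E :: "'a \<Rightarrow> 'a"
    unfolding op_trace_def
    by (rule sum.cong[OF refl], subst linear_sum_Basis[OF that]) (simp add: inner_sum_left)
  show ?thesis
    unfolding *[OF assms(1)] *[OF assms(2)] by (subst sum.swap) (simp add: mult.commute)
qed

lemma orthonormal_expansion:
  fixes A :: "'a::real_inner set"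
  assumes "finite A" "pairwise orthogonal A" "\<And>a. a \<in> A \<Longrightarrow> norm a = 1" "x \<in> span A"
  shows "x = (\<Sum>a\<in>A. (x \<bullet> a) *\<^sub>R a)"
proof -
  define y where "y = x - (\<Sum>a\<in>A. (x \<bullet> a) *\<^sub>R a)"
  have "orthogonal y a" if "a \<in> A" for a
  proof -
    have "(\<Sum>c\<in>A. (x \<bullet> c) * (c \<bullet> a)) = (\<Sum>c\<in>A. if c = a then x \<bullet> a else 0)"
      using assms(2,3) that
      by (intro sum.cong) (auto simp: pairwise_def orthogonal_def norm_eq_1)
    then show ?thesis
      using assms(1) that by (simp add: y_def orthogonal_def inner_diff_left inner_sum_left)
  qed
  moreover have "y \<in> span A"
    unfolding y_def by (intro span_diff span_sum span_scale assms(4)) (simp add: span_base)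
  ultimately have "orthogonal y y" by (metis orthogonal_commute orthogonal_to_span)
  then show ?thesis by (simp add: orthogonal_def y_def)
qed

lemma op_trace_orthonormal:
  fixes A :: "'a::euclidean_space set"
  assumes "linear D" "finite A" "pairwise orthogonal A" "\<And>a. a \<in> A \<Longrightarrow> norm a = 1" "span A = UNIV"
  shows "op_trace D = (\<Sum>a\<in>A. D a \<bullet> a)"
proof -
  have "(\<Sum>a\<in>A. D a \<bullet> a) = (\<Sum>a\<in>A. \<Sum>b\<in>Basis. (a \<bullet> b) * (D b \<bullet> a))"
    by (rule sum.cong[OF refl], subst linear_sum_Basis[OF assms(1)]) (simp add: inner_sum_left)
  also have "\<dots> = (\<Sum>b\<in>Basis. D b \<bullet> (\<Sum>a\<in>A. (b \<bullet> a) *\<^sub>R a))"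
    by (subst sum.swap) (simp add: inner_sum_right inner_commute)
  also have "\<dots> = op_trace D"
    unfolding op_trace_def
    by (rule sum.cong[OF refl], subst orthonormal_expansion[OF assms(2-4), symmetric])
      (use assms(5) in auto)
  finally show ?thesis by simp
qed

text \<open>A nilpotent map cannot send a nonzero invariant subspace \<open>S\<close> onto itself,
  so \<open>S\<close> contains a unit vector \<open>u\<close> orthogonal to the image of
  \<open>S\<close>. Then \<open>D u\<close> is orthogonal to \<open>u\<close>, and the complement of
  \<open>u\<close> in \<open>S\<close> is again invariant, which allows recursion on the
  dimension.\<close>

lemma nilpotent_orthonormal_basis:
  fixes D :: "'a::euclidean_space \<Rightarrow> 'a"
  assumes "linear D" "\<And>x. (D ^^ k) x = 0" "subspace S" "D ` S \<subseteq> S"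
  shows "\<exists>A. finite A \<and> A \<subseteq> S \<and> pairwise orthogonal A \<and> (\<forall>a\<in>A. norm a = 1 \<and> D a \<bullet> a = 0) \<and> span A = S"
  using assms(3,4)
proof (induction "dim S" arbitrary: S rule: less_induct)
  case less
  show ?case
  proof (cases "S = {0}")
    case True
    then show ?thesis by (intro exI[of _ "{}"]) auto
  next
    case False
    have "D ` S \<noteq> S"
    proof
      assume *: "D ` S = S"
      have "(D ^^ m) ` S = S" for m
        by (induction m) (simp, metis image_comp funpow.simps(2) *)
      then have "S = (\<lambda>x. 0) ` S" using assms(2) by (metis (no_types, lifting) image_cong)
      then show False using False less.prems(1) subspace_0 by fastforce
    qed
    moreover have "span (D ` S) = D ` S" "span S = S"
      using less.prems(1) linear_subspace_image[OF assms(1) less.prems(1)] by (simp_all only: span_eq_iff)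
    ultimately have "span (D ` S) \<subset> span S" using less.prems(2) by blast
    then obtain v where v: "v \<noteq> 0" "v \<in> span S" "\<And>y. y \<in> span (D ` S) \<Longrightarrow> orthogonal v y"
      by (rule orthogonal_to_subspace_exists_gen) blast
    define u where "u = v /\<^sub>R norm v"
    have u: "norm u = 1" "u \<in> S" "\<And>y. y \<in> S \<Longrightarrow> u \<bullet> D y = 0"
    proof -
      show "norm u = 1" using v(1) by (simp add: u_def)
      show "u \<in> S" using v(2) less.prems(1) by (metis u_def span_eq_iff subspace_scale)
      show "u \<bullet> D y = 0" if "y \<in> S" for y
        using v(3)[of "D y"] that by (simp add: u_def orthogonal_def span_base)
    qed
    define S' where "S' = {s \<in> S. u \<bullet> s = 0}"
    have S': "subspace S'" "D ` S' \<subseteq> S'"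
      using less.prems u(3) by (auto simp: S'_def subspace_def inner_add_right)
    have "S' \<subseteq> S" "u \<notin> S'" using u(1) by (auto simp: S'_def norm_eq_1)
    then have "dim S' < dim S"
      using subspace_dim_equal[OF S'(1) less.prems(1)] dim_subset[of S' S] u(2) by fastforce
    from less.hyps[OF this S'] obtain A where A: "finite A" "A \<subseteq> S'" "pairwise orthogonal A"
      "\<forall>a\<in>A. norm a = 1 \<and> D a \<bullet> a = 0" "span A = S'" by blast
    have "span (insert u A) = S"
    proof
      show "span (insert u A) \<subseteq> S"
        using A(2) u(2) less.prems(1) by (intro span_minimal) (auto simp: S'_def)
      show "S \<subseteq> span (insert u A)"
      proof
        fix s assume "s \<in> S"
        then have "s - (s \<bullet> u) *\<^sub>R u \<in> span A"
          using u less.prems(1) unfolding A(5)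
          by (auto simp: S'_def subspace_diff subspace_scale inner_diff_right norm_eq_1 inner_commute)
        then show "s \<in> span (insert u A)" by (auto simp: span_insert)
      qed
    qed
    moreover have "pairwise orthogonal (insert u A)"
      using A(2,3) by (auto simp: pairwise_insert S'_def orthogonal_def inner_commute)
    ultimately show ?thesis
      using A u S'_def by (intro exI[of _ "insert u A"]) (auto simp: inner_commute)
  qed
qed

lemma op_trace_nilpotent:
  assumes "linear D" "\<And>x. (D ^^ k) x = 0"
  shows "op_trace D = 0"
proof -
  from nilpotent_orthonormal_basis[OF assms subspace_UNIV] obtain A where
    "finite A" "pairwise orthogonal A" "\<forall>a\<in>A. norm a = 1 \<and> D a \<bullet> a = 0" "span A = UNIV" by auto
  then show ?thesis using op_trace_orthonormal[OF assms(1), of A] by auto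
qed

text \<open>Skewness turns |K^(k+1) x|^2 into minus the inner product of K^k x and K^(k+2) x, so the
  order of nilpotency at \<open>x\<close> can be lowered step by step to 1.\<close>

lemma nilpotent_skew_zero:
  fixes K :: "'a::real_inner \<Rightarrow> 'a"
  assumes skew: "\<And>x y. K x \<bullet> y = - (x \<bullet> K y)" and "(K ^^ Suc k) x = 0"
  shows "K x = 0"
  using assms(2)
proof (induction k)
  case (Suc k)
  have "(K ^^ Suc k) x \<bullet> (K ^^ Suc k) x = - ((K ^^ k) x \<bullet> (K ^^ Suc (Suc k)) x)"
    by (simp add: skew)
  then show ?case using Suc by simp
qed simp

section \<open>Nilpotent Kaehler and quasi-Sasakian Lie algebras\<close>

text \<open>Let \<open>Z\<close> be a nonzero central commutator and \<open>D = br (J Z)\<close>. The hypotheses make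
  \<open>br x (J y) \<bullet> Z = - (D x \<bullet> y + x \<bullet> D y)\<close>. Since nilpotent operators have trace \<open>0\<close>, the sum
  \<open>W\<close> of all \<open>br b (J b)\<close> vanishes. Applying the derivation \<open>D\<close> to \<open>W\<close> and pairing with \<open>Z\<close> then
  gives \<open>|D|\<^sup>2 = - tr D\<^sup>2 = 0\<close>. So \<open>Z\<close> is orthogonal to all commutators, in particular to itself.\<close>

lemma nilpotent_kaehler_abelian:
  fixes br :: "'a::euclidean_space \<Rightarrow> 'a \<Rightarrow> 'a" and J :: "'a \<Rightarrow> 'a"
  assumes lin: "\<And>x. linear (br x)" and alt: "\<And>x y. br x y = - br y x"
    and jacobi: "\<And>x y z. br x (br y z) = br (br x y) z + br y (br x z)"
    and J: "linear J" "\<And>x y. J x \<bullet> y = - (x \<bullet> J y)" "\<And>x y. J (J (br x y)) = - br x y"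
    and nijenhuis: "\<And>x y. br (J x) (J y) - br x y - J (br x (J y)) - J (br (J x) y) = 0"
    and closed: "\<And>x y z. br x y \<bullet> J z + br y z \<bullet> J x + br z x \<bullet> J y = 0"
    and filt: "C 0 = UNIV" "\<And>j x y. y \<in> C j \<Longrightarrow> br x y \<in> C (Suc j)" "C N = {0}"
  shows "br x y = 0"
proof (rule ccontr)
  assume "br x y \<noteq> 0"
  \<comment> \<open>At the last level where \<open>P\<close> holds, a nonzero bracket lies one level
    deeper, where all brackets vanish; it is therefore central.\<close>
  define P where "P j \<longleftrightarrow> (\<exists>x. \<exists>y\<in>C j. br x y \<noteq> 0)" for j
  have lin_left: "linear (\<lambda>x. br x y)" for y
    using linear_compose_neg[OF lin[of y]] alt[of _ y] by simp
  have zero: "br x 0 = 0" "br 0 x = 0" for x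
    using linear_0[OF lin] linear_0[OF lin_left] by auto
  have "P 0" using \<open>br x y \<noteq> 0\<close> by (auto simp: P_def filt)
  have "\<not> P N" by (auto simp: P_def filt zero)
  obtain j where "P j" "\<not> P (Suc j)"
    using \<open>P 0\<close> \<open>\<not> P N\<close> by (metis nat_induct)
  then obtain x0 y0 where xy: "br x0 y0 \<noteq> 0" "y0 \<in> C j" by (auto simp: P_def)
  define Z where "Z = br x0 y0"
  have "Z \<in> C (Suc j)" using filt xy by (simp add: Z_def)
  then have cen': "br x Z = 0" for x using \<open>\<not> P (Suc j)\<close> by (auto simp: P_def)
  then have cen: "br Z x = 0" for x using alt[of Z x] by simp
  have JJZ: "J (J Z) = - Z" by (simp add: Z_def J)
  have nil: "((br x) ^^ N) y = 0" for x y
  proof -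
    have "((br x) ^^ m) y \<in> C m" for m by (induction m) (auto simp: filt)
    then show ?thesis using filt(3) by blast
  qed
  define D where "D = br (J Z)"
  have linD: "linear D" by (simp add: D_def lin)
  have DJ: "D (J x) = J (D x)" for x
    using nijenhuis[of Z x] by (simp add: cen linear_0[OF J(1)] D_def)
  have JJD: "J (J (D x)) = - D x" for x by (simp add: D_def J)
  have B: "br x y \<bullet> Z = D x \<bullet> J y - D y \<bullet> J x" for x y
    using closed[of x y "J Z"] alt[of y "J Z"] by (simp add: JJZ D_def)
  have BJ: "br x (J y) \<bullet> Z = - (D x \<bullet> y + x \<bullet> D y)" for x y
  proof -
    have "D x \<bullet> J (J y) = - (D x \<bullet> y)"
      using J(2)[of "D x" "J y"] J(2)[of "J (D x)" y] by (simp add: JJD)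
    moreover have "D (J y) \<bullet> J x = D y \<bullet> x"
      using J(2)[of "J (D y)" x] by (simp add: DJ JJD)
    ultimately show ?thesis unfolding B by (simp add: inner_commute)
  qed
  define W where "W = (\<Sum>b\<in>Basis. br b (J b))"
  have trace0: "op_trace (br V) = 0" for V
    by (rule op_trace_nilpotent[OF lin nil])
  \<comment> \<open>Closedness at b, J b, V, summed over b, leaves twice the trace of
    \<open>br V\<close>, because the trace is cyclic and \<open>J\<close> squares to -1 on brackets.
    So \<open>W\<close> is orthogonal to the range of \<open>J\<close>; by skewness
    \<open>J W\<close> vanishes, and then so does \<open>W\<close>, being a sum of brackets.\<close>
  have "W \<bullet> J V = 0" for V
  proof -
    have "W \<bullet> J V = (\<Sum>b\<in>Basis. br V (J b) \<bullet> J b - J (J (br V b)) \<bullet> b)"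
      unfolding W_def inner_sum_left
    proof (rule sum.cong)
      fix b :: 'a
      have "br V b \<bullet> J (J b) = J (J (br V b)) \<bullet> b" using J(2) by simp
      then show "br b (J b) \<bullet> J V = br V (J b) \<bullet> J b - J (J (br V b)) \<bullet> b"
        using closed[of b "J b" V] alt[of "J b" V] J(3)[of V b] by simp
    qed simp
    also have "\<dots> = - op_trace (\<lambda>b. J (br V (J b))) + op_trace (br V)"
      by (simp add: op_trace_def sum.distrib sum_negf J)
    also have "op_trace (\<lambda>b. J (br V (J b))) = op_trace (\<lambda>b. br V (J (J b)))"
      using op_trace_commute[OF J(1) linear_compose[OF J(1) lin[of V]]] by (simp add: o_def)
    also have "\<dots> = op_trace (\<lambda>b. J (J (br V b)))"
      using op_trace_commute[OF lin[of V] linear_compose[OF J(1) J(1)]] by (simp add: o_def)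
    also have "\<dots> = - op_trace (br V)" by (simp add: op_trace_def sum_negf J)
    finally show ?thesis by (simp add: trace0)
  qed
  then have "J W \<bullet> V = 0" for V using J(2)[of W V] by simp
  then have "J W = 0" by (metis inner_eq_zero_iff)
  moreover have "J (J W) = - W"
    by (simp add: W_def linear_sum[OF J(1)] J(3) sum_negf)
  ultimately have W: "W = 0" by (simp add: linear_0[OF J(1)])
  have "(\<Sum>b\<in>Basis. br (D b) (J b) \<bullet> Z) = 0"
  proof -
    \<comment> \<open>The derivation \<open>D\<close> hits either entry of
      \<open>br b (J b)\<close>. By the symmetry of \<open>BJ\<close> both terms have the same
      product with \<open>Z\<close>, which is where the 2 comes from.\<close>
    have "D (br b (J b)) \<bullet> Z = 2 * (br (D b) (J b) \<bullet> Z)" for b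
    proof -
      have "br b (J (D b)) \<bullet> Z = br (D b) (J b) \<bullet> Z"
        unfolding BJ by (simp add: inner_commute)
      then show ?thesis
        using jacobi[of "J Z" b "J b"] by (simp add: D_def[symmetric] DJ inner_add_left)
    qed
    then have "2 * (\<Sum>b\<in>Basis. br (D b) (J b) \<bullet> Z) = D W \<bullet> Z"
      by (simp add: W_def linear_sum[OF linD] inner_sum_left sum_distrib_left)
    then show ?thesis by (simp add: W linear_0[OF linD])
  qed
  moreover have "op_trace (\<lambda>x. D (D x)) = 0"
  proof (rule op_trace_nilpotent)
    show "linear (\<lambda>x. D (D x))" using linear_compose[OF linD linD] by (simp add: o_def)
    have "((\<lambda>x. D (D x)) ^^ m) y = (D ^^ (m + m)) y" for m y
      by (induction m) auto
    then show "((\<lambda>x. D (D x)) ^^ N) y = 0" for y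
      using nil[of "J Z"] linear_0[OF linD] by (simp add: D_def funpow_add zero)
  qed
  ultimately have "(\<Sum>b\<in>Basis. D b \<bullet> D b) = 0"
    by (simp add: BJ op_trace_def sum_subtractf sum_negf)
  then have "\<forall>b\<in>Basis. D b = 0"
    by (subst (asm) sum_nonneg_eq_0_iff) auto
  then have "D x = 0" for x
    using linear_eq_stdbasis[OF linD linear_zero] by (metis)
  then have "br x0 y0 \<bullet> Z = 0" by (simp add: B)
  then show False using xy by (simp add: Z_def)
qed

text \<open>Here \<eta> is the inner product with \<xi>. Normality at \<xi> makes
  \<open>br \<xi>\<close> commute with \<phi> and take values orthogonal to \<xi>; closedness at
  \<xi>, x, \<phi> y then makes it skew. The quotient by \<xi> is realised on the same space, by
  following the bracket with the orthogonal projection \<open>P\<close>.\<close>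

lemma nilpotent_quasi_sasakian_bracket:
  fixes br :: "'a::euclidean_space \<Rightarrow> 'a \<Rightarrow> 'a" and \<phi> :: "'a \<Rightarrow> 'a" and \<xi> :: 'a
  assumes lin: "\<And>x. linear (br x)" and alt: "\<And>x y. br x y = - br y x"
    and jacobi: "\<And>x y z. br x (br y z) = br (br x y) z + br y (br x z)"
    and \<phi>: "linear \<phi>" "\<And>x. \<phi> (\<phi> x) = - x + (x \<bullet> \<xi>) *\<^sub>R \<xi>"
      "\<And>x y. \<phi> x \<bullet> \<phi> y = x \<bullet> y - (x \<bullet> \<xi>) * (y \<bullet> \<xi>)"
    and \<xi>: "\<xi> \<bullet> \<xi> = 1"
    and normal: "\<And>x y. br (\<phi> x) (\<phi> y) + \<phi> (\<phi> (br x y)) - \<phi> (br x (\<phi> y)) - \<phi> (br (\<phi> x) y)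
      - (br x y \<bullet> \<xi>) *\<^sub>R \<xi> = 0"
    and closed: "\<And>x y z. br x y \<bullet> \<phi> z + br y z \<bullet> \<phi> x + br z x \<bullet> \<phi> y = 0"
    and filt: "C 0 = UNIV" "\<And>j x y. y \<in> C j \<Longrightarrow> br x y \<in> C (Suc j)" "C N = {0}"
  shows "br \<xi> x = 0" "br x y = (br x y \<bullet> \<xi>) *\<^sub>R \<xi>"
proof -
  have \<phi>0: "\<phi> 0 = 0" using linear_0[OF \<phi>(1)] .
  have \<phi>m: "\<phi> (- x) = - \<phi> x" for x using linear_neg[OF \<phi>(1)] .
  have \<phi>\<xi>: "\<phi> \<xi> = 0"
  proof -
    have "\<phi> \<xi> \<bullet> \<phi> \<xi> = 0" by (simp add: \<phi>(3) \<xi>)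
    then show ?thesis by simp
  qed
  have \<eta>\<phi>: "\<phi> x \<bullet> \<xi> = 0" for x
  proof -
    have "\<phi> (\<phi> (\<phi> x)) = - \<phi> x"
      unfolding \<phi>(2)[of x] by (simp add: linear_add[OF \<phi>(1)] linear_diff[OF \<phi>(1)] linear_cmul[OF \<phi>(1)] \<phi>m \<phi>\<xi>)
    from this[unfolded \<phi>(2)[of "\<phi> x"]] have "(\<phi> x \<bullet> \<xi>) *\<^sub>R \<xi> = 0" by simp
    then show ?thesis using \<xi> by auto
  qed
  have skew: "\<phi> x \<bullet> y = - (x \<bullet> \<phi> y)" for x y
    using \<phi>(3)[of x "\<phi> y"] by (simp add: \<phi>(2) \<eta>\<phi> inner_add_right inner_diff_right inner_commute[of \<xi>])
  have lin_left: "linear (\<lambda>x. br x y)" for y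
    using linear_compose_neg[OF lin[of y]] alt[of _ y] by simp
  define K where "K = br \<xi>"
  have N\<xi>: "- K x - \<phi> (K (\<phi> x)) = 0" for x
    using normal[of \<xi> x] by (simp add: \<phi>\<xi> linear_0[OF lin_left] \<phi>0 \<phi>(2) K_def)
  have \<eta>K: "K x \<bullet> \<xi> = 0" for x
    using arg_cong[OF N\<xi>[of x], of "\<lambda>v. v \<bullet> \<xi>"] by (simp add: inner_diff_left \<eta>\<phi>)
  have K\<phi>: "K (\<phi> x) = \<phi> (K x)" for x
  proof -
    have "K x = - \<phi> (K (\<phi> x))" using N\<xi>[of x] by (metis eq_iff_diff_eq_0 minus_minus)
    then show ?thesis by (simp add: \<phi>m \<phi>(2) \<eta>K)
  qed
  have nil: "((br x) ^^ m) y \<in> C m" for x y m by (induction m) (auto simp: filt)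
  have "K x \<bullet> y = - (x \<bullet> K y)" for x y
  proof -
    have "K x \<bullet> \<phi> (\<phi> y) = K (\<phi> y) \<bullet> \<phi> x"
      using closed[of \<xi> x "\<phi> y"] alt[of "\<phi> y" \<xi>] by (simp add: K_def \<phi>\<xi>)
    moreover have "K (\<phi> y) \<bullet> \<phi> x = K y \<bullet> x"
      by (simp add: K\<phi> \<phi>(3) \<eta>K)
    ultimately have "K x \<bullet> \<phi> (\<phi> y) = K y \<bullet> x" by simp
    then show ?thesis
      by (simp add: \<phi>(2) inner_add_right inner_diff_right \<eta>K inner_commute[of x])
  qed
  moreover have "(K ^^ Suc N) x = 0" for x
    using nil[where m = N and x = \<xi>] filt(3) linear_0[OF lin] by (auto simp: K_def)
  ultimately have "K x = 0" for x by (rule nilpotent_skew_zero)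
  then show \<xi>c: "br \<xi> x = 0" for x by (simp add: K_def)
  then have \<xi>c': "br x \<xi> = 0" for x using alt[of x \<xi>] by simp
  define P where "P x = x - (x \<bullet> \<xi>) *\<^sub>R \<xi>" for x
  have linP: "linear P"
    unfolding P_def by (intro linearI) (auto simp: algebra_simps)
  have brP: "br x (P y) = br x y" "br (P y) x = br y x" for x y
    by (simp_all add: P_def linear_diff[OF lin] linear_cmul[OF lin] linear_diff[OF lin_left]
        linear_cmul[OF lin_left] \<xi>c \<xi>c')
  have \<phi>P: "\<phi> (P x) = \<phi> x" for x
    by (simp add: P_def linear_diff[OF \<phi>(1)] linear_cmul[OF \<phi>(1)] \<phi>\<xi>)
  have P\<phi>: "P (\<phi> x) = \<phi> x" for x by (simp add: P_def \<eta>\<phi>)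
  have P_inner: "P x \<bullet> \<phi> y = x \<bullet> \<phi> y" for x y
    by (simp add: P_def inner_diff_left inner_commute[of \<xi>] \<eta>\<phi>)
  \<comment> \<open>\<open>P\<close> maps \<open>C 0\<close> only onto the complement of \<xi>,
    whereas the filtration has to start with the whole space.\<close>
  define C' where "C' j = (if j = 0 then UNIV else P ` C j)" for j
  \<comment> \<open>\<phi> kills \<xi> and so squares to -1 only on the complement of \<xi>. This is
    why the Kaehler lemma asks for \<open>J (J z) = - z\<close> just on brackets, which are
    projected here.\<close>
  have "P (br x y) = 0" for x y
  proof (rule nilpotent_kaehler_abelian[where br = "\<lambda>x y. P (br x y)" and J = \<phi> and C = C' and N = N])
    show "linear (\<lambda>y. P (br x y))" for x
      using linear_compose[OF lin linP] by (simp add: o_def)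
    show "P (br x y) = - P (br y x)" for x y
      using alt[of x y] linear_neg[OF linP] by simp
    show "P (br x (P (br y z))) = P (br (P (br x y)) z) + P (br y (P (br x z)))" for x y z
      by (simp add: brP linear_add[OF linP, symmetric] jacobi[of x y z])
    show "\<phi> (\<phi> (P (br x y))) = - P (br x y)" for x y
      by (simp add: \<phi>P \<phi>(2)) (simp add: P_def \<xi> inner_diff_left)
    show "P (br (\<phi> x) (\<phi> y)) - P (br x y) - \<phi> (P (br x (\<phi> y))) - \<phi> (P (br (\<phi> x) y)) = 0" for x y
    proof -
      have "P (br (\<phi> x) (\<phi> y)) = P (br (\<phi> x) (\<phi> y) + \<phi> (\<phi> (br x y)) - \<phi> (br x (\<phi> y))
          - \<phi> (br (\<phi> x) y) - (br x y \<bullet> \<xi>) *\<^sub>R \<xi>) + P (br x y) + \<phi> (br x (\<phi> y)) + \<phi> (br (\<phi> x) y)"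
        by (simp add: linear_diff[OF linP] linear_add[OF linP] P\<phi> \<phi>(2) linear_neg[OF linP])
      then show ?thesis unfolding normal by (simp add: \<phi>P linear_0[OF linP])
    qed
    show "P (br x y) \<bullet> \<phi> z + P (br y z) \<bullet> \<phi> x + P (br z x) \<bullet> \<phi> y = 0" for x y z
      by (simp add: P_inner closed)
    show "P (br x y) \<in> C' (Suc j)" if "y \<in> C' j" for j x y
      using that filt by (cases "j = 0") (auto simp: C'_def brP)
    show "C' N = {0}"
    proof -
      have "N \<noteq> 0"
      proof
        assume "N = 0"
        then have "\<xi> = 0" using filt(1,3) by auto
        then show False using \<xi> by simp
      qed
      then show ?thesis using filt(3) by (simp add: C'_def linear_0[OF linP])
    qed
  qed (use \<phi> skew in \<open>auto simp: C'_def\<close>)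
  then show "br x y = (br x y \<bullet> \<xi>) *\<^sub>R \<xi>" for x y by (simp add: P_def)
qed

section \<open>Normal forms of bilinear forms\<close>

text \<open>Gram-Schmidt for \<gamma>. It converts the metric at the unit of the group into the
  standard inner product, for which the algebraic lemmas are stated.\<close>

lemma inner_product_isometry:
  fixes \<gamma> :: "'a::euclidean_space \<Rightarrow> 'a \<Rightarrow> real"
  assumes lin: "\<And>x. linear (\<gamma> x)" and sym: "\<And>x y. \<gamma> x y = \<gamma> y x" and pos: "\<And>x. x \<noteq> 0 \<Longrightarrow> \<gamma> x x > 0"
  obtains S :: "'a \<Rightarrow> 'a" where "linear S" "bij S" "\<And>x y. \<gamma> (S x) (S y) = x \<bullet> y"
proof -
  have lin': "linear (\<lambda>x. \<gamma> x y)" for y using lin[of y] sym[of _ y] by simp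
  have "\<exists>e. \<forall>a\<in>A. \<forall>b\<in>A. \<gamma> (e a) (e b) = (if a = b then 1 else 0)"
    if "finite A" "A \<subseteq> Basis" for A :: "'a set"
    using that
  proof (induction A rule: finite_induct)
    case (insert c A)
    then obtain e where e: "\<forall>a\<in>A. \<forall>b\<in>A. \<gamma> (e a) (e b) = (if a = b then 1 else 0)" by auto
    have "A \<subset> Basis" using insert by blast
    then have "card A < DIM('a)" by (simp add: psubset_card_mono)
    then have "dim (e ` A) < DIM('a)"
      using dim_le_card'[of "e ` A"] card_image_le[OF insert(1), of e] insert(1) by simp
    then have "span (e ` A) \<noteq> UNIV" by (metis dim_UNIV dim_span less_irrefl)
    then obtain v where v: "v \<notin> span (e ` A)" by blast
    define w where "w = v - (\<Sum>a\<in>A. \<gamma> v (e a) *\<^sub>R e a)"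
    have "w \<noteq> 0"
    proof
      assume "w = 0"
      then have "v = (\<Sum>a\<in>A. \<gamma> v (e a) *\<^sub>R e a)" by (simp add: w_def)
      also have "\<dots> \<in> span (e ` A)" by (intro span_sum span_scale span_base) auto
      finally show False using v by simp
    qed
    then have ww: "\<gamma> w w > 0" by (rule pos)
    have wA: "\<gamma> w (e b) = 0" if "b \<in> A" for b
    proof -
      have "(\<Sum>a\<in>A. \<gamma> v (e a) * \<gamma> (e a) (e b)) = (\<Sum>a\<in>A. if a = b then \<gamma> v (e b) else 0)"
        by (rule sum.cong) (use e that in auto)
      then show ?thesis
        using insert(1) that
        by (simp add: w_def linear_diff[OF lin'] linear_sum[OF lin'] linear_cmul[OF lin'])
    qed
    define u where "u = w /\<^sub>R sqrt (\<gamma> w w)"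
    have "\<gamma> u u = 1"
      using ww by (simp add: u_def linear_cmul[OF lin] linear_cmul[OF lin'] field_simps
          flip: real_sqrt_mult)
    moreover have "\<gamma> u (e b) = 0" "\<gamma> (e b) u = 0" if "b \<in> A" for b
      using wA[OF that] sym[of "e b" u] by (simp_all add: u_def linear_cmul[OF lin'])
    ultimately show ?case
      using e insert(2) by (intro exI[of _ "e(c := u)"]) auto
  qed simp
  from this[OF finite_Basis subset_refl] obtain e where
    e: "\<forall>a\<in>Basis. \<forall>b\<in>Basis. \<gamma> (e a) (e b) = (if a = (b::'a) then 1 else 0)" by blast
  define S where "S x = (\<Sum>b\<in>Basis. (x \<bullet> b) *\<^sub>R e b)" for x :: 'a
  have S: "linear S"
    unfolding S_def by (intro linearI)
      (simp_all add: inner_add_left scaleR_add_left sum.distrib scaleR_sum_right)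
  have \<gamma>S: "\<gamma> (S x) (S y) = x \<bullet> y" for x y
  proof -
    have "\<gamma> (S x) (S y) = (\<Sum>a\<in>Basis. \<Sum>b\<in>Basis. (x \<bullet> a) * ((y \<bullet> b) * \<gamma> (e a) (e b)))"
      by (simp add: S_def linear_sum[OF lin'] linear_sum[OF lin] linear_cmul[OF lin]
          linear_cmul[OF lin'] sum_distrib_left mult.left_commute) (rule sum.swap)
    also have "\<dots> = (\<Sum>a\<in>Basis. \<Sum>b\<in>Basis. if b = a then (x \<bullet> a) * (y \<bullet> a) else 0)"
      by (intro sum.cong refl) (use e in auto)
    also have "\<dots> = x \<bullet> y" by (simp add: euclidean_inner[of x y])
    finally show ?thesis .
  qed
  have "inj S"
    unfolding linear_injective_0[OF S]
  proof safe
    fix x assume "S x = 0"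
    then have "x \<bullet> x = 0" using \<gamma>S[of x x] linear_0[OF lin] by simp
    then show "x = 0" by simp
  qed
  then have "bij S" by (simp add: bij_def linear_injective_imp_surjective[OF S])
  from S this show thesis by (rule that) (rule \<gamma>S)
qed

text \<open>Symplectic Gram-Schmidt without normalisation: a pair \<open>u\<close>, \<open>v\<close>
  with nonzero product is split off, this product becomes its weight, and the other vectors are
  corrected to be orthogonal to both. If the form vanishes on the whole list, two of its members are
  paired with weight 0. Spanning lists of even length avoid any bookkeeping of linear
  independence.\<close>

lemma darboux_pairs:
  fixes \<beta> :: "'a::real_vector \<Rightarrow> 'a \<Rightarrow> real"
  assumes lin: "\<And>x. linear (\<beta> x)" and alt: "\<And>x y. \<beta> x y = - \<beta> y x"
  shows "length xs = 2 * m \<Longrightarrow> \<exists>a b (w :: nat \<Rightarrow> real).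
    a ` {1..m} \<union> b ` {1..m} \<subseteq> span (set xs) \<and> set xs \<subseteq> span (a ` {1..m} \<union> b ` {1..m}) \<and>
    (\<forall>i\<in>{1..m}. \<forall>j\<in>{1..m}. \<beta> (a i) (a j) = 0 \<and> \<beta> (b i) (b j) = 0 \<and>
      \<beta> (a i) (b j) = (if i = j then w i else 0))"
proof (induction m arbitrary: xs)
  case (Suc m)
  have lin': "linear (\<lambda>x. \<beta> x y)" for y using linear_compose_neg[OF lin[of y]] alt[of _ y] by simp
  have self: "\<beta> x x = 0" for x using alt[of x x] by simp
  have "\<exists>u v zs. length zs = 2 * m \<and> {u, v} \<union> set zs \<subseteq> span (set xs) \<and>
    set xs \<subseteq> span ({u, v} \<union> set zs) \<and> (\<forall>z\<in>set zs. \<beta> z u = 0 \<and> \<beta> z v = 0)"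
  proof (cases "\<exists>u\<in>set xs. \<exists>v\<in>set xs. \<beta> u v \<noteq> 0")
    case True
    then obtain u v where uv: "u \<in> set xs" "v \<in> set xs" "\<beta> u v \<noteq> 0" by blast
    then have "u \<noteq> v" using self by auto
    define ys where "ys = remove1 v (remove1 u xs)"
    have ys: "length ys = 2 * m" "set xs = {u, v} \<union> set ys"
    proof -
      have "v \<in> set (remove1 u xs)" using uv \<open>u \<noteq> v\<close> by simp
      then show "length ys = 2 * m" using Suc.prems uv(1) by (simp add: ys_def length_remove1)
      have "insert v (set (remove1 v zs)) = set zs" if "v \<in> set zs" for v :: 'a and zs
        using that by (induction zs) auto
      from this[of v "remove1 u xs"] this[of u xs]
      show "set xs = {u, v} \<union> set ys" using uv \<open>v \<in> set (remove1 u xs)\<close> by (auto simp: ys_def)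
    qed
    define pr where "pr x = x - (\<beta> x v / \<beta> u v) *\<^sub>R u + (\<beta> x u / \<beta> u v) *\<^sub>R v" for x
    have "\<beta> (pr x) u = 0 \<and> \<beta> (pr x) v = 0" for x
      using uv(3) alt[of v u]
      by (simp add: pr_def linear_add[OF lin'] linear_diff[OF lin'] linear_cmul[OF lin'] self)
    moreover have "pr x \<in> span (set xs)" if "x \<in> set xs" for x
      unfolding pr_def by (intro span_add span_diff span_scale span_base uv that)
    moreover have "x \<in> span ({u, v} \<union> set (map pr ys))" if "x \<in> set ys" for x
    proof -
      have "x = pr x + (\<beta> x v / \<beta> u v) *\<^sub>R u - (\<beta> x u / \<beta> u v) *\<^sub>R v" by (simp add: pr_def)
      also have "\<dots> \<in> span ({u, v} \<union> set (map pr ys))"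
        by (intro span_add span_diff span_scale span_base) (use that in auto)
      finally show ?thesis .
    qed
    ultimately show ?thesis using ys uv
      by (intro exI[of _ u] exI[of _ v] exI[of _ "map pr ys"]) (auto intro: span_base)
  next
    case False
    obtain u xs' where "xs = u # xs'" using Suc.prems by (cases xs) auto
    moreover obtain v zs where "xs' = v # zs" using Suc.prems calculation by (cases xs') auto
    ultimately have xs: "xs = u # v # zs" by simp
    show ?thesis
      by (intro exI[of _ u] exI[of _ v] exI[of _ zs]) (use False Suc.prems xs in \<open>auto intro: span_base\<close>)
  qed
  then obtain u v zs where uvz: "length zs = 2 * m" "{u, v} \<union> set zs \<subseteq> span (set xs)"
    "set xs \<subseteq> span ({u, v} \<union> set zs)" "\<forall>z\<in>set zs. \<beta> z u = 0 \<and> \<beta> z v = 0" by blast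
  from Suc.IH[OF uvz(1)] obtain a b w where abw: "a ` {1..m} \<union> b ` {1..m} \<subseteq> span (set zs)"
    "set zs \<subseteq> span (a ` {1..m} \<union> b ` {1..m})"
    "\<forall>i\<in>{1..m}. \<forall>j\<in>{1..m}. \<beta> (a i) (a j) = 0 \<and> \<beta> (b i) (b j) = 0 \<and>
      \<beta> (a i) (b j) = (if i = j then w i else 0)" by blast
  have orth: "\<beta> s u = 0" "\<beta> s v = 0" if "s \<in> span (set zs)" for s
  proof -
    have "subspace {s. \<beta> s u = 0 \<and> \<beta> s v = 0}"
      by (auto simp: subspace_def linear_add[OF lin'] linear_cmul[OF lin'] linear_0[OF lin'])
    then have "span (set zs) \<subseteq> {s. \<beta> s u = 0 \<and> \<beta> s v = 0}"
      by (rule span_minimal[rotated]) (use uvz(4) in auto)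
    then show "\<beta> s u = 0" "\<beta> s v = 0" using that by auto
  qed
  have orth': "\<beta> u s = 0" "\<beta> v s = 0" if "s \<in> span (set zs)" for s
    using orth[OF that] alt[of u s] alt[of v s] by auto
  define a' b' w' where "a' = a(Suc m := u)" and "b' = b(Suc m := v)" and "w' = w(Suc m := \<beta> u v)"
  have im: "a' ` {1..Suc m} = insert u (a ` {1..m})" "b' ` {1..Suc m} = insert v (b ` {1..m})"
    by (auto simp: a'_def b'_def atLeastAtMostSuc_conv)
  let ?T = "span (insert u (a ` {1..m}) \<union> insert v (b ` {1..m}))"
  have "span (set zs) \<subseteq> span (set xs)"
    using uvz(2) span_minimal[OF _ subspace_span] by blast
  then have 1: "a' ` {1..Suc m} \<union> b' ` {1..Suc m} \<subseteq> span (set xs)"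
    unfolding im using abw(1) uvz(2) by blast
  have "set zs \<subseteq> ?T" using abw(2) span_mono[of "a ` {1..m} \<union> b ` {1..m}"
        "insert u (a ` {1..m}) \<union> insert v (b ` {1..m})"] by blast
  then have "{u, v} \<union> set zs \<subseteq> ?T" by (auto intro: span_base)
  then have "span ({u, v} \<union> set zs) \<subseteq> ?T" by (rule span_minimal[OF _ subspace_span])
  then have 2: "set xs \<subseteq> span (a' ` {1..Suc m} \<union> b' ` {1..Suc m})"
    unfolding im using uvz(3) by blast
  have ab: "a i \<in> span (set zs)" "b i \<in> span (set zs)" if "i \<in> {1..m}" for i
    using abw(1) that by auto
  have "\<forall>i\<in>{1..Suc m}. \<forall>j\<in>{1..Suc m}. \<beta> (a' i) (a' j) = 0 \<and> \<beta> (b' i) (b' j) = 0 \<and>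
      \<beta> (a' i) (b' j) = (if i = j then w' i else 0)"
  proof (intro ballI)
    fix i j assume "i \<in> {1..Suc m}" "j \<in> {1..Suc m}"
    then consider "i \<in> {1..m}" "j \<in> {1..m}" | "i = Suc m" "j \<in> {1..m}"
      | "i \<in> {1..m}" "j = Suc m" | "i = Suc m" "j = Suc m" by fastforce
    then show "\<beta> (a' i) (a' j) = 0 \<and> \<beta> (b' i) (b' j) = 0 \<and>
      \<beta> (a' i) (b' j) = (if i = j then w' i else 0)"
    proof cases
      case 1
      then show ?thesis using abw(3) by (simp add: a'_def b'_def w'_def)
    next
      case 2
      then show ?thesis using orth' ab by (auto simp: a'_def b'_def w'_def)
    next
      case 3
      then show ?thesis using orth ab by (auto simp: a'_def b'_def w'_def)
    next
      case 4
      then show ?thesis by (simp add: a'_def b'_def w'_def self)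
    qed
  qed
  with 1 2 show ?case by blast
qed simp

lemma bij_betw_std_basis: "bij_betw (std_basis :: nat \<Rightarrow> 'e::euclidean_space) {..<DIM('e)} Basis"
proof -
  have "\<exists>b :: nat \<Rightarrow> 'e. bij_betw b {..<DIM('e)} Basis"
    using ex_bij_betw_nat_finite[OF finite_Basis] by (auto simp: atLeast0LessThan)
  then show ?thesis unfolding std_basis_def by (rule someI_ex)
qed

lemma inner_std_basis:
  assumes "i < DIM('e)" "j < DIM('e)"
  shows "(std_basis i :: 'e::euclidean_space) \<bullet> std_basis j = (if i = j then 1 else 0)"
proof -
  have "(std_basis i :: 'e) \<in> Basis" "(std_basis j :: 'e) \<in> Basis"
    using bij_betwE[OF bij_betw_std_basis[where 'e = 'e]] assms by auto
  moreover have "(std_basis i :: 'e) = std_basis j \<longleftrightarrow> i = j"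
    using inj_on_eq_iff[OF bij_betw_imp_inj_on[OF bij_betw_std_basis[where 'e = 'e]]] assms by simp
  ultimately show ?thesis by (simp add: inner_Basis)
qed

text \<open>The coefficient of \<xi> in the bracket of the weighted Heisenberg algebra. Its factor 2
  is cancelled by the 1/2 of the Baker-Campbell-Hausdorff product, which is why none appears in
  \<open>heisenberg_group\<close>.\<close>

definition heisenberg_form :: "nat \<Rightarrow> (nat \<Rightarrow> real) \<Rightarrow> 'e::euclidean_space \<Rightarrow> 'e \<Rightarrow> real" where
  "heisenberg_form n w x y = (\<Sum>r\<in>{1..n}. 2 * w r * ((x \<bullet> std_basis r) * (y \<bullet> std_basis (n + r))
     - (x \<bullet> std_basis (n + r)) * (y \<bullet> std_basis r)))"

lemma alternating_form_normal_form:
  fixes \<beta> :: "'e::euclidean_space \<Rightarrow> 'e \<Rightarrow> real"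
  assumes lin: "\<And>x. linear (\<beta> x)" and alt: "\<And>x y. \<beta> x y = - \<beta> y x"
    and \<xi>: "\<And>x. \<beta> \<xi> x = 0" "\<xi> \<noteq> 0" and dim: "DIM('e) = 2 * n + 1"
  obtains S :: "'e \<Rightarrow> 'e" and w where "linear S" "bij S" "S (std_basis 0) = \<xi>"
    "\<And>x y. \<beta> (S x) (S y) = heisenberg_form n w x y"
proof -
  have lin': "linear (\<lambda>x. \<beta> x y)" for y using linear_compose_neg[OF lin[of y]] alt[of _ y] by simp
  have \<xi>': "\<beta> x \<xi> = 0" for x using alt[of x \<xi>] \<xi> by simp
  \<comment> \<open>The hyperplane orthogonal to \<xi> has the even dimension 2n, so a basis of it
    can be fed to \<open>darboux_pairs\<close>.\<close>
  obtain X where X: "X \<subseteq> {x. \<xi> \<bullet> x = 0}" "independent X" "{x. \<xi> \<bullet> x = 0} \<subseteq> span X" "card X = 2 * n"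
    using basis_exists[of "{x. \<xi> \<bullet> x = 0}"] dim_hyperplane[OF \<xi>(2)] dim by auto
  obtain xs where xs: "set xs = X" "length xs = 2 * n"
    using finite_distinct_list[of X] X(2,4) independent_imp_finite distinct_card by metis
  from darboux_pairs[OF lin alt xs(2)] obtain a b w where
    ab: "set xs \<subseteq> span (a ` {1..n} \<union> b ` {1..n})"
    "\<forall>i\<in>{1..n}. \<forall>j\<in>{1..n}. \<beta> (a i) (a j) = 0 \<and> \<beta> (b i) (b j) = 0 \<and>
      \<beta> (a i) (b j) = (if i = j then w i else 0)" by blast
  define S where "S x = (x \<bullet> std_basis 0) *\<^sub>R \<xi> + ((\<Sum>r\<in>{1..n}. (x \<bullet> std_basis r) *\<^sub>R a r)
    + (\<Sum>r\<in>{1..n}. (x \<bullet> std_basis (n + r)) *\<^sub>R b r))" for x :: 'e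
  have S: "linear S"
    unfolding S_def by (intro linearI)
      (simp_all add: inner_add_left scaleR_add_left sum.distrib scaleR_sum_right scaleR_add_right)
  have S0: "S (std_basis 0) = \<xi>"
    by (simp add: S_def inner_std_basis dim)
  have Sa: "S (std_basis r) = a r" "S (std_basis (n + r)) = b r" if "r \<in> {1..n}" for r
  proof -
    have delta: "(\<Sum>s\<in>{1..n}. (if r = s then 1 else 0 :: real) *\<^sub>R c s) = c r" for c :: "nat \<Rightarrow> 'e"
    proof -
      have "(\<Sum>s\<in>{1..n}. (if r = s then 1 else 0 :: real) *\<^sub>R c s) = (\<Sum>s\<in>{1..n}. if s = r then c r else 0)"
        by (rule sum.cong) auto
      then show ?thesis using that by simp
    qed
    show "S (std_basis r) = a r" "S (std_basis (n + r)) = b r"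
      using that delta[of a] delta[of b] unfolding S_def by (simp_all add: inner_std_basis dim)
  qed
  \<comment> \<open>The Darboux vectors are only known to span; between spaces of equal dimension
    surjectivity of \<open>S\<close> suffices.\<close>
  have "surj S"
  proof -
    have sub: "subspace (range S)" by (rule linear_subspace_image[OF S subspace_UNIV])
    have "a ` {1..n} \<union> b ` {1..n} \<subseteq> range S"
    proof
      fix y assume "y \<in> a ` {1..n} \<union> b ` {1..n}"
      then obtain r where r: "r \<in> {1..n}" "y = a r \<or> y = b r" by blast
      show "y \<in> range S" using Sa[OF r(1)] r(2) by (metis rangeI)
    qed
    then have "span (a ` {1..n} \<union> b ` {1..n}) \<subseteq> range S" using sub by (rule span_minimal)
    then have "X \<subseteq> range S" using ab(1) xs(1) by auto
    then have "span X \<subseteq> range S" using sub by (rule span_minimal)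
    moreover have "x - (\<xi> \<bullet> x / (\<xi> \<bullet> \<xi>)) *\<^sub>R \<xi> \<in> {x. \<xi> \<bullet> x = 0}" for x
      using \<xi>(2) by (simp add: inner_diff_right)
    ultimately have "x - (\<xi> \<bullet> x / (\<xi> \<bullet> \<xi>)) *\<^sub>R \<xi> \<in> range S" for x using X(3) by blast
    moreover have "(\<xi> \<bullet> x / (\<xi> \<bullet> \<xi>)) *\<^sub>R \<xi> \<in> range S" for x
      using S0 sub by (metis rangeI subspace_scale)
    ultimately have "x \<in> range S" for x using sub by (metis diff_add_cancel subspace_add)
    then show ?thesis by auto
  qed
  then have bij: "bij S" using linear_surjective_imp_injective[OF S] by (simp add: bij_def)
  \<comment> \<open>The weights are halved because \<open>heisenberg_form\<close> already contains a
    factor 2.\<close>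
  have form: "\<beta> (S x) (S y) = heisenberg_form n (\<lambda>r. w r / 2) x y" for x y
  proof -
    define c where "c z r = z \<bullet> (std_basis r :: 'e)" for z r
    define A where "A z = (\<Sum>r\<in>{1..n}. c z r *\<^sub>R a r)" for z
    define B where "B z = (\<Sum>r\<in>{1..n}. c z (n + r) *\<^sub>R b r)" for z
    have SAB: "S z = c z 0 *\<^sub>R \<xi> + (A z + B z)" for z by (simp add: S_def A_def B_def c_def)
    have AA: "\<beta> (A x) (A y) = 0" and BB: "\<beta> (B x) (B y) = 0" for x y
      unfolding A_def B_def
      by (simp_all add: linear_sum[OF lin'] linear_sum[OF lin] linear_cmul[OF lin]
          linear_cmul[OF lin'] ab(2))
    have AB: "\<beta> (A x) (B y) = (\<Sum>r\<in>{1..n}. w r * (c x r * c y (n + r)))" for x y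
    proof -
      have "\<beta> (A x) (B y) = (\<Sum>s\<in>{1..n}. \<Sum>r\<in>{1..n}. c x r * (c y (n + s) * \<beta> (a r) (b s)))"
        unfolding A_def B_def
        by (simp add: linear_sum[OF lin'] linear_sum[OF lin] linear_cmul[OF lin]
          linear_cmul[OF lin'] sum_distrib_left mult.left_commute)
      also have "\<dots> = (\<Sum>s\<in>{1..n}. \<Sum>r\<in>{1..n}. if r = s then w s * (c x s * c y (n + s)) else 0)"
        by (intro sum.cong refl) (use ab(2) in auto)
      finally show ?thesis by simp
    qed
    have "\<beta> (S x) (S y) = \<beta> (A x) (B y) - \<beta> (A y) (B x)"
      using alt[of "B x" "A y"]
      by (simp add: SAB linear_add[OF lin] linear_add[OF lin'] linear_cmul[OF lin]
          linear_cmul[OF lin'] \<xi> \<xi>' AA BB)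
    also have "\<dots> = heisenberg_form n (\<lambda>r. w r / 2) x y"
      unfolding AB heisenberg_form_def c_def
      by (simp add: algebra_simps flip: sum_subtractf)
    finally show ?thesis .
  qed
  from S bij S0 show thesis by (rule that) (rule form)
qed

section \<open>Charts, smooth maps and translations\<close>

text \<open>The topological part of \<open>smooth_atlas\<close>. Composition of smooth maps rests on
  it alone, because \<open>smooth_map\<close> quantifies over all pairs of charts; product atlases
  can thus be used as soon as this part is checked.\<close>

definition chart_cover :: "('g::topological_space, 'e::euclidean_space) chart set \<Rightarrow> bool" where
  "chart_cover A \<longleftrightarrow> (\<Union>(U, x)\<in>A. U) = UNIV \<and>
     (\<forall>(U, x)\<in>A. open U \<and> open (x ` U) \<and> homeomorphism U (x ` U) x (inv_into U x))"

lemma smooth_atlas_chart_cover: "smooth_atlas A \<Longrightarrow> chart_cover A"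
  by (simp add: smooth_atlas_def chart_cover_def)

lemma chart_cover_euclidean: "chart_cover euclidean_atlas"
  by (auto simp: chart_cover_def euclidean_atlas_def homeomorphism_def)

lemma chart_coverE:
  assumes "chart_cover A"
  obtains U x where "(U, x) \<in> A" "p \<in> U"
  using assms unfolding chart_cover_def by blast

lemma chartD:
  assumes "chart_cover A" "(U, x) \<in> A"
  shows "open U" "open (x ` U)" "continuous_on U x" "continuous_on (x ` U) (inv_into U x)"
    "\<And>p. p \<in> U \<Longrightarrow> inv_into U x (x p) = p"
    "\<And>u. u \<in> x ` U \<Longrightarrow> x (inv_into U x u) = u" "\<And>u. u \<in> x ` U \<Longrightarrow> inv_into U x u \<in> U"
  using assms by (auto simp: chart_cover_def homeomorphism_def inv_into_into)

lemma chart_image_Int: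
  assumes "chart_cover A" "(U, x) \<in> A"
  shows "x ` (U \<inter> W) = {u \<in> x ` U. inv_into U x u \<in> W}"
  using chartD[OF assms] by force

lemma open_chart_preimage:
  assumes "chart_cover A" "(U, x) \<in> A" "open W"
  shows "open {u \<in> x ` U. inv_into U x u \<in> W}"
proof -
  have "open (x ` U \<inter> inv_into U x -` W)"
    using chartD[OF assms(1,2)] assms(3) by (intro continuous_open_preimage)
  then show ?thesis by (simp add: Int_def vimage_def)
qed

lemma smooth_mapI:
  assumes "chart_cover A" "continuous_on UNIV F"
    "\<And>U x V y p. (U, x) \<in> A \<Longrightarrow> (V, y) \<in> B \<Longrightarrow> p \<in> U \<Longrightarrow> F p \<in> V \<Longrightarrow>
      \<exists>T. open T \<and> x p \<in> T \<and> smooth_on T (\<lambda>u. y (F (inv_into U x u)))"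
  shows "smooth_map A B F"
  unfolding smooth_map_def
proof (intro conjI ballI, safe)
  fix U x V y assume *: "(U, x) \<in> A" "(V, y) \<in> B"
  show "smooth_on (x ` (U \<inter> F -` V)) (y \<circ> F \<circ> inv_into U x)"
    by (rule smooth_on_local) (use assms(3)[OF *] in \<open>auto simp: o_def\<close>)
qed (rule assms)

lemma smooth_mapD:
  assumes "chart_cover A" "smooth_map A B F" "(U, x) \<in> A" "(V, y) \<in> B"
  shows "smooth_on {u \<in> x ` U. F (inv_into U x u) \<in> V} (\<lambda>u. y (F (inv_into U x u)))"
proof -
  have "smooth_on (x ` (U \<inter> F -` V)) (y \<circ> F \<circ> inv_into U x)"
    using assms unfolding smooth_map_def by blast
  then show ?thesis unfolding chart_image_Int[OF assms(1,3)] by (simp add: o_def)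
qed

lemma smooth_map_continuous: "smooth_map A B F \<Longrightarrow> continuous_on UNIV F"
  by (simp add: smooth_map_def)

lemma open_continuous_vimage: "continuous_on UNIV F \<Longrightarrow> open V \<Longrightarrow> open (F -` V)"
  by (simp add: open_vimage)

lemma smooth_map_compose:
  assumes A: "chart_cover A" and B: "chart_cover B" and C: "chart_cover C"
    and F: "smooth_map A B F" and K: "smooth_map B C K"
  shows "smooth_map A C (\<lambda>p. K (F p))"
proof (rule smooth_mapI[OF A])
  note cF = smooth_map_continuous[OF F] and cK = smooth_map_continuous[OF K]
  show "continuous_on UNIV (\<lambda>p. K (F p))" using continuous_on_compose2[OF cK cF] by simp
  fix U x W z p assume Ux: "(U, x) \<in> A" and Wz: "(W, z) \<in> C" and p: "p \<in> U" "K (F p) \<in> W"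
  obtain V y where Vy: "(V, y) \<in> B" "F p \<in> V" using chart_coverE[OF B] by blast
  define T where "T = {u \<in> x ` U. inv_into U x u \<in> F -` (V \<inter> K -` W)}"
  define T' where "T' = {v \<in> y ` V. inv_into V y v \<in> K -` W}"
  have "open T" unfolding T_def
    by (intro open_chart_preimage[OF A Ux] open_continuous_vimage[OF cF] open_Int
        open_continuous_vimage[OF cK] chartD(1)[OF B Vy(1)] chartD(1)[OF C Wz])
  have "open T'" unfolding T'_def
    by (intro open_chart_preimage[OF B Vy(1)] open_continuous_vimage[OF cK] chartD(1)[OF C Wz])
  have "smooth_on T (\<lambda>u. z (K (inv_into V y (y (F (inv_into U x u))))))"
  proof (rule smooth_on_compose[OF \<open>open T\<close> \<open>open T'\<close>, where g = "\<lambda>v. z (K (inv_into V y v))"])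
    show "(\<lambda>u. y (F (inv_into U x u))) ` T \<subseteq> T'"
      using chartD[OF B Vy(1)] by (auto simp: T_def T'_def)
    show "smooth_on T (\<lambda>u. y (F (inv_into U x u)))"
      by (rule smooth_on_subset[OF smooth_mapD[OF A F Ux Vy(1)]]) (auto simp: T_def)
    show "smooth_on T' (\<lambda>v. z (K (inv_into V y v)))"
      using smooth_mapD[OF B K Vy(1) Wz] by (simp add: T'_def)
  qed
  then have "smooth_on T (\<lambda>u. z (K (F (inv_into U x u))))"
    by (rule smooth_on_cong[OF \<open>open T\<close>, rotated]) (auto simp: T_def chartD[OF B Vy(1)])
  moreover have "x p \<in> T" using p Vy chartD[OF A Ux] by (auto simp: T_def)
  ultimately show "\<exists>T. open T \<and> x p \<in> T \<and> smooth_on T (\<lambda>u. z (K (F (inv_into U x u))))"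
    using \<open>open T\<close> by blast
qed

lemma smooth_functions_iff:
  "f \<in> smooth_functions A \<longleftrightarrow>
     continuous_on UNIV f \<and> (\<forall>(U, x)\<in>A. smooth_on (x ` U) (\<lambda>u. f (inv_into U x u)))"
  by (simp add: smooth_functions_def smooth_map_def euclidean_atlas_def o_def)

lemma smooth_functionsI:
  fixes A :: "('g::t2_space, 'e::euclidean_space) chart set"
  assumes A: "chart_cover A" and sm: "\<And>U x. (U, x) \<in> A \<Longrightarrow> smooth_on (x ` U) (\<lambda>u. f (inv_into U x u))"
  shows "f \<in> smooth_functions A"
proof -
  have "isCont f p" for p
  proof -
    obtain U x where Ux: "(U, x) \<in> A" "p \<in> U" by (rule chart_coverE[OF A])
    have "continuous_on U (\<lambda>q. f (inv_into U x (x q)))"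
      by (rule continuous_on_compose2[OF smooth_on_continuous_on[OF sm[OF Ux(1)]] chartD(3)[OF A Ux(1)]]) auto
    then have "continuous_on U f"
      by (rule continuous_on_eq) (simp add: chartD(5)[OF A Ux(1)])
    then show ?thesis using Ux(2) chartD(1)[OF A Ux(1)] by (simp add: continuous_on_eq_continuous_at)
  qed
  then show ?thesis using sm by (auto simp: smooth_functions_iff intro: continuous_at_imp_continuous_on)
qed

lemma smooth_functions_const: "chart_cover A \<Longrightarrow> (\<lambda>p. c) \<in> smooth_functions A"
  by (auto simp: smooth_functions_iff chart_cover_def intro: smooth_on_const)

lemma smooth_functions_add:
  "chart_cover A \<Longrightarrow> f \<in> smooth_functions A \<Longrightarrow> h \<in> smooth_functions A \<Longrightarrow>
    (\<lambda>p. f p + h p) \<in> smooth_functions A"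
  by (auto simp: smooth_functions_iff chart_cover_def intro!: smooth_on_add continuous_on_add)

lemma smooth_functions_mult:
  "chart_cover A \<Longrightarrow> f \<in> smooth_functions A \<Longrightarrow> h \<in> smooth_functions A \<Longrightarrow>
    (\<lambda>p. f p * h p) \<in> smooth_functions A"
  by (auto simp: smooth_functions_iff chart_cover_def intro!: smooth_on_mult continuous_on_mult)

lemma smooth_functions_compose:
  assumes "chart_cover A" "chart_cover B" "smooth_map A B F" "f \<in> smooth_functions B"
  shows "(\<lambda>p. f (F p)) \<in> smooth_functions A"
  using smooth_map_compose[OF assms(1,2) chart_cover_euclidean assms(3)] assms(4)
  by (simp add: smooth_functions_def)


lemma chart_cover_prod:
  assumes A: "chart_cover A" and B: "chart_cover B"
  shows "chart_cover (prod_atlas A B)"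
    and "(U, x) \<in> A \<Longrightarrow> (V, y) \<in> B \<Longrightarrow> u \<in> x ` U \<Longrightarrow> v \<in> y ` V \<Longrightarrow>
      inv_into (U \<times> V) (map_prod x y) (u, v) = (inv_into U x u, inv_into V y v)"
proof -
  have inv: "inv_into (U \<times> V) (map_prod x y) (u, v) = (inv_into U x u, inv_into V y v)"
    if *: "(U, x) \<in> A" "(V, y) \<in> B" "u \<in> x ` U" "v \<in> y ` V" for U x V y u v
  proof -
    have "inj_on (map_prod x y) (U \<times> V)"
      using chartD(5)[OF A *(1)] chartD(5)[OF B *(2)] by (intro map_prod_inj_on inj_on_inverseI)
    then show ?thesis
      by (rule inv_into_f_eq) (use chartD[OF A *(1)] chartD[OF B *(2)] * in auto)
  qed
  then show "(U, x) \<in> A \<Longrightarrow> (V, y) \<in> B \<Longrightarrow> u \<in> x ` U \<Longrightarrow> v \<in> y ` V \<Longrightarrow>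
      inv_into (U \<times> V) (map_prod x y) (u, v) = (inv_into U x u, inv_into V y v)" .
  show "chart_cover (prod_atlas A B)"
    unfolding chart_cover_def
  proof (intro conjI)
    show "(\<Union>(W, z)\<in>prod_atlas A B. W) = UNIV"
    proof safe
      fix a b
      obtain U x where 1: "(U, x) \<in> A" "a \<in> U" by (rule chart_coverE[OF A])
      obtain V y where 2: "(V, y) \<in> B" "b \<in> V" by (rule chart_coverE[OF B])
      have "(U \<times> V, map_prod x y) \<in> prod_atlas A B" using 1 2 by (auto simp: prod_atlas_def)
      then show "(a, b) \<in> (\<Union>(W, z)\<in>prod_atlas A B. W)"
        by (rule UN_I) (use 1 2 in simp)
    qed simp
    have "open (U \<times> V) \<and> open (map_prod x y ` (U \<times> V)) \<and>
      homeomorphism (U \<times> V) (map_prod x y ` (U \<times> V)) (map_prod x y) (inv_into (U \<times> V) (map_prod x y))"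
      if *: "(U, x) \<in> A" "(V, y) \<in> B" for U x V y
    proof (intro conjI)
      note 1 = chartD[OF A *(1)] and 2 = chartD[OF B *(2)]
      have im: "map_prod x y ` (U \<times> V) = (x ` U) \<times> (y ` V)" by auto
      show "open (U \<times> V)" "open (map_prod x y ` (U \<times> V))"
        unfolding im using 1(1,2) 2(1,2) by (auto intro: open_Times)
      show "homeomorphism (U \<times> V) (map_prod x y ` (U \<times> V)) (map_prod x y) (inv_into (U \<times> V) (map_prod x y))"
      proof (rule homeomorphismI)
        have "continuous_on (U \<times> V) (\<lambda>p. (x (fst p), y (snd p)))"
          by (intro continuous_on_Pair continuous_on_compose2[OF 1(3)] continuous_on_compose2[OF 2(3)]
              continuous_on_fst continuous_on_snd continuous_on_id) auto
        then show "continuous_on (U \<times> V) (map_prod x y)"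
          by (simp add: map_prod_def case_prod_unfold)
        have "continuous_on ((x ` U) \<times> (y ` V)) (\<lambda>p. (inv_into U x (fst p), inv_into V y (snd p)))"
          by (intro continuous_on_Pair continuous_on_compose2[OF 1(4)] continuous_on_compose2[OF 2(4)]
              continuous_on_fst continuous_on_snd continuous_on_id) auto
        then show "continuous_on (map_prod x y ` (U \<times> V)) (inv_into (U \<times> V) (map_prod x y))"
          unfolding im by (rule continuous_on_eq) (auto simp: inv[OF *])
        show "inv_into (U \<times> V) (map_prod x y) ` map_prod x y ` (U \<times> V) \<subseteq> U \<times> V"
          by (auto simp: inv[OF *] 1 2)
        show "inv_into (U \<times> V) (map_prod x y) (map_prod x y p) = p" if "p \<in> U \<times> V" for p
          using that by (auto simp: inv[OF *] 1 2)
        show "map_prod x y (inv_into (U \<times> V) (map_prod x y) q) = q" if "q \<in> map_prod x y ` (U \<times> V)" for q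
          using that by (auto simp: inv[OF *] 1 2)
      qed auto
    qed
    then show "\<forall>(W, z)\<in>prod_atlas A B. open W \<and> open (z ` W) \<and> homeomorphism W (z ` W) z (inv_into W z)"
      unfolding prod_atlas_def by blast
  qed
qed

section \<open>The Lie algebra of a Lie group\<close>

locale lie_chart =
  fixes G :: "('g::{t2_space,second_countable_topology}, 'e::euclidean_space) smooth_group" (structure)
    and U :: "'g set" and x :: "'g \<Rightarrow> 'e"
  assumes lie: "lie_group G" and chart: "(U, x) \<in> atlas G" and one_U: "\<one> \<in> U"
begin

lemma group_G: "group G" and carrier_G [simp]: "carrier G = UNIV"
  using lie by (auto simp: lie_group_def)

sublocale group G by (rule group_G)

lemma cc: "chart_cover (atlas G)"
  using lie by (simp add: lie_group_def smooth_atlas_chart_cover)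

lemma inv_mult_cancel [simp]: "inv a \<otimes> (a \<otimes> b) = b" "a \<otimes> (inv a \<otimes> b) = b"
  by (simp_all flip: m_assoc)

text \<open>The chart is shifted so that the unit has coordinate 0, the point where balls and ray
  integrals are centred. \<open>\<kappa>\<close> inverts the shifted chart, and \<open>dm\<close> is
  the set of its coordinates.\<close>

definition "crd a = x a - x \<one>"
definition "\<kappa> u = inv_into U x (u + x \<one>)"
definition "dm = {u. u + x \<one> \<in> x ` U}"

lemmas ch = chartD[OF cc chart]

lemma dm_vimage: "dm = (\<lambda>u. u + x \<one>) -` (x ` U)"
  by (auto simp: dm_def)

lemma open_dm: "open dm"
  unfolding dm_vimage by (intro open_vimage ch(2) continuous_intros)

lemma zero_dm: "0 \<in> dm" using one_U by (simp add: dm_def)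

lemma \<kappa>_0 [simp]: "\<kappa> 0 = \<one>" using one_U by (simp add: \<kappa>_def ch)

lemma crd_\<kappa>: "u \<in> dm \<Longrightarrow> crd (\<kappa> u) = u"
  and \<kappa>_crd: "a \<in> U \<Longrightarrow> \<kappa> (crd a) = a"
  and crd_dm: "a \<in> U \<Longrightarrow> crd a \<in> dm"
  and \<kappa>_U: "u \<in> dm \<Longrightarrow> \<kappa> u \<in> U"
  by (simp_all add: dm_def crd_def \<kappa>_def ch)

lemma continuous_on_\<kappa>: "continuous_on dm \<kappa>"
  unfolding \<kappa>_def by (rule continuous_on_compose2[OF ch(4)]) (auto simp: dm_def intro!: continuous_intros)

lemma continuous_on_crd: "continuous_on U crd"
  unfolding crd_def by (intro continuous_intros ch(3))

lemma mult_smooth: "smooth_map (prod_atlas (atlas G) (atlas G)) (atlas G) (\<lambda>(a, b). a \<otimes> b)"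
  and inv_smooth: "smooth_map (atlas G) (atlas G) (\<lambda>a. inv a)"
  using lie by (auto simp: lie_group_def)

lemma continuous_mult:
  assumes "continuous_on S f" "continuous_on S h"
  shows "continuous_on S (\<lambda>p. f p \<otimes> h p)"
proof -
  have "continuous_on UNIV (\<lambda>(a, b). a \<otimes> b)" using mult_smooth by (rule smooth_map_continuous)
  from continuous_on_compose2[OF this continuous_on_Pair[OF assms]] show ?thesis by simp
qed

lemma continuous_inv:
  assumes "continuous_on S f"
  shows "continuous_on S (\<lambda>p. inv (f p))"
  using continuous_on_compose2[OF smooth_map_continuous[OF inv_smooth] assms] by simp

lemma mult_smooth_charts:
  assumes W: "(W, z) \<in> atlas G" and V: "(V, y) \<in> atlas G" and Z: "(Z, t) \<in> atlas G"
  defines "N \<equiv> {q. fst q \<in> z ` W \<and> snd q \<in> t ` Z \<and> inv_into W z (fst q) \<otimes> inv_into Z t (snd q) \<in> V}"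
  shows "open N" "smooth_on N (\<lambda>q. y (inv_into W z (fst q) \<otimes> inv_into Z t (snd q)))"
proof -
  note cp = chart_cover_prod(1)[OF cc cc]
  have WZ: "(W \<times> Z, map_prod z t) \<in> prod_atlas (atlas G) (atlas G)"
    using W Z by (auto simp: prod_atlas_def)
  have N: "N = {q \<in> map_prod z t ` (W \<times> Z). (\<lambda>(a, b). a \<otimes> b) (inv_into (W \<times> Z) (map_prod z t) q) \<in> V}"
  proof -
    have "map_prod z t ` (W \<times> Z) = (z ` W) \<times> (t ` Z)" by auto
    then show ?thesis by (auto simp: N_def chart_cover_prod(2)[OF cc cc W Z])
  qed
  show o: "open N"
  proof -
    have "open ((\<lambda>(a, b). a \<otimes> b) -` V)"
      by (rule open_continuous_vimage[OF smooth_map_continuous[OF mult_smooth] chartD(1)[OF cc V]])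
    from open_chart_preimage[OF cp WZ this] show ?thesis by (simp add: N vimage_def)
  qed
  show "smooth_on N (\<lambda>q. y (inv_into W z (fst q) \<otimes> inv_into Z t (snd q)))"
    by (rule smooth_on_cong[OF o _ smooth_mapD[OF cp mult_smooth WZ V, folded N]])
      (auto simp: N_def chart_cover_prod(2)[OF cc cc W Z])
qed

lemma left_translation_smooth: "smooth_map (atlas G) (atlas G) (\<lambda>b. a \<otimes> b)"
proof (rule smooth_mapI[OF cc])
  show "continuous_on UNIV (\<lambda>b. a \<otimes> b)" by (intro continuous_mult continuous_intros)
  fix Z t V y p assume Z: "(Z, t) \<in> atlas G" and V: "(V, y) \<in> atlas G" and p: "p \<in> Z" "a \<otimes> p \<in> V"
  obtain W z where W: "(W, z) \<in> atlas G" "a \<in> W" by (rule chart_coverE[OF cc])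
  note m = mult_smooth_charts[OF W(1) V Z]
  define N where "N = {q. fst q \<in> z ` W \<and> snd q \<in> t ` Z \<and> inv_into W z (fst q) \<otimes> inv_into Z t (snd q) \<in> V}"
  define T where "T = (\<lambda>u. (z a, u)) -` N"
  have "open T" unfolding T_def N_def by (intro open_vimage m(1) continuous_intros)
  have "smooth_on T (\<lambda>u. (\<lambda>q. y (inv_into W z (fst q) \<otimes> inv_into Z t (snd q))) (z a, u))"
    by (rule smooth_on_compose[OF \<open>open T\<close> m(1) _ _ m(2)])
      (auto simp: T_def N_def intro!: smooth_intros \<open>open T\<close>[unfolded T_def N_def, simplified])
  moreover have "t p \<in> T" using W p chartD[OF cc W(1)] chartD[OF cc Z] by (auto simp: T_def N_def)
  ultimately show "\<exists>T. open T \<and> t p \<in> T \<and> smooth_on T (\<lambda>u. y (a \<otimes> inv_into Z t u))"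
    using \<open>open T\<close> W(2) chartD[OF cc W(1)] by (intro exI[of _ T]) simp
qed

abbreviation "SF \<equiv> smooth_functions (atlas G)"

lemma SF_translate: "f \<in> SF \<Longrightarrow> (\<lambda>b. f (a \<otimes> b)) \<in> SF"
  by (rule smooth_functions_compose[OF cc cc left_translation_smooth])

lemma SF_translate_iff: "(\<lambda>b. f (a \<otimes> b)) \<in> SF \<longleftrightarrow> f \<in> SF"
  using SF_translate[of "\<lambda>b. f (a \<otimes> b)" "inv a"] SF_translate[of f a] by auto

lemma smooth_on_shift:
  assumes "smooth_on S f" "open S"
  shows "smooth_on {u. u + c \<in> S} (\<lambda>u. f (u + c))"
proof -
  have "open {u. u + c \<in> S}"
    using open_vimage[OF assms(2), of "\<lambda>u. u + c"] by (simp add: vimage_def continuous_intros)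
  then show ?thesis
    by (intro smooth_on_compose[OF _ assms(2) _ _ assms(1)] smooth_intros) auto
qed

lemma smooth_mult_crd:
  "open {q. fst q \<in> dm \<and> snd q \<in> dm \<and> \<kappa> (fst q) \<otimes> \<kappa> (snd q) \<in> U}"
  "smooth_on {q. fst q \<in> dm \<and> snd q \<in> dm \<and> \<kappa> (fst q) \<otimes> \<kappa> (snd q) \<in> U}
     (\<lambda>q. crd (\<kappa> (fst q) \<otimes> \<kappa> (snd q)))"
proof -
  note m = mult_smooth_charts[OF chart chart chart]
  let ?N = "{q. fst q \<in> dm \<and> snd q \<in> dm \<and> \<kappa> (fst q) \<otimes> \<kappa> (snd q) \<in> U}"
  let ?M = "{q. fst q \<in> x ` U \<and> snd q \<in> x ` U \<and> inv_into U x (fst q) \<otimes> inv_into U x (snd q) \<in> U}"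
  have N: "?N = {q. q + (x \<one>, x \<one>) \<in> ?M}" by (auto simp: dm_def \<kappa>_def)
  show o: "open ?N"
    unfolding N using open_vimage[OF m(1), of "\<lambda>u. u + (x \<one>, x \<one>)"]
    by (simp add: vimage_def continuous_intros)
  have "smooth_on ?N (\<lambda>q. x (inv_into U x (fst (q + (x \<one>, x \<one>))) \<otimes> inv_into U x (snd (q + (x \<one>, x \<one>)))))"
    unfolding N by (rule smooth_on_shift[OF m(2,1)])
  from smooth_on_diff[OF o this smooth_on_const[OF o]]
  show "smooth_on ?N (\<lambda>q. crd (\<kappa> (fst q) \<otimes> \<kappa> (snd q)))"
    by (simp add: crd_def \<kappa>_def)
qed

lemma smooth_inv_crd:
  "open {p \<in> dm. inv (\<kappa> p) \<in> U}" "smooth_on {p \<in> dm. inv (\<kappa> p) \<in> U} (\<lambda>p. crd (inv (\<kappa> p)))"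
proof -
  let ?M = "{u \<in> x ` U. inv (inv_into U x u) \<in> U}"
  have N: "{p \<in> dm. inv (\<kappa> p) \<in> U} = {p. p + x \<one> \<in> ?M}" by (auto simp: dm_def \<kappa>_def)
  have oM: "open ?M"
    using open_chart_preimage[OF cc chart open_continuous_vimage[OF smooth_map_continuous[OF inv_smooth] ch(1)]]
    by simp
  show o: "open {p \<in> dm. inv (\<kappa> p) \<in> U}"
    unfolding N using open_vimage[OF oM, of "\<lambda>u. u + x \<one>"] by (simp add: vimage_def continuous_intros)
  have "smooth_on {p \<in> dm. inv (\<kappa> p) \<in> U} (\<lambda>p. x (inv (inv_into U x (p + x \<one>))))"
    unfolding N by (rule smooth_on_shift[OF smooth_mapD[OF cc inv_smooth chart chart] oM])
  from smooth_on_diff[OF o this smooth_on_const[OF o]]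
  show "smooth_on {p \<in> dm. inv (\<kappa> p) \<in> U} (\<lambda>p. crd (inv (\<kappa> p)))"
    by (simp add: crd_def \<kappa>_def)
qed

lemma smooth_translate_\<kappa>:
  assumes V: "(V, y) \<in> atlas G"
  shows "open {u \<in> dm. a \<otimes> \<kappa> u \<in> V}" "smooth_on {u \<in> dm. a \<otimes> \<kappa> u \<in> V} (\<lambda>u. y (a \<otimes> \<kappa> u))"
proof -
  let ?M = "{u \<in> x ` U. a \<otimes> inv_into U x u \<in> V}"
  have N: "{u \<in> dm. a \<otimes> \<kappa> u \<in> V} = {p. p + x \<one> \<in> ?M}" by (auto simp: dm_def \<kappa>_def)
  have oM: "open ?M"
    using open_chart_preimage[OF cc chart open_continuous_vimage[OF
          smooth_map_continuous[OF left_translation_smooth] chartD(1)[OF cc V]]]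
    by simp
  show "open {u \<in> dm. a \<otimes> \<kappa> u \<in> V}"
    unfolding N using open_vimage[OF oM, of "\<lambda>u. u + x \<one>"] by (simp add: vimage_def continuous_intros)
  show "smooth_on {u \<in> dm. a \<otimes> \<kappa> u \<in> V} (\<lambda>u. y (a \<otimes> \<kappa> u))"
    using smooth_on_shift[OF smooth_mapD[OF cc left_translation_smooth chart V] oM, of "x \<one>"]
    unfolding N by (simp add: \<kappa>_def)
qed

lemma smooth_crd_translate:
  assumes V: "(V, y) \<in> atlas G"
  shows "open {v \<in> y ` V. a \<otimes> inv_into V y v \<in> U}"
    "smooth_on {v \<in> y ` V. a \<otimes> inv_into V y v \<in> U} (\<lambda>v. crd (a \<otimes> inv_into V y v))"
proof -
  show o: "open {v \<in> y ` V. a \<otimes> inv_into V y v \<in> U}"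
    using open_chart_preimage[OF cc V open_continuous_vimage[OF
          smooth_map_continuous[OF left_translation_smooth] ch(1)]]
    by simp
  show "smooth_on {v \<in> y ` V. a \<otimes> inv_into V y v \<in> U} (\<lambda>v. crd (a \<otimes> inv_into V y v))"
    unfolding crd_def
    by (intro smooth_on_diff[OF o _ smooth_on_const[OF o]] smooth_mapD[OF cc left_translation_smooth V chart])
qed

lemma SF_smooth_\<kappa>:
  assumes "f \<in> SF"
  shows "smooth_on dm (\<lambda>u. f (\<kappa> u))"
proof -
  have "smooth_on (x ` U) (\<lambda>u. f (inv_into U x u))"
    using assms chart by (auto simp: smooth_functions_iff)
  from smooth_on_shift[OF this ch(2), of "x \<one>"] show ?thesis by (simp add: dm_def \<kappa>_def)
qed

text \<open>Joint smoothness in the base point, read in an arbitrary chart, and in the right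
  increment near the unit: this makes the left-invariant fields \<open>tau v\<close> smooth.\<close>

lemma SF_smooth_mult:
  assumes "f \<in> SF" and W: "(W, z) \<in> atlas G"
  shows "smooth_on ((z ` W) \<times> dm) (\<lambda>q. f (inv_into W z (fst q) \<otimes> \<kappa> (snd q)))"
proof -
  let ?h = "\<lambda>q. f (inv_into W z (fst q) \<otimes> inv_into U x (snd q))"
  have "smooth_on ((z ` W) \<times> (x ` U)) ?h"
  proof (rule smooth_on_local)
    fix q assume q: "q \<in> (z ` W) \<times> (x ` U)"
    obtain V y where V: "(V, y) \<in> atlas G" "inv_into W z (fst q) \<otimes> inv_into U x (snd q) \<in> V"
      by (rule chart_coverE[OF cc])
    note m = mult_smooth_charts[OF W V(1) chart]
    let ?N = "{q. fst q \<in> z ` W \<and> snd q \<in> x ` U \<and> inv_into W z (fst q) \<otimes> inv_into U x (snd q) \<in> V}"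
    have "smooth_on (y ` V) (\<lambda>v. f (inv_into V y v))"
      using assms(1) V(1) by (auto simp: smooth_functions_iff)
    from smooth_on_compose[OF m(1) chartD(2)[OF cc V(1)] _ m(2) this]
    have "smooth_on ?N (\<lambda>q. f (inv_into V y (y (inv_into W z (fst q) \<otimes> inv_into U x (snd q)))))"
      by auto
    then have "smooth_on ?N ?h"
      by (rule smooth_on_cong[OF m(1), rotated]) (auto simp: chartD(5)[OF cc V(1)])
    moreover have "q \<in> ?N" using q V(2) by auto
    ultimately show "\<exists>T. open T \<and> q \<in> T \<and> smooth_on T ?h" using m(1) by blast
  qed
  note h = this
  have "{q. q + (0, x \<one>) \<in> (z ` W) \<times> (x ` U)} = (z ` W) \<times> dm" by (auto simp: dm_def)
  then show ?thesis
    using smooth_on_shift[OF h open_Times[OF chartD(2)[OF cc W] ch(2)], of "(0, x \<one>)"]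
    by (simp add: \<kappa>_def)
qed

end

section \<open>Vector fields as derivations\<close>

lemma vector_field_SF: "X \<in> vector_fields A \<Longrightarrow> f \<in> smooth_functions A \<Longrightarrow> X f \<in> smooth_functions A"
  by (simp add: vector_fields_def)

lemma vector_field_not_SF: "X \<in> vector_fields A \<Longrightarrow> f \<notin> smooth_functions A \<Longrightarrow> X f = 0"
  by (simp add: vector_fields_def)

lemma vector_field_add:
  assumes "X \<in> vector_fields A" "f \<in> smooth_functions A" "h \<in> smooth_functions A"
  shows "X (\<lambda>p. f p + h p) = (\<lambda>p. X f p + X h p)"
proof -
  have "X (f + h) = X f + X h" using assms by (simp add: vector_fields_def)
  then show ?thesis by (simp add: plus_fun_def)
qed

lemma vector_field_mult:
  assumes "X \<in> vector_fields A" "f \<in> smooth_functions A" "h \<in> smooth_functions A"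
  shows "X (\<lambda>p. f p * h p) = (\<lambda>p. X f p * h p + f p * X h p)"
proof -
  have "X (f * h) = X f * h + f * X h" using assms by (simp add: vector_fields_def)
  then show ?thesis by (simp add: plus_fun_def times_fun_def)
qed

lemma vector_field_cmult:
  "X \<in> vector_fields A \<Longrightarrow> f \<in> smooth_functions A \<Longrightarrow> X (\<lambda>p. c * f p) = (\<lambda>p. c * X f p)"
  by (simp add: vector_fields_def)

lemma vector_field_const:
  assumes "chart_cover A" "X \<in> vector_fields A"
  shows "X (\<lambda>p. c) = (\<lambda>p. 0)"
proof -
  note one = smooth_functions_const[OF assms(1), of 1]
  have "X (\<lambda>p. 1) p = 0" for p
    using fun_cong[OF vector_field_mult[OF assms(2) one one], of p] by simp
  then show ?thesis using vector_field_cmult[OF assms(2) one, of c] by simp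
qed

lemma vector_field_diff:
  assumes "chart_cover A" "X \<in> vector_fields A" "f \<in> smooth_functions A" "h \<in> smooth_functions A"
  shows "(\<lambda>p. f p - h p) \<in> smooth_functions A" "X (\<lambda>p. f p - h p) = (\<lambda>p. X f p - X h p)"
proof -
  have m: "(\<lambda>p. (-1) * h p) \<in> smooth_functions A"
    by (rule smooth_functions_mult[OF assms(1) smooth_functions_const[OF assms(1)] assms(4)])
  show "(\<lambda>p. f p - h p) \<in> smooth_functions A"
    using smooth_functions_add[OF assms(1,3) m] by simp
  show "X (\<lambda>p. f p - h p) = (\<lambda>p. X f p - X h p)"
    using vector_field_add[OF assms(2,3) m] vector_field_cmult[OF assms(2,4), of "-1"] by simp
qed

lemma vector_field_sum:
  assumes "chart_cover A" "X \<in> vector_fields A" "\<And>i. i \<in> I \<Longrightarrow> f i \<in> smooth_functions A"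
  shows "(\<lambda>p. \<Sum>i\<in>I. f i p) \<in> smooth_functions A \<and> X (\<lambda>p. \<Sum>i\<in>I. f i p) = (\<lambda>p. \<Sum>i\<in>I. X (f i) p)"
  using assms(3)
proof (induction I rule: infinite_finite_induct)
  case (insert i I)
  then have IH: "(\<lambda>p. \<Sum>i\<in>I. f i p) \<in> smooth_functions A"
    "X (\<lambda>p. \<Sum>i\<in>I. f i p) = (\<lambda>p. \<Sum>i\<in>I. X (f i) p)" and fi: "f i \<in> smooth_functions A"
    by auto
  show ?case
    using insert(1,2) smooth_functions_add[OF assms(1) fi IH(1)] vector_field_add[OF assms(2) fi IH(1)]
    by (simp add: IH(2))
qed (use smooth_functions_const[OF assms(1)] vector_field_const[OF assms(1,2)] in auto)

lemma lie_bracket_vector_fields: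
  assumes "chart_cover A" "X \<in> vector_fields A" "Y \<in> vector_fields A"
  shows "lie_bracket X Y \<in> vector_fields A"
proof -
  note SF = vector_field_SF[OF assms(2)] vector_field_SF[OF assms(3)]
  note add = vector_field_add[OF assms(2)] vector_field_add[OF assms(3)]
  note mult = vector_field_mult[OF assms(2)] vector_field_mult[OF assms(3)]
  note cmult = vector_field_cmult[OF assms(2)] vector_field_cmult[OF assms(3)]
  note SFm = smooth_functions_mult[OF assms(1)]
  have zero: "X 0 = 0" "Y 0 = 0"
    using vector_field_const[OF assms(1,2), of 0] vector_field_const[OF assms(1,3), of 0]
    by (simp_all add: zero_fun_def)
  show ?thesis
    unfolding vector_fields_def mem_Collect_eq
  proof (intro conjI ballI allI impI)
    fix f assume f: "f \<in> smooth_functions A"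
    show "lie_bracket X Y f \<in> smooth_functions A"
      using vector_field_diff(1)[OF assms(1,2) SF(1)[OF SF(2)[OF f]] SF(2)[OF SF(1)[OF f]]]
      by (simp add: lie_bracket_def fun_diff_def)
    show "lie_bracket X Y (\<lambda>p. c * f p) = (\<lambda>p. c * lie_bracket X Y f p)" for c
      by (simp add: lie_bracket_def cmult f SF fun_diff_def algebra_simps)
    fix h assume h: "h \<in> smooth_functions A"
    show "lie_bracket X Y (f + h) = lie_bracket X Y f + lie_bracket X Y h"
      by (simp add: lie_bracket_def plus_fun_def add f h SF fun_diff_def algebra_simps)
    show "lie_bracket X Y (f * h) = lie_bracket X Y f * h + f * lie_bracket X Y h"
      by (simp add: lie_bracket_def plus_fun_def times_fun_def add mult f h SF SFm fun_diff_def algebra_simps)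
  next
    fix f assume f: "f \<notin> smooth_functions A"
    show "lie_bracket X Y f = 0"
      using vector_field_not_SF[OF assms(2) f] vector_field_not_SF[OF assms(3) f] zero
      by (simp add: lie_bracket_def)
  qed
qed

section \<open>Left-invariant vector fields and tangent vectors at the unit\<close>

context lie_chart
begin

text \<open>The left-invariant field with value \<open>v\<close> at the unit: right multiplication
  by \<open>\<kappa> u\<close> commutes with all left translations. The value 0 outside
  \<open>SF\<close> follows the convention of \<open>vector_fields\<close>.\<close>

definition tau :: "'e \<Rightarrow> 'g vfield" where
  "tau v f = (\<lambda>p. if f \<in> SF then frechet_derivative (\<lambda>u. f (p \<otimes> \<kappa> u)) (at 0) v else 0)"

lemma SF_has_derivative:
  assumes "f \<in> SF"
  shows "((\<lambda>u. f (p \<otimes> \<kappa> u)) has_derivative (\<lambda>v. tau v f p)) (at 0)"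
  using smooth_on_has_derivative[OF SF_smooth_\<kappa>[OF SF_translate[OF assms]] zero_dm] assms
  by (simp add: tau_def)

lemma tau_eq:
  assumes "f \<in> SF" "((\<lambda>u. f (p \<otimes> \<kappa> u)) has_derivative D) (at 0)"
  shows "tau v f p = D v"
  using has_derivative_unique[OF SF_has_derivative[OF assms(1)] assms(2)] by (rule fun_cong)

lemma tau_not_SF: "f \<notin> SF \<Longrightarrow> tau v f = 0"
  by (auto simp: tau_def)

text \<open>In a chart this is the derivative along (0, v) of the jointly smooth function of
  \<open>SF_smooth_mult\<close>, restricted to increment 0.\<close>

lemma tau_SF:
  assumes f: "f \<in> SF"
  shows "tau v f \<in> SF"
proof (rule smooth_functionsI[OF cc])
  fix W z assume W: "(W, z) \<in> atlas G"
  let ?h = "\<lambda>q. f (inv_into W z (fst q) \<otimes> \<kappa> (snd q))"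
  note sm = SF_smooth_mult[OF f W] and oW = chartD(2)[OF cc W]
  have "smooth_on (z ` W) (\<lambda>s. (\<lambda>q. frechet_derivative ?h (at q) (0, v)) (s, 0))"
    by (rule smooth_on_compose[OF oW open_Times[OF oW open_dm] _ _ smooth_on_frechet_derivative[OF sm]])
      (auto intro!: smooth_intros oW zero_dm)
  moreover have "frechet_derivative ?h (at (s, 0)) (0, v) = tau v f (inv_into W z s)" if "s \<in> z ` W" for s
  proof -
    have "(?h has_derivative frechet_derivative ?h (at (s, 0))) (at (s, 0))"
      by (rule smooth_on_has_derivative[OF sm]) (use that zero_dm in simp)
    then have "((\<lambda>u. ?h (s, u)) has_derivative (\<lambda>v. frechet_derivative ?h (at (s, 0)) (0, v))) (at 0)"
      by (intro has_derivative_compose[of "\<lambda>u. (s, u)" "\<lambda>v. (0, v)" 0 UNIV ?h])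
        (auto intro!: derivative_eq_intros)
    from tau_eq[OF f, of "inv_into W z s", OF this[simplified]] show ?thesis by simp
  qed
  ultimately show "smooth_on (z ` W) (\<lambda>s. tau v f (inv_into W z s))"
    by (rule smooth_on_cong[OF oW, rotated]) auto
qed

lemma tau_vector_field: "tau v \<in> vector_fields (atlas G)"
  unfolding vector_fields_def mem_Collect_eq
proof (intro conjI ballI allI impI)
  fix f assume f: "f \<in> SF"
  note df = SF_has_derivative[OF f]
  show "tau v f \<in> SF" by (rule tau_SF[OF f])
  show "tau v (\<lambda>p. c * f p) = (\<lambda>p. c * tau v f p)" for c
    by (intro ext tau_eq smooth_functions_mult[OF cc] smooth_functions_const[OF cc] f
        has_derivative_mult_right df)
  fix h assume h: "h \<in> SF"
  note dh = SF_has_derivative[OF h]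
  show "tau v (f + h) = tau v f + tau v h"
    unfolding plus_fun_def
    by (intro ext tau_eq smooth_functions_add[OF cc] f h has_derivative_add df dh)
  show "tau v (f * h) = tau v f * h + f * tau v h"
  proof
    fix p
    have "tau v (\<lambda>p. f p * h p) p = f (p \<otimes> \<kappa> 0) * tau v h p + tau v f p * h (p \<otimes> \<kappa> 0)"
      by (intro tau_eq smooth_functions_mult[OF cc] f h has_derivative_mult df dh)
    then show "tau v (f * h) p = (tau v f * h + f * tau v h) p"
      by (simp add: times_fun_def plus_fun_def)
  qed
qed (rule tau_not_SF)

lemma tau_left_invariant: "left_push G a (tau v) = tau v"
proof (intro ext)
  fix f p
  show "left_push G a (tau v) f p = tau v f p"
  proof (cases "f \<in> SF")
    case True
    have "((\<lambda>u. f (a \<otimes> ((inv a \<otimes> p) \<otimes> \<kappa> u))) has_derivative (\<lambda>v. tau v f p)) (at 0)"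
      using SF_has_derivative[OF True, of p] by (simp add: m_assoc)
    from tau_eq[OF SF_translate[OF True] this] show ?thesis by (simp add: left_push_def)
  next
    case False
    then have "(\<lambda>x. f (a \<otimes> x)) \<notin> SF" by (simp add: SF_translate_iff)
    then show ?thesis using False by (simp add: left_push_def tau_not_SF)
  qed
qed

lemma tau_lie_algebra: "tau v \<in> lie_algebra G"
  by (simp add: lie_algebra_def tau_vector_field tau_left_invariant)

lemma tau_add: "tau (v + w) = tau v + tau w" and tau_scaleR: "tau (c *\<^sub>R v) = vf_scale c (tau v)"
proof -
  have lin: "linear (\<lambda>v. tau v f p)" for f p
  proof (cases "f \<in> SF")
    case True
    then show ?thesis using SF_has_derivative has_derivative_linear by blast
  qed (simp add: tau_def linear_zero)
  show "tau (v + w) = tau v + tau w"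
    using linear_add[OF lin] by (simp add: fun_eq_iff)
  show "tau (c *\<^sub>R v) = vf_scale c (tau v)"
    using linear_cmul[OF lin] by (simp add: fun_eq_iff vf_scale_def fun_scale_def)
qed

text \<open>The function is supported in the image \<open>K\<close> of a closed ball.
  \<open>K\<close> is compact, hence closed since the group is Hausdorff. So the preimage of the
  coordinate ball and the complement of \<open>K\<close> are open and cover the group, and the
  function is smooth on each.\<close>

lemma cutoff_smooth:
  assumes R: "ball 0 R \<subseteq> dm" and s: "s < R" and \<rho>: "smooth_on UNIV \<rho>" "\<And>p. norm p \<ge> s \<Longrightarrow> \<rho> p = 0"
    and h: "smooth_on (ball 0 R) h"
  shows "(\<lambda>a. if a \<in> U \<and> crd a \<in> ball 0 R then \<rho> (crd a) * h (crd a) else 0 :: real) \<in> SF"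
proof (rule smooth_functionsI[OF cc])
  fix V y assume V: "(V, y) \<in> atlas G"
  let ?f = "\<lambda>a. if a \<in> U \<and> crd a \<in> ball 0 R then \<rho> (crd a) * h (crd a) else 0"
  define K where "K = \<kappa> ` cball 0 s"
  have cR: "cball 0 s \<subseteq> ball 0 R" using s by auto
  have "compact K" unfolding K_def
    by (rule compact_continuous_image[OF continuous_on_subset[OF continuous_on_\<kappa>]]) (use cR R in auto)
  then have cK: "closed K" by (rule compact_imp_closed)
  show "smooth_on (y ` V) (\<lambda>v. ?f (inv_into V y v))"
  proof (rule smooth_on_local)
    fix v assume v: "v \<in> y ` V"
    show "\<exists>T. open T \<and> v \<in> T \<and> smooth_on T (\<lambda>v. ?f (inv_into V y v))"
    proof (cases "inv_into V y v \<in> U \<and> crd (inv_into V y v) \<in> ball 0 R")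
      case True
      define T where "T = {v \<in> y ` V. inv_into V y v \<in> U \<inter> crd -` ball 0 R}"
      have "open (U \<inter> crd -` ball 0 R)"
        by (rule continuous_open_preimage[OF continuous_on_crd ch(1) open_ball])
      then have oT: "open T" unfolding T_def by (rule open_chart_preimage[OF cc V])
      have sc: "smooth_on T (\<lambda>v. crd (inv_into V y v))"
        by (rule smooth_on_subset[OF smooth_crd_translate(2)[OF V, of \<one>, simplified]])
          (auto simp: T_def)
      have "smooth_on T (\<lambda>v. \<rho> (crd (inv_into V y v)) * h (crd (inv_into V y v)))"
        by (intro smooth_on_mult oT smooth_on_compose[OF oT open_UNIV _ sc \<rho>(1)]
            smooth_on_compose[OF oT open_ball _ sc h]) (auto simp: T_def)
      then have "smooth_on T (\<lambda>v. ?f (inv_into V y v))"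
        by (rule smooth_on_cong[OF oT, rotated]) (auto simp: T_def)
      moreover have "v \<in> T" using True v by (simp add: T_def)
      ultimately show ?thesis using oT by blast
    next
      case False
      define T where "T = {v \<in> y ` V. inv_into V y v \<in> - K}"
      have oT: "open T" unfolding T_def by (rule open_chart_preimage[OF cc V]) (use cK in auto)
      have z: "?f a = 0" if "a \<notin> K" for a
      proof (cases "a \<in> U \<and> crd a \<in> ball 0 R")
        case True
        then have "crd a \<notin> cball 0 s" using that \<kappa>_crd[of a] unfolding K_def by (metis imageI)
        then show ?thesis using \<rho>(2)[of "crd a"] by simp
      qed auto
      have "smooth_on T (\<lambda>v. ?f (inv_into V y v))"
        by (rule smooth_on_cong[OF oT _ smooth_on_const[OF oT, of 0]], rule z[symmetric]) (simp add: T_def)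
      moreover have "inv_into V y v \<notin> K"
      proof
        assume "inv_into V y v \<in> K"
        then obtain u where "u \<in> cball 0 s" "inv_into V y v = \<kappa> u" by (auto simp: K_def)
        moreover from this have "u \<in> ball 0 R" "u \<in> dm" using cR R by blast+
        ultimately show False using False crd_\<kappa>[of u] \<kappa>_U[of u] by simp
      qed
      then have "v \<in> T" using v by (simp add: T_def)
      ultimately show ?thesis using oT by blast
    qed
  qed
qed

text \<open>One cutoff serves all local functions: \<open>C h\<close> is \<open>h\<close> in
  coordinates times the bump function \<open>C (\<lambda>u. 1)\<close>, which is 1 near the unit.
  \<open>derivation_at_one\<close> relies on this factorised form.\<close>

lemma cutoff:
  obtains R r C where "0 < r" "r < R" "ball 0 R \<subseteq> dm"
    "\<And>h. smooth_on (ball 0 R) h \<Longrightarrow> C h \<in> SF"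
    "\<And>h a. C h a = (C (\<lambda>u. 1) a * (if a \<in> U \<and> crd a \<in> ball 0 R then h (crd a) else 0) :: real)"
    "\<And>h u. norm u < r \<Longrightarrow> C h (\<kappa> u) = h u"
    "\<And>a. \<not> (a \<in> U \<and> crd a \<in> ball 0 R) \<Longrightarrow> C (\<lambda>u. 1) a = 0"
proof -
  obtain R where R: "R > 0" "ball 0 R \<subseteq> dm" using open_dm zero_dm open_contains_ball by blast
  obtain \<rho> :: "'e \<Rightarrow> real" where \<rho>: "smooth_on UNIV \<rho>" "\<And>p. norm p \<le> R / 3 \<Longrightarrow> \<rho> p = 1"
    "\<And>p. norm p \<ge> R / 2 \<Longrightarrow> \<rho> p = 0" by (rule bump_function[of "R / 3" "R / 2"]) (use R in auto)
  define C where "C h a = (if a \<in> U \<and> crd a \<in> ball 0 R then \<rho> (crd a) * h (crd a) else 0)"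
    for h :: "'e \<Rightarrow> real" and a
  show thesis
  proof (rule that[of "R / 3" R C])
    show "C h \<in> SF" if "smooth_on (ball 0 R) h" for h
      unfolding C_def[abs_def] by (rule cutoff_smooth[where s = "R / 2", OF R(2) _ \<rho>(1) _ that]) (use R \<rho>(3) in auto)
    show "C h (\<kappa> u) = h u" if "norm u < R / 3" for h u
    proof -
      have "u \<in> ball 0 R" using that R(1) norm_ge_zero[of u] by (simp, linarith)
      moreover from this have "u \<in> dm" using R(2) by blast
      ultimately show ?thesis using that R \<kappa>_U[of u] crd_\<kappa>[of u] \<rho>(2)[of u] by (auto simp: C_def)
    qed
  qed (use R in \<open>auto simp: C_def\<close>)
qed

lemma coordinate_functions:
  obtains r where "0 < r" "ball 0 r \<subseteq> dm"
    "\<And>b. \<exists>f\<in>SF. \<forall>u\<in>ball 0 r. f (\<kappa> u) = u \<bullet> b"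
proof -
  obtain R r C where C: "0 < r" "r < R" "ball 0 R \<subseteq> dm"
    "\<And>h. smooth_on (ball 0 R) h \<Longrightarrow> C h \<in> SF" "\<And>h u. norm u < r \<Longrightarrow> C h (\<kappa> u) = (h u :: real)"
    by (rule cutoff) blast
  show thesis
  proof (rule that[of r])
    show "\<exists>f\<in>SF. \<forall>u\<in>ball 0 r. f (\<kappa> u) = u \<bullet> b" for b
      by (rule bexI[of _ "C (\<lambda>u. u \<bullet> b)"]) (auto intro!: C smooth_intros)
  qed (use C in auto)
qed

text \<open>By Hadamard's lemma, \<open>f - f \<one>\<close> is a sum of products near \<open>\<one>\<close>. Multiplying it by the square of a
  cutoff function makes both factors of every product globally smooth.\<close>

lemma derivation_at_one:
  assumes X: "X \<in> vector_fields (atlas G)"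
  obtains v where "\<And>f. f \<in> SF \<Longrightarrow> X f \<one> = tau v f \<one>"
proof -
  obtain R r C where C: "0 < r" "r < R" "ball 0 R \<subseteq> dm"
    "\<And>h. smooth_on (ball 0 R) h \<Longrightarrow> C h \<in> SF"
    "\<And>h a. C h a = (C (\<lambda>u. 1) a * (if a \<in> U \<and> crd a \<in> ball 0 R then h (crd a) else 0) :: real)"
    "\<And>h u. norm u < r \<Longrightarrow> C h (\<kappa> u) = h u"
    "\<And>a. \<not> (a \<in> U \<and> crd a \<in> ball 0 R) \<Longrightarrow> C (\<lambda>u. 1) a = 0"
    by (rule cutoff) blast
  have C0: "C h \<one> = h 0" for h using C(6)[of 0 h] C(1) by simp
  have SFc: "C (\<lambda>u. u \<bullet> b) \<in> SF" for b by (intro C(4) smooth_intros) auto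
  define \<rho> where "\<rho> = C (\<lambda>u. 1)"
  have SF\<rho>: "\<rho> \<in> SF" unfolding \<rho>_def by (intro C(4) smooth_intros) auto
  define v where "v = (\<Sum>b\<in>Basis. X (C (\<lambda>u. u \<bullet> b)) \<one> *\<^sub>R b)"
  show thesis
  proof (rule that[of v])
    fix f assume f: "f \<in> SF"
    have "smooth_on (ball 0 R) (\<lambda>u. f (\<kappa> u))" by (rule smooth_on_subset[OF SF_smooth_\<kappa>[OF f] C(3)])
    moreover have "R > 0" using C(1,2) by simp
    ultimately obtain h where h: "\<And>b. smooth_on (ball 0 R) (h b)"
      "\<And>p. p \<in> ball 0 R \<Longrightarrow> f (\<kappa> p) = f (\<kappa> 0) + (\<Sum>b\<in>Basis. (p \<bullet> b) * h b p)"
      "((\<lambda>u. f (\<kappa> u)) has_derivative (\<lambda>v. \<Sum>b\<in>Basis. (v \<bullet> b) * h b 0)) (at 0)"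
      by (rule hadamard) blast
    have SFh: "C (h b) \<in> SF" for b by (rule C(4)[OF h(1)])
    note c = smooth_functions_const[OF cc] and m = smooth_functions_mult[OF cc]
    note d = vector_field_diff[OF cc X f c[of "f \<one>"]]
    have "(\<lambda>a. (\<rho> a * \<rho> a) * (f a - f \<one>)) = (\<lambda>a. \<Sum>b\<in>Basis. C (\<lambda>u. u \<bullet> b) a * C (h b) a)"
    proof
      fix a
      show "(\<rho> a * \<rho> a) * (f a - f \<one>) = (\<Sum>b\<in>Basis. C (\<lambda>u. u \<bullet> b) a * C (h b) a)"
      proof (cases "a \<in> U \<and> crd a \<in> ball 0 R")
        case True
        then have "f a - f \<one> = (\<Sum>b\<in>Basis. (crd a \<bullet> b) * h b (crd a))"
          using h(2)[of "crd a"] by (simp add: \<kappa>_crd)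
        moreover have "C h a = \<rho> a * h (crd a)" for h using C(5)[of h a] True by (simp add: \<rho>_def)
        ultimately show ?thesis by (simp add: sum_distrib_left ac_simps)
      next
        case False
        then have "C h a = 0" for h using C(5)[of h a] C(7)[of a] by simp
        then show ?thesis by (simp add: \<rho>_def)
      qed
    qed
    then have "X (\<lambda>a. (\<rho> a * \<rho> a) * (f a - f \<one>)) \<one> = X (\<lambda>a. \<Sum>b\<in>Basis. C (\<lambda>u. u \<bullet> b) a * C (h b) a) \<one>"
      by simp
    \<comment> \<open>At the unit \<rho> is 1 and \<open>f a - f \<one>\<close> is 0, so the Leibniz
      rule does not see the cutoff.\<close>
    also have "X (\<lambda>a. (\<rho> a * \<rho> a) * (f a - f \<one>)) \<one> = X f \<one>"
      using vector_field_mult[OF X m[OF SF\<rho> SF\<rho>] d(1)]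
      by (simp add: d(2) vector_field_const[OF cc X] C0 \<rho>_def)
    also have "X (\<lambda>a. \<Sum>b\<in>Basis. C (\<lambda>u. u \<bullet> b) a * C (h b) a) \<one>
        = (\<Sum>b\<in>Basis. X (\<lambda>a. C (\<lambda>u. u \<bullet> b) a * C (h b) a) \<one>)"
      using vector_field_sum[OF cc X, of Basis "\<lambda>b a. C (\<lambda>u. u \<bullet> b) a * C (h b) a"] m[OF SFc SFh]
      by simp
    also have "\<dots> = (\<Sum>b\<in>Basis. X (C (\<lambda>u. u \<bullet> b)) \<one> * h b 0)"
      by (rule sum.cong[OF refl]) (simp add: vector_field_mult[OF X SFc SFh] C0)
    also have "\<dots> = (\<Sum>b\<in>Basis. (v \<bullet> b) * h b 0)"
      by (rule sum.cong[OF refl]) (simp add: v_def inner_sum_left inner_Basis sum.delta if_distrib cong: if_cong)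
    also have "\<dots> = tau v f \<one>"
      using tau_eq[OF f, of \<one>] h(3) by simp
    finally show "X f \<one> = tau v f \<one>" .
  qed
qed

text \<open>An invariant field is determined by its action at the unit, and there every derivation
  is a tangent vector by \<open>derivation_at_one\<close>.\<close>

lemma lie_algebra_eq: "lie_algebra G = range tau"
proof
  show "range tau \<subseteq> lie_algebra G" using tau_lie_algebra by auto
  show "lie_algebra G \<subseteq> range tau"
  proof
    fix X assume X: "X \<in> lie_algebra G"
    then have XV: "X \<in> vector_fields (atlas G)" by (simp add: lie_algebra_def)
    from derivation_at_one[OF XV] obtain v where v: "\<And>f. f \<in> SF \<Longrightarrow> X f \<one> = tau v f \<one>" by blast
    have inv: "Y f p = Y (\<lambda>x. f (p \<otimes> x)) \<one>" if "Y \<in> lie_algebra G" for Y f p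
    proof -
      have "left_push G p Y = Y" using that by (simp add: lie_algebra_def)
      then have "Y f p = left_push G p Y f p" by simp
      then show ?thesis by (simp add: left_push_def)
    qed
    have "X f p = tau v f p" for f p
    proof (cases "f \<in> SF")
      case True
      then show ?thesis
        using inv[OF X, of f p] inv[OF tau_lie_algebra, of v f p] v[OF SF_translate[OF True]] by simp
    next
      case False
      then show ?thesis using vector_field_not_SF[OF XV False] tau_not_SF[OF False] by simp
    qed
    then have "X = tau v" by blast
    then show "X \<in> range tau" by simp
  qed
qed

lemma tau_at_one:
  assumes "f \<in> SF" "((\<lambda>u. f (\<kappa> u)) has_derivative D) (at 0)"
  shows "tau v f \<one> = D v"
  by (rule tau_eq) (use assms in auto)

lemma inj_tau: "inj tau"
proof (rule injI)
  fix v w assume eq: "tau v = tau w"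
  obtain r where r: "0 < r" "ball 0 r \<subseteq> dm" "\<And>b. \<exists>f\<in>SF. \<forall>u\<in>ball 0 r. f (\<kappa> u) = u \<bullet> b"
    by (rule coordinate_functions) blast
  have "v \<bullet> b = w \<bullet> b" for b
  proof -
    obtain f where f: "f \<in> SF" "\<forall>u\<in>ball 0 r. f (\<kappa> u) = u \<bullet> b" using r(3) by blast
    have "((\<lambda>u. u \<bullet> b) has_derivative (\<lambda>u. u \<bullet> b)) (at 0)" by (auto intro!: derivative_eq_intros)
    then have "((\<lambda>u. f (\<kappa> u)) has_derivative (\<lambda>u. u \<bullet> b)) (at 0)"
      by (rule has_derivative_transform_within_open[of _ _ _ _ "ball 0 r"]) (use f r in auto)
    from tau_at_one[OF f(1) this] eq show ?thesis by metis
  qed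
  then show "v = w" by (rule euclidean_eqI)
qed

lemma lie_algebra_translate:
  assumes "X \<in> lie_algebra G"
  shows "X (\<lambda>b. f (a \<otimes> b)) = (\<lambda>p. X f (a \<otimes> p))"
proof
  fix p
  have "left_push G a X = X" using assms by (simp add: lie_algebra_def)
  then have "X f (a \<otimes> p) = left_push G a X f (a \<otimes> p)" by simp
  then show "X (\<lambda>b. f (a \<otimes> b)) p = X f (a \<otimes> p)" by (simp add: left_push_def)
qed

lemma lie_bracket_lie_algebra:
  assumes "X \<in> lie_algebra G" "Y \<in> lie_algebra G"
  shows "lie_bracket X Y \<in> lie_algebra G"
proof -
  have "lie_bracket X Y \<in> vector_fields (atlas G)"
    using assms by (intro lie_bracket_vector_fields[OF cc]) (auto simp: lie_algebra_def)
  moreover have "left_push G a (lie_bracket X Y) = lie_bracket X Y" for a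
    by (intro ext) (simp add: left_push_def lie_bracket_def lie_algebra_translate assms)
  ultimately show ?thesis by (simp add: lie_algebra_def)
qed

definition lbr :: "'e \<Rightarrow> 'e \<Rightarrow> 'e" where
  "lbr v w = inv_into UNIV tau (lie_bracket (tau v) (tau w))"

lemma tau_lbr: "tau (lbr v w) = lie_bracket (tau v) (tau w)"
proof -
  have "lie_bracket (tau v) (tau w) \<in> range tau"
    using lie_bracket_lie_algebra[OF tau_lie_algebra tau_lie_algebra] lie_algebra_eq by blast
  then show ?thesis unfolding lbr_def by (rule f_inv_into_f)
qed

end

context lie_chart
begin

section \<open>The Maurer-Cartan form in coordinates\<close>

definition mu :: "'e \<Rightarrow> 'e \<Rightarrow> 'e" where "mu p q = crd (\<kappa> p \<otimes> \<kappa> q)"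

definition ldiff :: "'e \<Rightarrow> 'e \<Rightarrow> 'e" where "ldiff p q = crd (inv (\<kappa> p) \<otimes> \<kappa> q)"

text \<open>\<open>A p\<close> is the differential at the unit of the left translation by \<open>\<kappa> p\<close>, and its inverse \<open>B p\<close> is
  the value of the Maurer-Cartan form at \<open>\<kappa> p\<close>.\<close>

definition A :: "'e \<Rightarrow> 'e \<Rightarrow> 'e" where "A p v = frechet_derivative (mu p) (at 0) v"

definition B :: "'e \<Rightarrow> 'e \<Rightarrow> 'e" where "B p v = frechet_derivative (ldiff p) (at p) v"

definition "dmul = {q. fst q \<in> dm \<and> snd q \<in> dm \<and> \<kappa> (fst q) \<otimes> \<kappa> (snd q) \<in> U}"

definition "dinv = {p \<in> dm. inv (\<kappa> p) \<in> U}"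

lemma open_dmul: "open dmul" and smooth_mu: "smooth_on dmul (\<lambda>q. mu (fst q) (snd q))"
  using smooth_mult_crd by (simp_all add: dmul_def mu_def)

lemma open_dinv: "open dinv" using smooth_inv_crd(1) by (simp add: dinv_def)

lemma zero_dinv: "0 \<in> dinv" using one_U zero_dm by (simp add: dinv_def)

lemma mu_0_right: "p \<in> dm \<Longrightarrow> mu p 0 = p" by (simp add: mu_def crd_\<kappa>)

lemma mu_0_left: "p \<in> dm \<Longrightarrow> mu 0 p = p" by (simp add: mu_def crd_\<kappa>)

lemma \<kappa>_mu: "(p, q) \<in> dmul \<Longrightarrow> \<kappa> (mu p q) = \<kappa> p \<otimes> \<kappa> q"
  by (simp add: mu_def dmul_def \<kappa>_crd)

lemma mu_dm: "(p, q) \<in> dmul \<Longrightarrow> mu p q \<in> dm"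
  by (simp add: mu_def dmul_def crd_dm)

lemma translate_crd_has_derivative:
  assumes "q \<in> dm" "a \<otimes> \<kappa> q \<in> U"
  shows "((\<lambda>u. crd (a \<otimes> \<kappa> u)) has_derivative frechet_derivative (\<lambda>u. crd (a \<otimes> \<kappa> u)) (at q)) (at q)"
proof -
  note s = smooth_translate_\<kappa>[OF chart, of a]
  have "smooth_on {u \<in> dm. a \<otimes> \<kappa> u \<in> U} (\<lambda>u. crd (a \<otimes> \<kappa> u))"
    unfolding crd_def by (rule smooth_on_diff[OF s smooth_on_const[OF s(1)]])
  then show ?thesis by (rule smooth_on_has_derivative) (use assms in simp)
qed

lemma mu_has_derivative:
  assumes "(p, q) \<in> dmul"
  shows "(mu p has_derivative frechet_derivative (mu p) (at q)) (at q)"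
  using translate_crd_has_derivative[of q "\<kappa> p"] assms
  unfolding mu_def[abs_def] by (simp add: dmul_def)

lemma dmul_0: "p \<in> dm \<Longrightarrow> (p, 0) \<in> dmul" by (simp add: dmul_def zero_dm \<kappa>_U)

lemma A_has_derivative: "p \<in> dm \<Longrightarrow> (mu p has_derivative A p) (at 0)"
  using mu_has_derivative[OF dmul_0] by (simp add: A_def[abs_def])

lemma B_has_derivative: "p \<in> dm \<Longrightarrow> (ldiff p has_derivative B p) (at p)"
  using translate_crd_has_derivative[of p "inv (\<kappa> p)"] one_U
  unfolding ldiff_def[abs_def] B_def[abs_def] by simp

lemma linear_A: "p \<in> dm \<Longrightarrow> linear (A p)" and linear_B: "p \<in> dm \<Longrightarrow> linear (B p)"
  using A_has_derivative B_has_derivative has_derivative_linear by blast+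

lemma open_slice: "open {u \<in> dm. a \<otimes> \<kappa> u \<in> U}" by (rule smooth_translate_\<kappa>[OF chart])

text \<open>A partial derivative whose base point moves as well. For \<open>A\<close> the second
  argument stays 0; for \<open>B\<close> the first argument is the coordinate of the inverse of the
  second.\<close>

lemma smooth_mu_snd_derivative:
  assumes "open S" "smooth_on S f" "smooth_on S g" "\<And>p. p \<in> S \<Longrightarrow> (f p, g p) \<in> dmul"
  shows "smooth_on S (\<lambda>p. frechet_derivative (mu (f p)) (at (g p)) v)"
proof -
  let ?h = "\<lambda>q. mu (fst q) (snd q)"
  have "smooth_on S (\<lambda>p. (\<lambda>q. frechet_derivative ?h (at q) (0, v)) (f p, g p))"
    by (rule smooth_on_compose[OF assms(1) open_dmul _ _ smooth_on_frechet_derivative[OF smooth_mu]])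
      (use assms in \<open>auto intro: smooth_on_Pair\<close>)
  moreover have "frechet_derivative ?h (at (f p, g p)) (0, v) = frechet_derivative (mu (f p)) (at (g p)) v"
    if "p \<in> S" for p
  proof -
    have "(?h has_derivative frechet_derivative ?h (at (f p, g p))) (at (f p, g p))"
      by (rule smooth_on_has_derivative[OF smooth_mu assms(4)[OF that]])
    then have "((\<lambda>u. ?h (f p, u)) has_derivative (\<lambda>v. frechet_derivative ?h (at (f p, g p)) (0, v))) (at (g p))"
      by (intro has_derivative_compose[of "\<lambda>u. (f p, u)" "\<lambda>v. (0, v)" "g p" UNIV ?h])
        (auto intro!: derivative_eq_intros)
    then have "(mu (f p) has_derivative (\<lambda>v. frechet_derivative ?h (at (f p, g p)) (0, v))) (at (g p))"
      by simp
    from has_derivative_unique[OF this mu_has_derivative[OF assms(4)[OF that]]]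
    show ?thesis by (rule fun_cong)
  qed
  ultimately show ?thesis by (rule smooth_on_cong[OF assms(1), rotated]) auto
qed

lemma smooth_A: "smooth_on dm (\<lambda>p. A p v)"
  unfolding A_def
  by (rule smooth_mu_snd_derivative) (auto intro: open_dm smooth_on_id smooth_on_const dmul_0)

lemma smooth_B: "smooth_on dinv (\<lambda>p. B p v)"
proof -
  have sub: "dinv \<subseteq> dm" by (auto simp: dinv_def)
  have \<kappa>i: "\<kappa> (crd (inv (\<kappa> p))) = inv (\<kappa> p)" if "p \<in> dinv" for p
    using that by (simp add: dinv_def \<kappa>_crd)
  have "smooth_on dinv (\<lambda>p. frechet_derivative (mu (crd (inv (\<kappa> p)))) (at p) v)"
  proof (rule smooth_mu_snd_derivative[OF open_dinv _ smooth_on_id[OF open_dinv]])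
    show "smooth_on dinv (\<lambda>p. crd (inv (\<kappa> p)))" using smooth_inv_crd(2) by (simp add: dinv_def)
    show "(crd (inv (\<kappa> p)), p) \<in> dmul" if "p \<in> dinv" for p
      using that \<kappa>i[OF that] crd_dm one_U by (auto simp: dmul_def dinv_def)
  qed
  then show ?thesis
    by (rule smooth_on_cong[OF open_dinv, rotated]) (simp add: B_def mu_def[abs_def] ldiff_def[abs_def] \<kappa>i)
qed

lemma B_A: assumes p: "p \<in> dm" shows "B p (A p v) = v"
proof -
  have "((\<lambda>u. ldiff p (mu p u)) has_derivative (\<lambda>v. B p (A p v))) (at 0)"
    by (rule has_derivative_compose[OF A_has_derivative[OF p]]) (simp add: mu_0_right p B_has_derivative)
  then have "((\<lambda>u. u) has_derivative (\<lambda>v. B p (A p v))) (at 0)"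
    by (rule has_derivative_transform_within_open[OF _ open_slice[of "\<kappa> p"]])
      (auto simp: zero_dm p \<kappa>_U ldiff_def mu_def \<kappa>_crd crd_\<kappa>)
  from has_derivative_unique[OF this has_derivative_ident] show ?thesis by (rule fun_cong)
qed

lemma A_B: assumes p: "p \<in> dm" shows "A p (B p v) = v"
proof -
  have "((\<lambda>u. mu p (ldiff p u)) has_derivative (\<lambda>v. A p (B p v))) (at p)"
  proof (rule has_derivative_compose[OF B_has_derivative[OF p]])
    have "ldiff p p = 0" using crd_\<kappa>[OF zero_dm] p by (simp add: ldiff_def)
    then show "(mu p has_derivative A p) (at (ldiff p p))" using A_has_derivative[OF p] by simp
  qed
  then have "((\<lambda>u. u) has_derivative (\<lambda>v. A p (B p v))) (at p)"
    by (rule has_derivative_transform_within_open[OF _ open_slice[of "inv (\<kappa> p)"]])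
      (auto simp: p one_U ldiff_def mu_def \<kappa>_crd crd_\<kappa>)
  from has_derivative_unique[OF this has_derivative_ident] show ?thesis by (rule fun_cong)
qed

text \<open>Left translation cancels in \<open>ldiff\<close>, since (pq)^-1 (pu) = q^-1 u.
  Differentiating at u = q yields the left-invariance of the Maurer-Cartan form.\<close>

lemma B_left_invariant:
  assumes pq: "(p, q) \<in> dmul"
  shows "B (mu p q) (frechet_derivative (mu p) (at q) v) = B q v"
proof -
  have q: "q \<in> dm" using pq by (simp add: dmul_def)
  have "((\<lambda>u. ldiff (mu p q) (mu p u)) has_derivative (\<lambda>v. B (mu p q) (frechet_derivative (mu p) (at q) v))) (at q)"
    by (rule has_derivative_compose[OF mu_has_derivative[OF pq]]) (rule B_has_derivative[OF mu_dm[OF pq]])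
  then have "(ldiff q has_derivative (\<lambda>v. B (mu p q) (frechet_derivative (mu p) (at q) v))) (at q)"
  proof (rule has_derivative_transform_within_open[OF _ open_slice[of "\<kappa> p"]])
    show "q \<in> {u \<in> dm. \<kappa> p \<otimes> \<kappa> u \<in> U}" using pq by (simp add: dmul_def)
    show "ldiff (mu p q) (mu p u) = ldiff q u" if "u \<in> {u \<in> dm. \<kappa> p \<otimes> \<kappa> u \<in> U}" for u
    proof -
      have "(p, u) \<in> dmul" using that pq by (simp add: dmul_def)
      then show ?thesis by (simp add: ldiff_def \<kappa>_mu pq inv_mult_group m_assoc)
    qed
  qed
  from has_derivative_unique[OF this B_has_derivative[OF q]] show ?thesis by (rule fun_cong)
qed

lemma B_0: "B 0 v = v"
proof -
  have "(mu 0 has_derivative (\<lambda>v. v)) (at 0)"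
    by (rule has_derivative_transform_within_open[OF has_derivative_ident open_dm zero_dm])
      (simp add: mu_0_left)
  from has_derivative_unique[OF this A_has_derivative[OF zero_dm]] have "A 0 v = v"
    by (metis (no_types))
  then show ?thesis using B_A[OF zero_dm, of v] by simp
qed

text \<open>In coordinates \<open>tau v\<close> is the vector field with value \<open>A p v\<close>
  at \<open>p\<close>.\<close>

lemma tau_\<kappa>:
  assumes "f \<in> SF" and p: "p \<in> dm" and "((\<lambda>u. f (\<kappa> u)) has_derivative D) (at p)"
  shows "tau v f (\<kappa> p) = D (A p v)"
proof -
  have "((\<lambda>u. f (\<kappa> (mu p u))) has_derivative (\<lambda>v. D (A p v))) (at 0)"
    by (rule has_derivative_compose[OF A_has_derivative[OF p]]) (use assms in \<open>simp add: mu_0_right\<close>)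
  then have "((\<lambda>u. f (\<kappa> p \<otimes> \<kappa> u)) has_derivative (\<lambda>v. D (A p v))) (at 0)"
    by (rule has_derivative_transform_within_open[OF _ open_slice[of "\<kappa> p"]])
      (auto simp: p zero_dm \<kappa>_U mu_def \<kappa>_crd)
  then show ?thesis by (rule tau_eq[OF assms(1)])
qed

definition DA :: "'e \<Rightarrow> 'e \<Rightarrow> 'e \<Rightarrow> 'e" where "DA w p = frechet_derivative (\<lambda>p. A p w) (at p)"

definition DB :: "'e \<Rightarrow> 'e \<Rightarrow> 'e \<Rightarrow> 'e" where "DB w p = frechet_derivative (\<lambda>p. B p w) (at p)"

lemma DA: "p \<in> dm \<Longrightarrow> ((\<lambda>p. A p w) has_derivative DA w p) (at p)"
  unfolding DA_def by (rule smooth_on_has_derivative[OF smooth_A])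

lemma DB: "p \<in> dinv \<Longrightarrow> ((\<lambda>p. B p w) has_derivative DB w p) (at p)"
  unfolding DB_def by (rule smooth_on_has_derivative[OF smooth_B])

text \<open>The commutator of the coordinate fields \<open>\<lambda>p. A p v\<close> and
  \<open>\<lambda>p. A p w\<close>, read off by applying \<open>tau (lbr v w)\<close> to cutoff
  coordinate functions.\<close>

lemma structure_equation_A:
  obtains r where "0 < r" "ball 0 r \<subseteq> dm"
    "\<And>p v w. p \<in> ball 0 r \<Longrightarrow> DA w p (A p v) - DA v p (A p w) = A p (lbr v w)"
proof -
  obtain r where r: "0 < r" "ball 0 r \<subseteq> dm" "\<And>b. \<exists>f\<in>SF. \<forall>u\<in>ball 0 r. f (\<kappa> u) = u \<bullet> b"
    by (rule coordinate_functions) blast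
  show thesis
  proof (rule that[OF r(1,2)])
    fix p v w :: 'e assume p: "p \<in> ball 0 r"
    show "DA w p (A p v) - DA v p (A p w) = A p (lbr v w)"
    proof (rule euclidean_eqI)
      fix b :: 'e
      obtain f where f: "f \<in> SF" "\<forall>u\<in>ball 0 r. f (\<kappa> u) = u \<bullet> b" using r(3) by blast
      have 1: "tau w f (\<kappa> q) = A q w \<bullet> b" if q: "q \<in> ball 0 r" for q w
      proof (rule tau_\<kappa>[OF f(1)])
        show "((\<lambda>u. f (\<kappa> u)) has_derivative (\<lambda>u. u \<bullet> b)) (at q)"
          by (rule has_derivative_transform_within_open[of "\<lambda>u. u \<bullet> b" _ _ _ "ball 0 r"])
            (use f(2) q in \<open>auto intro!: derivative_eq_intros\<close>)
      qed (use q r(2) in blast)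
      have 2: "tau v (tau w f) (\<kappa> p) = DA w p (A p v) \<bullet> b" for v w
      proof (rule tau_\<kappa>[OF tau_SF[OF f(1)], where D = "\<lambda>u. DA w p u \<bullet> b"])
        have "p \<in> dm" using p r(2) by blast
        from has_derivative_inner_left[OF DA[OF this]]
        show "((\<lambda>u. tau w f (\<kappa> u)) has_derivative (\<lambda>u. DA w p u \<bullet> b)) (at p)"
          by (rule has_derivative_transform_within_open[OF _ open_ball p]) (simp only: 1)
      qed (use p r(2) in blast)
      have "A p (lbr v w) \<bullet> b = lie_bracket (tau v) (tau w) f (\<kappa> p)"
        using 1[OF p] by (simp add: tau_lbr[symmetric])
      also have "\<dots> = (DA w p (A p v) - DA v p (A p w)) \<bullet> b"
        by (simp add: lie_bracket_def 2 inner_diff_left)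
      finally show "(DA w p (A p v) - DA v p (A p w)) \<bullet> b = A p (lbr v w) \<bullet> b" by simp
    qed
  qed
qed

text \<open>Differentiating \<open>B p (A p w) = w\<close> expresses the derivative of
  \<open>B\<close> through that of \<open>A\<close>, so the commutator formula for the fields
  \<open>A\<close> becomes the structure equation of the dual form \<open>B\<close>.\<close>

lemma maurer_cartan:
  obtains r where "0 < r" "ball 0 r \<subseteq> dinv"
    "\<And>p v w. p \<in> ball 0 r \<Longrightarrow> DB w p v - DB v p w = - lbr (B p v) (B p w)"
proof -
  obtain r where r: "0 < r" "ball 0 r \<subseteq> dm"
    "\<And>p v w. p \<in> ball 0 r \<Longrightarrow> DA w p (A p v) - DA v p (A p w) = A p (lbr v w)"
    by (rule structure_equation_A) blast
  obtain s where s: "0 < s" "ball 0 s \<subseteq> dinv" using open_dinv zero_dinv open_contains_ball by blast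
  have dd: "dinv \<subseteq> dm" by (auto simp: dinv_def)
  show thesis
  proof (rule that[of "min r s"])
    fix p v w assume "p \<in> ball (0::'e) (min r s)"
    then have p: "p \<in> ball 0 r" "p \<in> dinv" "p \<in> dm" using r(2) s(2) by auto
    have *: "DB (A p w) p u = - B p (DA w p u)" for u w
    proof -
      have "((\<lambda>q. B q (A q w)) has_derivative (\<lambda>u. DB (A p w) p u + B p (DA w p u))) (at p)"
        by (rule has_derivative_linear_apply[OF open_dinv p(2) _ DB[OF p(2)] DA[OF p(3)]])
          (use linear_B dd in blast)
      then have "((\<lambda>q. w) has_derivative (\<lambda>u. DB (A p w) p u + B p (DA w p u))) (at p)"
        by (rule has_derivative_transform_within_open[OF _ open_dinv p(2)]) (use B_A dd in auto)
      from fun_cong[OF has_derivative_unique[OF this has_derivative_const], of u]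
      show ?thesis by (simp add: eq_neg_iff_add_eq_0)
    qed
    \<comment> \<open>The formula \<open>*\<close> differentiates \<open>B\<close> only on vectors
      of the form \<open>A p w\<close>; by \<open>A_B\<close> these are all vectors.\<close>
    have "DB (A p (B p w)) p (A p (B p v)) - DB (A p (B p v)) p (A p (B p w))
        = - B p (DA (B p w) p (A p (B p v)) - DA (B p v) p (A p (B p w)))"
      unfolding * by (simp add: linear_diff[OF linear_B[OF p(3)]])
    also have "\<dots> = - lbr (B p v) (B p w)"
      unfolding r(3)[OF p(1)] by (simp add: B_A p)
    finally show "DB w p v - DB v p w = - lbr (B p v) (B p w)" by (simp add: A_B p)
  qed (use r s in auto)
qed

end

section \<open>Local isomorphism with a two-step nilpotent group\<close>

text \<open>The Baker-Campbell-Hausdorff product for the bracket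
  \<open>\<omega> u v *\<^sub>R \<xi>\<close>; for central \<xi> all later terms of the series
  vanish.\<close>

definition hmul :: "('e::real_vector \<Rightarrow> 'e \<Rightarrow> real) \<Rightarrow> 'e \<Rightarrow> 'e \<Rightarrow> 'e \<Rightarrow> 'e" where
  "hmul \<omega> \<xi> u v = u + v + (\<omega> u v / 2) *\<^sub>R \<xi>"

locale two_step =
  fixes \<omega> :: "'e::euclidean_space \<Rightarrow> 'e \<Rightarrow> real" and \<xi> :: 'e
  assumes bil: "bounded_bilinear \<omega>" and alt: "\<omega> v w = - \<omega> w v" and \<omega>_\<xi>: "\<omega> \<xi> v = 0"
    and \<xi>_nz: "\<xi> \<noteq> 0"
begin

abbreviation "hm \<equiv> hmul \<omega> \<xi>"

lemma \<omega>_\<xi>': "\<omega> v \<xi> = 0" using alt[of v \<xi>] \<omega>_\<xi> by simp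

lemma \<omega>_self: "\<omega> v v = 0" using alt[of v v] by simp

lemmas \<omega>_add = bounded_bilinear.add_left[OF bil] bounded_bilinear.add_right[OF bil]
lemmas \<omega>_diff = bounded_bilinear.diff_left[OF bil] bounded_bilinear.diff_right[OF bil]
lemmas \<omega>_scale = bounded_bilinear.scaleR_left[OF bil] bounded_bilinear.scaleR_right[OF bil]
lemmas \<omega>_zero = bounded_bilinear.zero_left[OF bil] bounded_bilinear.zero_right[OF bil]
lemmas \<omega>_minus = bounded_bilinear.minus_left[OF bil] bounded_bilinear.minus_right[OF bil]
lemmas \<omega>_simps = \<omega>_add \<omega>_diff \<omega>_scale \<omega>_zero \<omega>_minus \<omega>_\<xi> \<omega>_\<xi>' \<omega>_self

definition "dual v = v \<bullet> \<xi> / (\<xi> \<bullet> \<xi>)"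
definition "proj v = v - dual v *\<^sub>R \<xi>"

lemma dual_\<xi>: "dual \<xi> = 1" using \<xi>_nz by (simp add: dual_def)

lemma bounded_linear_dual: "bounded_linear dual"
  unfolding dual_def by (rule bounded_linear_compose[OF bounded_linear_divide bounded_linear_inner_left])

lemma bounded_linear_proj: "bounded_linear proj"
  unfolding proj_def
  by (intro bounded_linear_sub bounded_linear_ident bounded_linear_scaleR_const bounded_linear_dual)

lemma proj_\<xi>: "proj \<xi> = 0" by (simp add: proj_def dual_\<xi>)

lemma \<omega>_proj: "\<omega> (proj v) w = \<omega> v w" "\<omega> v (proj w) = \<omega> v w"
  by (simp_all add: proj_def \<omega>_simps)

end

locale lie_chart_two_step = lie_chart G U x + two_step \<omega> \<xi>
  for G :: "('g::{t2_space,second_countable_topology}, 'e::euclidean_space) smooth_group" (structure)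
    and U x and \<omega> :: "'e \<Rightarrow> 'e \<Rightarrow> real" and \<xi> :: 'e +
  assumes lbr_\<omega>: "lbr v w = \<omega> v w *\<^sub>R \<xi>"
begin

text \<open>By the Maurer-Cartan equation, \<open>proj \<circ> B\<close> is closed, say \<open>proj \<circ> B = dQ\<close>, and the
  differential \<open>- \<omega>(B, B)\<close> of \<open>dual \<circ> B\<close> is cancelled by that of \<open>\<omega>(Q, dQ) / 2\<close>.\<close>

lemma local_coordinates:
  obtains R F where "0 < R" "ball 0 R \<subseteq> dinv" "F 0 = 0" "smooth_on (ball 0 R) F"
    "\<And>p. p \<in> ball 0 R \<Longrightarrow> (F has_derivative (\<lambda>v. B p v + (\<omega> (F p) (B p v) / 2) *\<^sub>R \<xi>)) (at p)"
proof -
  obtain R where R: "0 < R" "ball 0 R \<subseteq> dinv"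
    "\<And>p v w. p \<in> ball 0 R \<Longrightarrow> DB w p v - DB v p w = - lbr (B p v) (B p w)"
    by (rule maurer_cartan) blast
  have dd: "dinv \<subseteq> dm" by (auto simp: dinv_def)
  have linB: "linear (B p)" if "p \<in> ball 0 R" for p using that R(2) dd linear_B by blast
  have smB: "smooth_on (ball 0 R) (\<lambda>p. B p v)" for v
    by (rule smooth_on_subset[OF smooth_B R(2)])
  have dB: "((\<lambda>p. B p v) has_derivative DB v p) (at p)" if "p \<in> ball 0 R" for p v
    using that R(2) DB by blast
  interpret \<pi>: bounded_linear proj by (rule bounded_linear_proj)
  interpret \<delta>: bounded_linear dual by (rule bounded_linear_dual)
  have MC: "DB w p v = DB v p w - \<omega> (B p v) (B p w) *\<^sub>R \<xi>" if "p \<in> ball 0 R" for p v w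
    using R(3)[OF that, of w v] by (simp add: lbr_\<omega> algebra_simps)
  obtain Q where Q: "Q 0 = 0" "smooth_on (ball 0 R) Q"
    "\<And>p. p \<in> ball 0 R \<Longrightarrow> (Q has_derivative (\<lambda>v. proj (B p v))) (at p)"
  proof (rule poincare[of R "\<lambda>p v. proj (B p v)" "\<lambda>v p u. proj (DB v p u)"])
    show "linear (\<lambda>v. proj (B p v))" if "p \<in> ball 0 R" for p
      using linear_compose[OF linB[OF that] \<pi>.linear_axioms] by (simp add: o_def)
    show "smooth_on (ball 0 R) (\<lambda>p. proj (B p v))" for v
      by (rule smooth_on_bounded_linear[OF bounded_linear_proj open_ball smB])
    show "((\<lambda>p. proj (B p v)) has_derivative (\<lambda>u. proj (DB v p u))) (at p)" if "p \<in> ball 0 R" for p v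
      by (rule \<pi>.has_derivative[OF dB[OF that]])
    show "proj (DB v p u) = proj (DB u p v)" if "p \<in> ball 0 R" for p u v
      unfolding MC[OF that, of v u] by (simp add: \<pi>.diff \<pi>.scaleR proj_\<xi>)
  qed blast
  obtain X where X: "X 0 = 0" "smooth_on (ball 0 R) X"
    "\<And>p. p \<in> ball 0 R \<Longrightarrow> (X has_derivative (\<lambda>v. dual (B p v) + \<omega> (Q p) (B p v) / 2)) (at p)"
  proof (rule poincare[of R "\<lambda>p v. dual (B p v) + \<omega> (Q p) (B p v) / 2"
        "\<lambda>v p u. dual (DB v p u) + (\<omega> (Q p) (DB v p u) + \<omega> (proj (B p u)) (B p v)) / 2"])
    show "linear (\<lambda>v. dual (B p v) + \<omega> (Q p) (B p v) / 2)" if "p \<in> ball 0 R" for p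
      by (intro linearI) (simp_all add: linear_add[OF linB[OF that]] linear_cmul[OF linB[OF that]]
          \<delta>.add \<delta>.scaleR \<omega>_simps algebra_simps add_divide_distrib)
    show "smooth_on (ball 0 R) (\<lambda>p. dual (B p v) + \<omega> (Q p) (B p v) / 2)" for v
    proof -
      have "smooth_on (ball 0 R) (\<lambda>p. dual (B p v) + (1/2) *\<^sub>R \<omega> (Q p) (B p v))"
        by (intro smooth_on_add smooth_on_scaleR smooth_on_const smooth_on_bounded_bilinear[OF bil]
            smooth_on_bounded_linear[OF bounded_linear_dual] open_ball smB Q)
      then show ?thesis by simp
    qed
    show "((\<lambda>p. dual (B p v) + \<omega> (Q p) (B p v) / 2) has_derivative
       (\<lambda>u. dual (DB v p u) + (\<omega> (Q p) (DB v p u) + \<omega> (proj (B p u)) (B p v)) / 2)) (at p)"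
      if "p \<in> ball 0 R" for p v
    proof -
      have "((\<lambda>p. dual (B p v) + (1/2) *\<^sub>R \<omega> (Q p) (B p v)) has_derivative
       (\<lambda>u. dual (DB v p u) + (1/2) *\<^sub>R (\<omega> (Q p) (DB v p u) + \<omega> (proj (B p u)) (B p v)))) (at p)"
        by (intro has_derivative_add has_derivative_scaleR_right \<delta>.has_derivative
            bounded_bilinear.FDERIV[OF bil] dB Q that)
      then show ?thesis by simp
    qed
    show "dual (DB v p u) + (\<omega> (Q p) (DB v p u) + \<omega> (proj (B p u)) (B p v)) / 2 =
        dual (DB u p v) + (\<omega> (Q p) (DB u p v) + \<omega> (proj (B p v)) (B p u)) / 2"
      if "p \<in> ball 0 R" for p u v
      unfolding MC[OF that, of v u] using alt[of "B p v" "B p u"]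
      by (simp add: \<delta>.diff \<delta>.scaleR dual_\<xi> \<omega>_simps \<omega>_proj)
  qed blast
  \<comment> \<open>The derivative of \<open>hm (F p)\<close> at 0 sends w to w + (\<omega>(F p, w)
    / 2) \<xi>. So the equation reached for \<open>F\<close> says that it pulls the Maurer-Cartan
    form of the two-step group back to \<open>B\<close>.\<close>
  define F where "F p = Q p + X p *\<^sub>R \<xi>" for p
  have \<omega>F: "\<omega> (F p) v = \<omega> (Q p) v" for p v by (simp add: F_def \<omega>_simps)
  show thesis
  proof (rule that[OF R(1,2), of F])
    show "F 0 = 0" by (simp add: F_def Q X)
    show "smooth_on (ball 0 R) F"
      unfolding F_def by (intro smooth_on_add smooth_on_scaleR smooth_on_const open_ball Q X)
    fix p :: 'e assume p: "p \<in> ball 0 R"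
    have "(F has_derivative (\<lambda>v. proj (B p v) + (dual (B p v) + \<omega> (Q p) (B p v) / 2) *\<^sub>R \<xi>)) (at p)"
      unfolding F_def by (intro has_derivative_add has_derivative_scaleR_left Q X p)
    then show "(F has_derivative (\<lambda>v. B p v + (\<omega> (F p) (B p v) / 2) *\<^sub>R \<xi>)) (at p)"
      unfolding \<omega>F by (simp add: proj_def scaleR_add_left)
  qed
qed

lemma open_mult_ball:
  assumes "open S" "0 \<in> S" "S \<subseteq> dm"
  obtains r where "0 < r" "ball 0 r \<subseteq> S" "\<And>p q. p \<in> ball 0 r \<Longrightarrow> q \<in> ball 0 r \<Longrightarrow> (p, q) \<in> dmul \<and> mu p q \<in> S"
proof -
  have c: "continuous_on dmul (\<lambda>q. mu (fst q) (snd q))"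
    by (rule smooth_on_continuous_on[OF smooth_mu])
  have "open (dmul \<inter> (\<lambda>q. mu (fst q) (snd q)) -` S)"
    by (rule continuous_open_preimage[OF c open_dmul assms(1)])
  moreover have "(0, 0) \<in> dmul \<inter> (\<lambda>q. mu (fst q) (snd q)) -` S"
    using dmul_0[OF zero_dm] mu_0_right[OF zero_dm] assms(2) by simp
  ultimately obtain M N where MN: "open M" "open N" "(0, 0) \<in> M \<times> N"
    "M \<times> N \<subseteq> dmul \<inter> (\<lambda>q. mu (fst q) (snd q)) -` S"
    by (rule open_prod_elim) blast
  have "open (M \<inter> N \<inter> S)" "0 \<in> M \<inter> N \<inter> S" using MN assms by auto
  then obtain r where r: "0 < r" "ball 0 r \<subseteq> M \<inter> N \<inter> S" using open_contains_ball by blast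
  show thesis
  proof (rule that[OF r(1)])
    show "ball 0 r \<subseteq> S" using r(2) by blast
    fix p q :: 'e assume "p \<in> ball 0 r" "q \<in> ball 0 r"
    then have "(p, q) \<in> M \<times> N" using r(2) by blast
    then show "(p, q) \<in> dmul \<and> mu p q \<in> S" using MN(4) by auto
  qed
qed

text \<open>As functions of \<open>q\<close>, both sides solve the same total differential equation,
  and they agree at q = 0. The equation is triangular: the projected parts are compared first, and
  since \<omega> sees only these, the \<xi>-component can be compared afterwards.\<close>

lemma local_homomorphism:
  assumes F: "F 0 = 0"
    "\<And>p. p \<in> ball 0 R \<Longrightarrow> (F has_derivative (\<lambda>v. B p v + (\<omega> (F p) (B p v) / 2) *\<^sub>R \<xi>)) (at p)"
    and r: "r \<le> R" "ball 0 R \<subseteq> dm"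
    "\<And>p q. p \<in> ball 0 r \<Longrightarrow> q \<in> ball 0 r \<Longrightarrow> (p, q) \<in> dmul \<and> mu p q \<in> ball 0 R"
    and p: "p \<in> ball 0 r" and q: "q \<in> ball 0 r"
  shows "F (mu p q) = hm (F p) (F q)"
proof -
  interpret \<pi>: bounded_linear proj by (rule bounded_linear_proj)
  have rR: "ball 0 r \<subseteq> (ball 0 R :: 'e set)" using r(1) by auto
  then have p': "p \<in> dm" using p r(2) by blast
  have z: "0 \<in> ball 0 r" using p by (auto intro: le_less_trans[OF norm_ge_zero])
  have dF: "(F has_derivative (\<lambda>v. B q v + (\<omega> (F q) (B q v) / 2) *\<^sub>R \<xi>)) (at q)"
    if "q \<in> ball 0 r" for q using that rR F(2) by blast
  have dmuF: "((\<lambda>q. F (mu p q)) has_derivative (\<lambda>v. B q v + (\<omega> (F (mu p q)) (B q v) / 2) *\<^sub>R \<xi>)) (at q)"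
    if "q \<in> ball 0 r" for q
  proof -
    have pq: "(p, q) \<in> dmul" "mu p q \<in> ball 0 R" using r(3)[OF p that] by auto
    from has_derivative_compose[OF mu_has_derivative[OF pq(1)] F(2)[OF pq(2)]]
    show ?thesis by (simp add: B_left_invariant[OF pq(1)])
  qed
  have 1: "proj (F (mu p q)) = proj (F p) + proj (F q)" if q: "q \<in> ball 0 r" for q
  proof -
    define \<Phi> where "\<Phi> q = proj (F (mu p q)) - proj (F q)" for q
    have "(\<Phi> has_derivative (\<lambda>v. 0)) (at q within ball 0 r)" if "q \<in> ball 0 r" for q
    proof -
      have "(\<Phi> has_derivative (\<lambda>v. proj (B q v + (\<omega> (F (mu p q)) (B q v) / 2) *\<^sub>R \<xi>)
          - proj (B q v + (\<omega> (F q) (B q v) / 2) *\<^sub>R \<xi>))) (at q)"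
        unfolding \<Phi>_def by (intro has_derivative_diff \<pi>.has_derivative dmuF dF that)
      then show ?thesis by (simp add: \<pi>.add \<pi>.scaleR proj_\<xi> has_derivative_at_withinI)
    qed
    then obtain c where "\<And>q. q \<in> ball 0 r \<Longrightarrow> \<Phi> q = c"
      using has_derivative_zero_constant[OF convex_ball, of 0 r \<Phi>] by blast
    from this[OF q] this[OF z] show ?thesis
      by (simp add: \<Phi>_def mu_0_right[OF p'] F(1) \<pi>.zero algebra_simps)
  qed
  have 2: "\<omega> (F (mu p q)) v = \<omega> (F p) v + \<omega> (F q) v" if "q \<in> ball 0 r" for q v
    using arg_cong[OF 1[OF that], of "\<lambda>u. \<omega> u v"] by (simp add: \<omega>_add \<omega>_proj)
  define \<Phi> where "\<Phi> q = F (mu p q) - F q - (\<omega> (F p) (F q) / 2) *\<^sub>R \<xi>" for q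
  have "(\<Phi> has_derivative (\<lambda>v. 0)) (at q within ball 0 r)" if "q \<in> ball 0 r" for q
  proof -
    have "((\<lambda>q. \<omega> (F p) (F q)) has_derivative (\<lambda>v. \<omega> (F p) (B q v + (\<omega> (F q) (B q v) / 2) *\<^sub>R \<xi>))) (at q)"
      by (rule bounded_linear.has_derivative[OF bounded_bilinear.bounded_linear_right[OF bil] dF[OF that]])
    then have "((\<lambda>q. (1/2) *\<^sub>R \<omega> (F p) (F q) *\<^sub>R \<xi>) has_derivative (\<lambda>v. (1/2) *\<^sub>R \<omega> (F p) (B q v) *\<^sub>R \<xi>)) (at q)"
      by (intro has_derivative_scaleR_left has_derivative_scaleR_right) (simp add: \<omega>_simps)
    then have "((\<lambda>q. (\<omega> (F p) (F q) / 2) *\<^sub>R \<xi>) has_derivative (\<lambda>v. (\<omega> (F p) (B q v) / 2) *\<^sub>R \<xi>)) (at q)"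
      by simp
    from has_derivative_diff[OF has_derivative_diff[OF dmuF[OF that] dF[OF that]] this]
    have "(\<Phi> has_derivative (\<lambda>v. 0)) (at q)"
      unfolding \<Phi>_def 2[OF that] by (simp add: algebra_simps add_divide_distrib)
    then show ?thesis by (rule has_derivative_at_withinI)
  qed
  then obtain c where "\<And>q. q \<in> ball 0 r \<Longrightarrow> \<Phi> q = c"
    using has_derivative_zero_constant[OF convex_ball, of 0 r \<Phi>] by blast
  from this[OF q] this[OF z] show ?thesis
    by (simp add: \<Phi>_def hmul_def mu_0_right[OF p'] F(1) \<omega>_zero algebra_simps)
qed

text \<open>The derivative of \<open>F\<close> at 0 is \<open>B 0\<close>, the identity, so the
  inverse function theorem applies; it supplies \<open>E\<close> with one derivative.\<close>

lemma local_isomorphism: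
  obtains F E S T r where "open S" "0 \<in> S" "S \<subseteq> dm" "open T" "homeomorphism S T F E" "F 0 = 0"
    "smooth_on S F" "smooth_on T E" "0 < r" "ball 0 r \<subseteq> S"
    "\<And>p q. p \<in> ball 0 r \<Longrightarrow> q \<in> ball 0 r \<Longrightarrow> (p, q) \<in> dmul \<and> mu p q \<in> S \<and> F (mu p q) = hm (F p) (F q)"
proof -
  obtain R F where F: "0 < R" "ball 0 R \<subseteq> dinv" "F 0 = 0" "smooth_on (ball 0 R) F"
    "\<And>p. p \<in> ball 0 R \<Longrightarrow> (F has_derivative (\<lambda>v. B p v + (\<omega> (F p) (B p v) / 2) *\<^sub>R \<xi>)) (at p)"
    by (rule local_coordinates) blast
  have Rdm: "ball 0 R \<subseteq> dm" using F(2) by (auto simp: dinv_def)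
  define F' where "F' p v = B p v + (\<omega> (F p) (B p v) / 2) *\<^sub>R \<xi>" for p v
  note dF = F(5)[folded F'_def]
  have blF: "bounded_linear (F' p)" if "p \<in> ball 0 R" for p
    using dF[OF that] by (rule has_derivative_bounded_linear)
  define D where "D p = Blinfun (F' p)" for p
  have D: "blinfun_apply (D p) = F' p" if "p \<in> ball 0 R" for p
    unfolding D_def by (rule bounded_linear_Blinfun_apply[OF blF[OF that]])
  have cD: "continuous_on (ball 0 R) D"
  proof (rule continuous_on_blinfun_componentwise)
    fix v :: 'e
    have "continuous_on (ball 0 R) (\<lambda>p. F' p v)"
    proof (rule continuous_on_eq[OF smooth_on_continuous_on[OF smooth_on_frechet_derivative[OF F(4)]]])
      show "frechet_derivative F (at p) v = F' p v" if "p \<in> ball 0 R" for p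
        using frechet_derivative_at[OF dF[OF that]] by simp
    qed
    then show "continuous_on (ball 0 R) (\<lambda>p. blinfun_apply (D p) v)"
      by (rule continuous_on_eq) (simp add: D)
  qed
  have 0: "0 \<in> ball 0 R" using F(1) by simp
  have "id_blinfun o\<^sub>L D 0 = id_blinfun"
    by (rule blinfun_eqI) (simp add: D[OF 0] F'_def F(3) B_0 \<omega>_zero)
  then obtain S T E E' where ST: "open S" "S \<subseteq> ball 0 R" "0 \<in> S" "open T" "F 0 \<in> T"
    "homeomorphism S T F E" "\<And>y. y \<in> T \<Longrightarrow> (E has_derivative (E' y)) (at y)"
    "\<And>y. y \<in> T \<Longrightarrow> E' y = inv_into UNIV (blinfun_apply (D (E y)))"
    "\<And>y. y \<in> T \<Longrightarrow> bij (blinfun_apply (D (E y)))"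
    using inverse_function_theorem[OF open_ball _ cD 0, of F id_blinfun] dF D by metis
  have ES: "E y \<in> S" "F (E y) = y" if "y \<in> T" for y
    using ST(6) that by (auto simp: homeomorphism_def)
  \<comment> \<open>Inverting v + (\<omega>(y, v) / 2) \<xi> only changes the sign of the
    correction, because \<omega> kills \<xi>. The resulting formula gives the derivative of
    \<open>E\<close> in terms of \<open>E\<close> itself, so each degree of smoothness yields the
    next.\<close>
  have E': "E' y v = A (E y) (v - (\<omega> y v / 2) *\<^sub>R \<xi>)" if "y \<in> T" for y v
  proof -
    have Ey: "E y \<in> ball 0 R" "E y \<in> dm" using ES[OF that] ST(2) Rdm by auto
    have "F' (E y) (A (E y) (v - (\<omega> y v / 2) *\<^sub>R \<xi>)) = v"
      by (simp add: F'_def B_A[OF Ey(2)] ES(2)[OF that] \<omega>_simps)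
    then show ?thesis
      using ST(8)[OF that] ST(9)[OF that] D[OF Ey(1)] by (metis bij_is_inj inv_f_f)
  qed
  have "Ck_on k T E" for k
  proof (induction k)
    case 0
    then show ?case using ST(6) by (simp add: homeomorphism_def)
  next
    case (Suc k)
    show ?case
    proof (rule Ck_on_SucI[OF ST(4) ST(7)])
      fix v
      have "Ck_on k T (\<lambda>y. A (E y) (v - (1/2) *\<^sub>R \<omega> y v *\<^sub>R \<xi>))"
      proof (rule Ck_on_linear_apply[where B = "\<lambda>y. A (E y)", OF ST(4)])
        show "linear (A (E p))" if "p \<in> T" for p using ES[OF that] ST(2) Rdm linear_A by blast
        show "Ck_on k T (\<lambda>y. A (E y) z)" for z
          by (rule Ck_on_compose[OF ST(4) open_dm _ Suc]) (use ES ST(2) Rdm smooth_A in \<open>auto simp: smooth_on_def\<close>)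
        have "smooth_on T (\<lambda>y. v - (1/2) *\<^sub>R \<omega> y v *\<^sub>R \<xi>)"
          by (intro smooth_on_diff smooth_on_scaleR smooth_on_const smooth_on_bounded_bilinear[OF bil]
              smooth_on_id ST(4))
        then show "Ck_on k T (\<lambda>y. v - (1/2) *\<^sub>R \<omega> y v *\<^sub>R \<xi>)" by (simp add: smooth_on_def)
      qed
      then show "Ck_on k T (\<lambda>y. E' y v)"
        by (rule Ck_on_cong[OF ST(4), rotated]) (simp add: E')
    qed
  qed
  then have smE: "smooth_on T E" by (simp add: smooth_on_def)
  have Sdm: "S \<subseteq> dm" using ST(2) Rdm by blast
  obtain r where r: "0 < r" "ball 0 r \<subseteq> S"
    "\<And>p q. p \<in> ball 0 r \<Longrightarrow> q \<in> ball 0 r \<Longrightarrow> (p, q) \<in> dmul \<and> mu p q \<in> S"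
    by (rule open_mult_ball[OF ST(1,3) Sdm]) blast
  have "ball 0 (min r R) \<subseteq> (ball 0 r :: 'e set)" by auto
  then have r': "(p, q) \<in> dmul \<and> mu p q \<in> ball 0 R"
    if "p \<in> ball 0 (min r R)" "q \<in> ball 0 (min r R)" for p q
    using r(3)[of p q] that ST(2) by blast
  have pq: "(p, q) \<in> dmul \<and> mu p q \<in> S \<and> F (mu p q) = hm (F p) (F q)"
    if "p \<in> ball 0 (min r R)" "q \<in> ball 0 (min r R)" for p q
  proof -
    have "F (mu p q) = hm (F p) (F q)"
      by (rule local_homomorphism[OF F(3,5) _ Rdm r' that]) auto
    then show ?thesis using r(3)[of p q] that by simp
  qed
  have "ball 0 (min r R) \<subseteq> S" "0 < min r R" using r F(1) by auto
  with pq show thesis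
    by (intro that[OF ST(1,3) Sdm ST(4,6) F(3) smooth_on_subset[OF F(4) ST(2)] smE])
qed

end

section \<open>Algebra and continuity of the two-step nilpotent group law\<close>

context two_step
begin

lemma hm_0 [simp]: "hm 0 v = v" "hm v 0 = v" by (simp_all add: hmul_def \<omega>_zero)

lemma hm_assoc: "hm (hm u v) w = hm u (hm v w)"
  by (simp add: hmul_def \<omega>_simps algebra_simps add_divide_distrib scaleR_add_left)

lemma hm_minus [simp]: "hm v (- v) = 0" "hm (- v) v = 0"
  by (simp_all add: hmul_def \<omega>_minus \<omega>_self)

lemma hm_eq_0: "hm (- u) v = 0 \<Longrightarrow> u = v"
  by (metis hm_assoc hm_0 hm_minus(1))

lemma hm_commuting: "\<omega> u v = 0 \<Longrightarrow> hm u v = u + v"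
  by (simp add: hmul_def)

lemma continuous_on_hm:
  "continuous_on S f \<Longrightarrow> continuous_on S h \<Longrightarrow> continuous_on S (\<lambda>p. hm (f p) (h p))"
  unfolding hmul_def by (intro continuous_intros bounded_bilinear.continuous_on[OF bil]) auto

lemma smooth_on_hm:
  assumes "open S" "smooth_on S f" "smooth_on S h"
  shows "smooth_on S (\<lambda>p. hm (f p) (h p))"
proof -
  have "smooth_on S (\<lambda>p. f p + h p + (1/2) *\<^sub>R \<omega> (f p) (h p) *\<^sub>R \<xi>)"
    by (intro smooth_on_add smooth_on_scaleR smooth_on_const smooth_on_bounded_bilinear[OF bil] assms)
  then show ?thesis by (simp add: hmul_def)
qed

lemma hm_small:
  assumes "\<epsilon> > 0"
  obtains \<delta> where "0 < \<delta>" "\<delta> \<le> \<epsilon>" "\<And>u v. norm u < \<delta> \<Longrightarrow> norm v < \<delta> \<Longrightarrow> norm (hm u v) < \<epsilon>"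
proof -
  have "continuous_on UNIV (\<lambda>q. hm (fst q) (snd q))"
    by (intro continuous_on_hm continuous_on_fst continuous_on_snd continuous_on_id)
  then have "open ((\<lambda>q. hm (fst q) (snd q)) -` ball 0 \<epsilon>)" by (rule open_continuous_vimage) simp
  moreover have "(0, 0) \<in> (\<lambda>q. hm (fst q) (snd q)) -` ball 0 \<epsilon>" using assms by simp
  ultimately obtain M N where MN: "open M" "open N" "(0, 0) \<in> M \<times> N"
    "M \<times> N \<subseteq> (\<lambda>q. hm (fst q) (snd q)) -` ball 0 \<epsilon>"
    by (rule open_prod_elim) blast
  have "open (M \<inter> N)" "0 \<in> M \<inter> N" using MN by auto
  then obtain r where r: "0 < r" "ball 0 r \<subseteq> M \<inter> N" using open_contains_ball by blast
  show thesis
  proof (rule that[of "min r \<epsilon>"])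
    fix u v :: 'e assume "norm u < min r \<epsilon>" "norm v < min r \<epsilon>"
    then have "u \<in> ball 0 r" "v \<in> ball 0 r" by auto
    then have "(u, v) \<in> M \<times> N" using r(2) by blast
    then show "norm (hm u v) < \<epsilon>" using MN(4) by auto
  qed (use r assms in auto)
qed

end

section \<open>Extending a local homomorphism\<close>

locale group_two_step = group G + two_step \<omega> \<xi>
  for G :: "('g, 'm) monoid_scheme" (structure) and \<omega> :: "'e::euclidean_space \<Rightarrow> 'e \<Rightarrow> real" and \<xi> :: 'e +
  assumes carrier_UNIV [simp]: "carrier G = UNIV"
begin

text \<open>The extension is \<open>y \<mapsto> L (y / 2^k)^(2^k)\<close>. By induction on the size of the arguments, it is a
  homomorphism first on commuting pairs, and then on all pairs, since
  \<open>a\<^sup>2 b\<^sup>2 = (a b)\<^sup>2 c\<close> if \<open>a b = b a c\<close> with \<open>c\<close> commuting with \<open>a\<close> and \<open>b\<close>.\<close>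

lemma extend_local_homomorphism:
  assumes \<epsilon>: "\<epsilon> > 0" and L: "\<And>y z. norm y < \<epsilon> \<Longrightarrow> norm z < \<epsilon> \<Longrightarrow> L y \<otimes> L z = L (hm y z)"
  obtains E where "\<And>y z. E (hm y z) = E y \<otimes> E z" "\<And>y. norm y < \<epsilon> \<Longrightarrow> E y = L y"
proof -
  define sq where "sq a = a \<otimes> a" for a
  \<comment> \<open>By \<open>half\<close>, one more halving and squaring changes nothing as soon as
    \<open>norm y < \<epsilon> * 2 ^ k\<close>. The least such \<open>k\<close>, chosen for
    \<open>E\<close> below, is therefore as good as any other.\<close>
  define pw where "pw k y = (sq ^^ k) (L ((1 / 2 ^ k) *\<^sub>R y))" for k y
  have half: "sq (L ((1/2) *\<^sub>R y)) = L y" if "norm y < \<epsilon>" for y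
  proof -
    have "hm ((1/2) *\<^sub>R y) ((1/2) *\<^sub>R y) = y"
      by (simp add: hmul_def \<omega>_simps flip: scaleR_add_left)
    then show ?thesis using L[of "(1/2) *\<^sub>R y" "(1/2) *\<^sub>R y"] that \<epsilon> by (simp add: sq_def)
  qed
  have pw_Suc: "pw (Suc k) y = pw k y" if "norm y < \<epsilon> * 2 ^ k" for k y
  proof -
    have "norm ((1 / 2 ^ k) *\<^sub>R y) < \<epsilon>" using that by (simp add: field_simps)
    from half[OF this] show ?thesis by (simp add: pw_def funpow_Suc_right mult.commute del: funpow.simps)
  qed
  have pw_add: "pw (k + j) y = pw k y" if "norm y < \<epsilon> * 2 ^ k" for k j y
  proof (induction j)
    case (Suc j)
    have "\<epsilon> * 2 ^ k \<le> \<epsilon> * 2 ^ (k + j)" using \<epsilon> by simp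
    then show ?case using Suc pw_Suc[of y "k + j"] that by simp
  qed simp
  have ex: "\<exists>k. norm y < \<epsilon> * 2 ^ k" for y :: 'e
  proof -
    obtain k where "norm y / \<epsilon> < 2 ^ k" using real_arch_pow[of 2 "norm y / \<epsilon>"] by auto
    then show ?thesis using \<epsilon> by (intro exI[of _ k]) (simp add: field_simps)
  qed
  define E where "E y = pw (LEAST k. norm y < \<epsilon> * 2 ^ k) y" for y
  have E_pw: "E y = pw k y" if "norm y < \<epsilon> * 2 ^ k" for k y
  proof -
    let ?l = "LEAST k. norm y < \<epsilon> * 2 ^ k"
    have "?l \<le> k" using that by (rule Least_le)
    then show ?thesis using pw_add[OF LeastI[of "\<lambda>k. norm y < \<epsilon> * 2 ^ k", OF that], of "k - ?l"]
      by (simp add: E_def)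
  qed
  have E_L: "E y = L y" if "norm y < \<epsilon>" for y
    using E_pw[of y 0] that by (simp add: pw_def)
  have E_dbl: "E (2 *\<^sub>R y) = E y \<otimes> E y" for y
  proof -
    obtain k where k: "norm y < \<epsilon> * 2 ^ k" using ex by blast
    then have "E (2 *\<^sub>R y) = pw (Suc k) (2 *\<^sub>R y)" by (intro E_pw) simp
    then show ?thesis using E_pw[OF k] by (simp add: pw_def sq_def)
  qed
  have small: "\<exists>k. norm y < \<delta> * 2 ^ k \<and> norm z < \<delta> * 2 ^ k" if "\<delta> > 0" for y z :: 'e and \<delta>
  proof -
    obtain k where "(norm y + norm z) / \<delta> < 2 ^ k" using real_arch_pow[of 2 "(norm y + norm z) / \<delta>"] by auto
    then have "norm y + norm z < \<delta> * 2 ^ k" using that by (simp add: field_simps)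
    then show ?thesis using norm_ge_zero[of y] norm_ge_zero[of z] by (intro exI[of _ k]) linarith
  qed
  \<comment> \<open>The radius is halved so that in the base case the sum of the two arguments still
    has norm below \<epsilon>.\<close>
  have comm0: "norm y < \<epsilon> / 2 * 2 ^ k \<Longrightarrow> norm z < \<epsilon> / 2 * 2 ^ k \<Longrightarrow> \<omega> y z = 0 \<Longrightarrow> E (y + z) = E y \<otimes> E z" for k y z
  proof (induction k arbitrary: y z)
    case 0
    then have "norm (y + z) < \<epsilon>" using norm_triangle_ineq[of y z] by simp
    then show ?case using 0 L[of y z] \<epsilon> by (simp add: E_L hm_commuting)
  next
    case (Suc k)
    define y' z' where "y' = (1/2) *\<^sub>R y" and "z' = (1/2) *\<^sub>R z"
    have yz: "y = 2 *\<^sub>R y'" "z = 2 *\<^sub>R z'" by (simp_all add: y'_def z'_def)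
    have \<omega>0: "\<omega> y' z' = 0" "\<omega> z' y' = 0" using Suc.prems(3) alt[of z y] by (simp_all add: y'_def z'_def \<omega>_scale)
    have n: "norm y' < \<epsilon> / 2 * 2 ^ k" "norm z' < \<epsilon> / 2 * 2 ^ k"
      using Suc.prems(1,2) by (simp_all add: y'_def z'_def)
    note 1 = Suc.IH[OF n \<omega>0(1)] and 2 = Suc.IH[OF n(2,1) \<omega>0(2)]
    have "E (y + z) = E (y' + z') \<otimes> E (y' + z')"
      unfolding yz scaleR_add_right[symmetric] by (rule E_dbl)
    also have "\<dots> = E y' \<otimes> E z' \<otimes> (E z' \<otimes> E y')" using 1 2 by (simp add: add.commute)
    also have "\<dots> = E y' \<otimes> (E z' \<otimes> E y') \<otimes> E z'"
      using 1 2 by (simp add: add.commute m_assoc) (metis m_assoc UNIV_I carrier_UNIV)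
    also have "\<dots> = E y \<otimes> E z"
      using 1 2 unfolding yz E_dbl by (simp add: add.commute m_assoc) (metis m_assoc UNIV_I carrier_UNIV)
    finally show ?case .
  qed
  have comm: "E (y + z) = E y \<otimes> E z" if "\<omega> y z = 0" for y z
    using small[of "\<epsilon> / 2" y z] comm0 that \<epsilon> by auto
  obtain \<delta> where \<delta>: "0 < \<delta>" "\<delta> \<le> \<epsilon>" "\<And>u v. norm u < \<delta> \<Longrightarrow> norm v < \<delta> \<Longrightarrow> norm (hm u v) < \<epsilon>"
    by (rule hm_small[OF \<epsilon>]) blast
  have hom0: "norm y < \<delta> * 2 ^ k \<Longrightarrow> norm z < \<delta> * 2 ^ k \<Longrightarrow> E (hm y z) = E y \<otimes> E z" for k y z
  proof (induction k arbitrary: y z)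
    case 0
    then show ?case using L[of y z] \<delta> by (simp add: E_L)
  next
    case (Suc k)
    \<comment> \<open>\<open>w\<close> is the commutator of \<open>y'\<close> and \<open>z'\<close>.
      It is also the excess of \<open>hm y z\<close> over \<open>2 *\<^sub>R hm y' z'\<close>,
      because doubling both arguments multiplies \<omega> by 4. Hence the same
      \<open>c = E w\<close> serves in both identities.\<close>
    define y' z' w where "y' = (1/2) *\<^sub>R y" and "z' = (1/2) *\<^sub>R z" and "w = \<omega> y' z' *\<^sub>R \<xi>"
    have yz: "y = 2 *\<^sub>R y'" "z = 2 *\<^sub>R z'" by (simp_all add: y'_def z'_def)
    have n: "norm y' < \<delta> * 2 ^ k" "norm z' < \<delta> * 2 ^ k"
      using Suc.prems(1,2) by (simp_all add: y'_def z'_def)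
    define a b c where "a = E y'" and "b = E z'" and "c = E w"
    note 1 = Suc.IH[OF n, folded a_def b_def] and 2 = Suc.IH[OF n(2,1), folded a_def b_def]
    have w: "\<omega> w u = 0" "\<omega> u w = 0" for u by (simp_all add: w_def \<omega>_simps)
    have bc: "b \<otimes> c = c \<otimes> b"
      using comm[OF w(1), of z'] comm[OF w(2), of z'] by (simp add: b_def c_def add.commute)
    have "hm y' z' = hm z' y' + w"
      using alt[of z' y'] by (simp add: hmul_def w_def algebra_simps flip: scaleR_add_left)
    then have abc: "a \<otimes> b = b \<otimes> a \<otimes> c" using comm[OF w(2)] by (simp add: 1[symmetric] 2[symmetric] c_def)
    have "hm y z = 2 *\<^sub>R hm y' z' + w"
      by (simp add: yz hmul_def w_def \<omega>_simps algebra_simps flip: scaleR_add_left)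
    then have "E (hm y z) = a \<otimes> b \<otimes> (a \<otimes> b) \<otimes> c"
      by (simp add: comm[OF w(2)] E_dbl 1 c_def)
    also have "\<dots> = a \<otimes> (b \<otimes> a \<otimes> c) \<otimes> b" by (simp add: m_assoc bc)
    also have "\<dots> = E y \<otimes> E z" unfolding abc[symmetric] yz E_dbl by (simp add: m_assoc a_def b_def)
    finally show ?case .
  qed
  have hom: "E (hm y z) = E y \<otimes> E z" for y z
    using small[OF \<delta>(1), of y z] hom0 by auto
  show thesis using that hom E_L by blast
qed

end

text \<open>Simple connectedness is phrased as free homotopy of any two loops. A homotopy between
  two constant loops moves the base point along a path.\<close>

lemma simply_connected_UNIV_connected:
  assumes "simply_connected (UNIV :: 'a::topological_space set)"
  shows "connected (UNIV :: 'a set)"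
proof (rule path_connected_imp_connected)
  show "path_connected (UNIV :: 'a set)"
    unfolding path_connected_def
  proof (intro ballI)
    fix a b :: 'a
    have "homotopic_loops UNIV (\<lambda>t::real. a) (\<lambda>t. b)"
      using assms unfolding simply_connected_def
      by (simp add: path_def pathstart_def pathfinish_def)
    then obtain h where h: "continuous_on ({0..1::real} \<times> {0..1::real}) h"
      "\<forall>t\<in>{0..1}. h (0::real, t) = a" "\<forall>t\<in>{0..1}. h (1, t) = b"
      unfolding homotopic_loops by blast
    have "continuous_on {0..1} (\<lambda>s. h (s, 0))"
      by (rule continuous_on_compose2[OF h(1)]) (auto intro!: continuous_intros)
    then show "\<exists>g. path g \<and> path_image g \<subseteq> UNIV \<and> pathstart g = a \<and> pathfinish g = b"
      using h(2,3) by (intro exI[of _ "\<lambda>s. h (s, 0)"]) (simp add: path_def pathstart_def pathfinish_def)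
  qed
qed

context lie_chart
begin

text \<open>Uniform continuity with respect to left translations: \<delta> is a Lebesgue number for
  a cover by balls on which all increments lie in \<open>N\<close>.\<close>

lemma small_increments:
  fixes K :: "'a::heine_borel \<Rightarrow> 'g"
  assumes Q: "compact Q" and K: "continuous_on Q K" and N: "open N" "\<one> \<in> N"
  obtains \<delta> where "0 < \<delta>" "\<And>p q. p \<in> Q \<Longrightarrow> q \<in> Q \<Longrightarrow> dist p q < \<delta> \<Longrightarrow> inv (K p) \<otimes> K q \<in> N"
proof -
  have "continuous_on (Q \<times> Q) (\<lambda>z. inv (K (fst z)) \<otimes> K (snd z))"
    by (intro continuous_mult continuous_inv continuous_on_compose2[OF K] continuous_on_fst
        continuous_on_snd continuous_on_id) auto
  then obtain Z where Z: "open Z" "Z \<inter> (Q \<times> Q) = (\<lambda>z. inv (K (fst z)) \<otimes> K (snd z)) -` N \<inter> (Q \<times> Q)"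
    using N(1) unfolding continuous_on_open_invariant by blast
  have "\<exists>d>0. \<forall>q\<in>Q \<inter> ball p d. \<forall>r\<in>Q \<inter> ball p d. inv (K q) \<otimes> K r \<in> N" if p: "p \<in> Q" for p
  proof -
    have "(p, p) \<in> Z" using Z(2) p N(2) by auto
    from open_prod_elim[OF Z(1) this] obtain M M' where
      M: "open M" "open M'" "(p, p) \<in> M \<times> M'" "M \<times> M' \<subseteq> Z" by blast
    have "open (M \<inter> M')" "p \<in> M \<inter> M'" using M by auto
    then obtain d where d: "0 < d" "ball p d \<subseteq> M \<inter> M'" using open_contains_ball by blast
    have "inv (K q) \<otimes> K r \<in> N" if "q \<in> Q \<inter> ball p d" "r \<in> Q \<inter> ball p d" for q r
    proof -
      have "(q, r) \<in> Z \<inter> (Q \<times> Q)" using that d(2) M(4) by blast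
      then show ?thesis using Z(2) by auto
    qed
    then show ?thesis using d(1) by blast
  qed
  then obtain d where d: "\<And>p. p \<in> Q \<Longrightarrow> d p > 0"
    "\<And>p q r. p \<in> Q \<Longrightarrow> q \<in> Q \<inter> ball p (d p) \<Longrightarrow> r \<in> Q \<inter> ball p (d p) \<Longrightarrow> inv (K q) \<otimes> K r \<in> N"
    by metis
  have cov: "Q \<subseteq> \<Union> ((\<lambda>p. ball p (d p)) ` Q)" using d(1) by force
  obtain e where e: "e > 0" "\<forall>p\<in>Q. \<exists>W\<in>(\<lambda>p. ball p (d p)) ` Q. ball p e \<subseteq> W"
    by (rule Heine_Borel_lemma[OF Q cov]) auto
  show thesis
  proof (rule that[OF e(1)])
    fix p q assume pq: "p \<in> Q" "q \<in> Q" "dist p q < e"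
    then obtain r where "r \<in> Q" "ball p e \<subseteq> ball r (d r)" using e(2) by auto
    moreover have "p \<in> ball p e" "q \<in> ball p e" using e(1) pq by auto
    ultimately show "inv (K p) \<otimes> K q \<in> N" using d(2)[of r p q] pq by blast
  qed
qed

end

section \<open>The global isomorphism\<close>

context lie_chart_two_step
begin

text \<open>A continuous homomorphism that is locally injective with open image is injective if loops in
  the target are contractible: the increments of a homotopy \<open>K\<close> lift to \<open>l p q\<close> near \<open>0\<close>, and the
  product of the increments along a row \<open>K (s, _)\<close> of a fine grid is, up to conjugation,
  independent of \<open>s\<close>.\<close>

lemma homomorphism_injective:
  assumes sc: "simply_connected (UNIV :: 'g set)"
    and hom: "\<And>y z. E (hm y z) = E y \<otimes> E z" and cont: "continuous_on UNIV E"
    and \<epsilon>: "\<epsilon> > 0" and inj: "inj_on E (ball 0 \<epsilon>)" and op: "\<And>W. open W \<Longrightarrow> W \<subseteq> ball 0 \<epsilon> \<Longrightarrow> open (E ` W)"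
  shows "inj E"
proof -
  have E0: "E 0 = \<one>" using hom[of 0 0] by simp
  have E_minus: "E (- y) = inv (E y)" for y
    using hom[of "- y" y] by (intro inv_equality[symmetric]) (simp_all add: E0)
  have ker: "h = 0" if h: "E h = \<one>" for h
  proof -
    have cp: "continuous_on {0..1} (\<lambda>t. E (t *\<^sub>R h))"
      by (rule continuous_on_compose2[OF cont]) (auto intro!: continuous_intros)
    then have "homotopic_loops UNIV (\<lambda>t. E (t *\<^sub>R h)) (\<lambda>t. \<one>)"
      using sc unfolding simply_connected_def
      by (simp add: path_def pathstart_def pathfinish_def h E0)
    then obtain K where K: "continuous_on ({0..1::real} \<times> {0..1::real}) K"
      "\<forall>t\<in>{0..1}. K (0, t) = E (t *\<^sub>R h)" "\<forall>t\<in>{0..1}. K (1, t) = \<one>"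
      "\<forall>s\<in>{0..1}. K (s, 1) = K (s, 0)"
      unfolding homotopic_loops pathfinish_def pathstart_def by auto
    \<comment> \<open>Products of two lifts from the smaller ball still lie where \<open>E\<close>
      is injective, so the cocycle identity can be checked after applying \<open>E\<close>.\<close>
    obtain \<epsilon>' where \<epsilon>': "0 < \<epsilon>'" "\<epsilon>' \<le> \<epsilon>" "\<And>u v. norm u < \<epsilon>' \<Longrightarrow> norm v < \<epsilon>' \<Longrightarrow> norm (hm u v) < \<epsilon>"
      by (rule hm_small[OF \<epsilon>]) blast
    define N where "N = E ` ball 0 \<epsilon>'"
    have "open N" unfolding N_def by (rule op) (use \<epsilon>'(2) in auto)
    moreover have "\<one> \<in> N" using \<epsilon>'(1) E0 unfolding N_def by (metis centre_in_ball imageI)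
    moreover have "compact ({0..1::real} \<times> {0..1::real})" by (intro compact_Times compact_Icc)
    ultimately obtain \<delta> where \<delta>: "0 < \<delta>" "\<And>p q. p \<in> {0..1} \<times> {0..1} \<Longrightarrow> q \<in> {0..1} \<times> {0..1} \<Longrightarrow>
        dist p q < \<delta> \<Longrightarrow> inv (K p) \<otimes> K q \<in> N"
      using small_increments[OF _ K(1)] by blast
    define l where "l p q = inv_into (ball 0 \<epsilon>') E (inv (K p) \<otimes> K q)" for p q
    have l: "E (l p q) = inv (K p) \<otimes> K q" "norm (l p q) < \<epsilon>'"
      if "p \<in> {0..1} \<times> {0..1}" "q \<in> {0..1} \<times> {0..1}" "dist p q < \<delta>" for p q
      using \<delta>(2)[OF that] f_inv_into_f[of "inv (K p) \<otimes> K q" E "ball 0 \<epsilon>'"]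
        inv_into_into[of "inv (K p) \<otimes> K q" E "ball 0 \<epsilon>'"] by (simp_all add: N_def l_def)
    have inj_l: "u = v" if "E u = E v" "norm u < \<epsilon>" "norm v < \<epsilon>" for u v
      using inj_onD[OF inj that(1)] that by simp
    have cocycle: "hm (l p q) (l q r) = l p r"
      if "p \<in> {0..1} \<times> {0..1}" "q \<in> {0..1} \<times> {0..1}" "r \<in> {0..1} \<times> {0..1}"
        "dist p q < \<delta>" "dist q r < \<delta>" "dist p r < \<delta>" for p q r
    proof (rule inj_l)
      show "E (hm (l p q) (l q r)) = E (l p r)" using that by (simp add: hom l m_assoc)
      show "norm (hm (l p q) (l q r)) < \<epsilon>" using that l by (intro \<epsilon>') auto
      show "norm (l p r) < \<epsilon>" using l(2)[OF that(1,3,6)] \<epsilon>'(2) by simp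
    qed
    \<comment> \<open>The first term makes two grid steps, the bound used for a diagonal, shorter
      than \<delta>. The second puts \<open>(1 / real m) *\<^sub>R h\<close> into the ball where
      \<open>E\<close> is injective.\<close>
    obtain m where m: "real m > 2 / \<delta> + norm h / \<epsilon>'" using reals_Archimedean2 by blast
    have pos: "2 / \<delta> > 0" "norm h / \<epsilon>' \<ge> 0" using \<delta>(1) \<epsilon>'(1) by auto
    have m0: "m > 0" using m pos by (cases m) auto
    have md: "1 / real m < \<delta> / 2" and mh: "norm h / real m < \<epsilon>'"
    proof -
      have "2 / \<delta> < real m" "norm h / \<epsilon>' < real m" using m pos by linarith+
      then show "1 / real m < \<delta> / 2" "norm h / real m < \<epsilon>'"
        using m0 \<delta>(1) \<epsilon>'(1) by (simp_all add: field_simps)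
    qed
    define t where "t i = real i / real m" for i
    have t01: "t i \<in> {0..1}" if "i \<le> m" for i using that m0 by (simp add: t_def)
    have t_Suc: "t (Suc i) - t i = 1 / real m" for i by (simp add: t_def add_divide_distrib)
    have dt: "dist (t i) (t (Suc i)) = 1 / real m" for i
      by (subst dist_commute) (simp add: dist_real_def t_Suc)
    have d: "dist (t i, t j) (t i', t j') < \<delta>"
      if "i' = i \<or> i' = Suc i" "j' = j \<or> j' = Suc j" for i j i' j'
    proof -
      have "dist (t i) (t i') \<le> 1 / real m" "dist (t j) (t j') \<le> 1 / real m"
        using that dt by auto
      then have "dist (t i, t j) (t i', t j') \<le> 1 / real m + 1 / real m"
        using sqrt_sum_squares_le_sum[of "dist (t i) (t i')" "dist (t j) (t j')"]
        by (simp add: dist_Pair_Pair)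
      then show ?thesis using md by simp
    qed
    define P where "P i = rec_nat 0 (\<lambda>j u. hm u (l (t i, t j) (t i, t (Suc j))))" for i
    have P: "P i 0 = 0" "P i (Suc j) = hm (P i j) (l (t i, t j) (t i, t (Suc j)))" for i j
      by (simp_all add: P_def)
    define v where "v i j = l (t i, t j) (t (Suc i), t j)" for i j
    \<comment> \<open>\<open>v i j\<close> lifts the step from row \<open>i\<close> to the next one
      in column \<open>j\<close>. Each grid square is crossed along its diagonal, with
      \<open>cocycle\<close> applied to the two triangles.\<close>
    have row: "j \<le> m \<Longrightarrow> hm (v i 0) (P (Suc i) j) = hm (P i j) (v i j)" if i: "Suc i \<le> m" for i j
    proof (induction j)
      case (Suc j)
      have j: "j \<le> m" "i \<le> m" using Suc.prems i by auto
      note in01 = t01[OF Suc.prems] t01[OF j(1)] t01[OF i] t01[OF j(2)]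
      have "hm (v i 0) (P (Suc i) (Suc j)) =
          hm (P i j) (hm (v i j) (l (t (Suc i), t j) (t (Suc i), t (Suc j))))"
        using Suc.IH[OF j(1)] by (simp add: P(2) flip: hm_assoc)
      also have "hm (v i j) (l (t (Suc i), t j) (t (Suc i), t (Suc j))) = l (t i, t j) (t (Suc i), t (Suc j))"
        unfolding v_def by (rule cocycle) (use in01 d in auto)
      also have "\<dots> = hm (l (t i, t j) (t i, t (Suc j))) (v i (Suc j))"
        unfolding v_def by (rule cocycle[symmetric]) (use in01 d in auto)
      finally show ?case by (simp add: P(2) hm_assoc)
    qed (simp add: P)
    \<comment> \<open>\<open>K\<close> is a homotopy of loops, so the first and last steps between
      two rows coincide and conjugation by them relates the products of the rows. Triviality thus
      travels from the constant last row back to row 0, whose product is \<open>h\<close>.\<close>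
    have row_back: "P i m = 0" if "P (Suc i) m = 0" "Suc i \<le> m" for i
    proof -
      have "t m = 1" "t 0 = 0" using m0 by (simp_all add: t_def)
      moreover have "t i \<in> {0..1}" "t (Suc i) \<in> {0..1}" using t01 that(2) by auto
      ultimately have "v i m = v i 0" using K(4) by (simp add: v_def l_def)
      then have "hm (P i m) (v i 0) = v i 0" using row[OF that(2), of m] that(1) by simp
      then have "hm (hm (P i m) (v i 0)) (- v i 0) = 0" by simp
      then show ?thesis unfolding hm_assoc by simp
    qed
    have small0: "norm (0::'e) < \<epsilon>" using \<epsilon> by simp
    have "P m j = 0" if "j \<le> m" for j
      using that
    proof (induction j)
      case (Suc j)
      have tm: "t m = 1" using m0 by (simp add: t_def)
      have "l (t m, t j) (t m, t (Suc j)) = 0"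
      proof (rule inj_l[OF _ _ small0])
        have j: "j \<le> m" using Suc.prems by simp
        have *: "(t m, t j) \<in> {0..1} \<times> {0..1}" "(t m, t (Suc j)) \<in> {0..1} \<times> {0..1}"
          using t01[OF j] t01[OF Suc.prems] t01[of m] by auto
        have **: "dist (t m, t j) (t m, t (Suc j)) < \<delta>" by (rule d) auto
        show "E (l (t m, t j) (t m, t (Suc j))) = E 0"
          using l(1)[OF * **] K(3) t01[OF j] t01[OF Suc.prems] by (simp add: tm E0)
        show "norm (l (t m, t j) (t m, t (Suc j))) < \<epsilon>" using l(2)[OF * **] \<epsilon>'(2) by simp
      qed
      then show ?case using Suc by (simp add: P)
    qed (simp add: P)
    then have "P m m = 0" by simp
    have "P (m - i) m = 0" if "i \<le> m" for i
      using that
    proof (induction i)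
      case (Suc i)
      then have "P (Suc (m - Suc i)) m = 0" by (simp add: Suc_diff_Suc)
      then show ?case by (rule row_back) (use Suc.prems in auto)
    qed (simp add: \<open>P m m = 0\<close>)
    from this[of m] have P0: "P 0 m = 0" by simp
    have "P 0 j = t j *\<^sub>R h" if "j \<le> m" for j
      using that
    proof (induction j)
      case (Suc j)
      have j: "j \<le> m" using Suc.prems by simp
      have t0: "t 0 = 0" by (simp add: t_def)
      have *: "(t 0, t j) \<in> {0..1} \<times> {0..1}" "(t 0, t (Suc j)) \<in> {0..1} \<times> {0..1}"
        using t01[OF j] t01[OF Suc.prems] t01[of 0] by auto
      have **: "dist (t 0, t j) (t 0, t (Suc j)) < \<delta>" by (rule d) auto
      have hs: "hm (t j *\<^sub>R h) ((1 / real m) *\<^sub>R h) = t (Suc j) *\<^sub>R h"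
        using t_Suc[of j] by (simp add: hmul_def \<omega>_simps flip: scaleR_add_left)
      have "l (t 0, t j) (t 0, t (Suc j)) = (1 / real m) *\<^sub>R h"
      proof (rule inj_l)
        have "E (l (t 0, t j) (t 0, t (Suc j))) = inv (E (t j *\<^sub>R h)) \<otimes> E (t (Suc j) *\<^sub>R h)"
          using l(1)[OF * **] K(2) t01[OF j] t01[OF Suc.prems] by (simp add: t0)
        also have "\<dots> = E ((1 / real m) *\<^sub>R h)" unfolding hs[symmetric] hom by simp
        finally show "E (l (t 0, t j) (t 0, t (Suc j))) = E ((1 / real m) *\<^sub>R h)" .
        show "norm (l (t 0, t j) (t 0, t (Suc j))) < \<epsilon>" using l(2)[OF * **] \<epsilon>'(2) by simp
        show "norm ((1 / real m) *\<^sub>R h) < \<epsilon>" using mh \<epsilon>'(2) by simp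
      qed
      then show ?case using Suc.IH[OF j] hs by (simp add: P(2))
    qed (simp add: P t_def)
    from this[of m] P0 show "h = 0" using m0 by (simp add: t_def)
  qed
  show "inj E"
  proof (rule injI)
    fix y z assume "E y = E z"
    then have "E (hm (- y) z) = \<one>" by (simp add: hom E_minus)
    then show "y = z" using ker hm_eq_0 by blast
  qed
qed

text \<open>The range contains a translate of \<open>N\<close> around each of its points and is
  open. So is its complement, since a translate of \<open>N\<close> around an outside point cannot
  meet the subgroup; connectedness then leaves only the whole group.\<close>

lemma homomorphism_surjective:
  assumes conn: "connected (UNIV :: 'g set)" and hom: "\<And>y z. E (hm y z) = E y \<otimes> E z"
    and N: "open N" "\<one> \<in> N" "N \<subseteq> range E"
  shows "surj E"
proof -
  have E0: "E 0 = \<one>" using hom[of 0 0] by simp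
  have E_minus: "E (- y) = inv (E y)" for y
    using hom[of "- y" y] by (intro inv_equality[symmetric]) (simp_all add: E0)
  define C where "C a = (\<lambda>b. inv a \<otimes> b) -` N" for a
  have C: "open (C a)" "a \<in> C a" for a
    unfolding C_def using N(1,2) by (auto intro!: open_continuous_vimage continuous_mult continuous_intros)
  have CE: "C a \<subseteq> range E" if a: "a \<in> range E" for a
  proof
    fix b assume "b \<in> C a"
    then obtain z where "inv a \<otimes> b = E z" using N(3) by (auto simp: C_def)
    moreover obtain y where "a = E y" using a by blast
    ultimately have "b = E (hm y z)" by (metis hom inv_mult_cancel(2))
    then show "b \<in> range E" by simp
  qed
  have CE': "C a \<subseteq> - range E" if a: "a \<notin> range E" for a
  proof
    fix b assume b: "b \<in> C a"
    show "b \<in> - range E"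
    proof
      assume "b \<in> range E"
      then obtain y where "b = E y" by blast
      moreover obtain z where z: "inv a \<otimes> b = E z" using b N(3) by (auto simp: C_def)
      moreover have "a = b \<otimes> inv (inv a \<otimes> b)" by (simp add: inv_mult_group)
      ultimately have "a = E (hm y (- z))" by (simp add: hom E_minus)
      then show False using a by simp
    qed
  qed
  have "open (range E)" using C CE by (meson openI subsetD open_subopen)
  moreover have "open (- range E)" using C CE' by (meson open_subopen ComplD)
  ultimately have "range E \<inter> UNIV = {} \<or> - range E \<inter> UNIV = {}"
    by (rule connectedD[OF conn]) auto
  then show ?thesis by blast
qed

text \<open>On a small ball \<open>E y\<close> is \<open>\<kappa> (e y)\<close>. Homogeneity does
  the rest: around any other point, \<open>E\<close> and its inverse are these local maps composed
  with left translations of the two groups.\<close>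

lemma global_isomorphism:
  assumes sc: "simply_connected (UNIV :: 'g set)"
  obtains E where "bij E" "\<And>y z. E (hm y z) = E y \<otimes> E z"
    "smooth_map euclidean_atlas (atlas G) E" "smooth_map (atlas G) euclidean_atlas (inv_into UNIV E)"
proof -
  obtain F e S T r where loc: "open S" "0 \<in> S" "S \<subseteq> dm" "open T" "homeomorphism S T F e" "F 0 = 0"
    "smooth_on S F" "smooth_on T e" "0 < r" "ball 0 r \<subseteq> S"
    "\<And>p q. p \<in> ball 0 r \<Longrightarrow> q \<in> ball 0 r \<Longrightarrow> (p, q) \<in> dmul \<and> mu p q \<in> S \<and> F (mu p q) = hm (F p) (F q)"
    by (rule local_isomorphism) blast
  have FS: "F p \<in> T" "e (F p) = p" if "p \<in> S" for p
    using loc(5) that by (auto simp: homeomorphism_def)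
  have eT: "e y \<in> S" "F (e y) = y" if "y \<in> T" for y
    using loc(5) that by (auto simp: homeomorphism_def)
  have ce: "continuous_on T e" using loc(5) by (simp add: homeomorphism_def)
  have zT: "0 \<in> T" "e 0 = 0" using FS[OF loc(2)] loc(6) by auto
  have "open (T \<inter> e -` ball 0 r)" by (rule continuous_open_preimage[OF ce loc(4) open_ball])
  moreover have "0 \<in> T \<inter> e -` ball 0 r" using zT loc(9) by simp
  ultimately obtain \<epsilon> where \<epsilon>: "\<epsilon> > 0" "ball 0 \<epsilon> \<subseteq> T \<inter> e -` ball 0 r"
    using open_contains_ball by blast
  interpret g2: group_two_step G \<omega> \<xi> by unfold_locales simp
  have L: "\<kappa> (e y) \<otimes> \<kappa> (e z) = \<kappa> (e (hm y z))" if "norm y < \<epsilon>" "norm z < \<epsilon>" for y z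
  proof -
    have y: "y \<in> T" "e y \<in> ball 0 r" and z: "z \<in> T" "e z \<in> ball 0 r" using \<epsilon>(2) that by auto
    note * = loc(11)[OF y(2) z(2)]
    have "hm y z = F (mu (e y) (e z))" using * eT y z by simp
    then have "e (hm y z) = mu (e y) (e z)" using FS(2) * by metis
    then show ?thesis using * \<kappa>_mu by simp
  qed
  obtain E where hom: "\<And>y z. E (hm y z) = E y \<otimes> E z" and EL: "\<And>y. norm y < \<epsilon> \<Longrightarrow> E y = \<kappa> (e y)"
    using g2.extend_local_homomorphism[OF \<epsilon>(1), of "\<lambda>y. \<kappa> (e y)"] L by blast
  have E0: "E 0 = \<one>" using EL[of 0] \<epsilon>(1) zT by simp
  have E_minus: "E (- y) = inv (E y)" for y
    using hom[of "- y" y] by (intro inv_equality[symmetric]) (simp_all add: E0)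
  have near: "E z = E y \<otimes> \<kappa> (e (hm (- y) z))" if "hm (- y) z \<in> ball 0 \<epsilon>" for y z
  proof -
    have "E z = E y \<otimes> E (hm (- y) z)" by (simp add: hom E_minus)
    then show ?thesis using EL that by simp
  qed
  have nb: "open {z. hm (- y) z \<in> ball 0 \<epsilon>}" for y
    using open_continuous_vimage[OF continuous_on_hm[OF continuous_on_const continuous_on_id], of "ball 0 \<epsilon>" "- y"]
    by (simp add: vimage_def)
  have nb': "y \<in> {z. hm (- y) z \<in> ball 0 \<epsilon>}" for y using \<epsilon>(1) by simp
  have sm: "smooth_map euclidean_atlas (atlas G) E" "continuous_on UNIV E"
  proof -
    have eb: "e (hm (- y) z) \<in> dm" "hm (- y) z \<in> T" if "hm (- y) z \<in> ball 0 \<epsilon>" for y z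
      using that \<epsilon>(2) eT loc(3) by blast+
    show c: "continuous_on UNIV E"
    proof (rule continuous_at_imp_continuous_on, rule ballI)
      fix y
      have "continuous_on {z. hm (- y) z \<in> ball 0 \<epsilon>} (\<lambda>z. E y \<otimes> \<kappa> (e (hm (- y) z)))"
        by (intro continuous_mult continuous_on_const continuous_on_compose2[OF continuous_on_\<kappa>]
            continuous_on_compose2[OF ce] continuous_on_hm continuous_on_id) (use eb in auto)
      then have "continuous_on {z. hm (- y) z \<in> ball 0 \<epsilon>} E"
        by (rule continuous_on_eq) (simp add: near[symmetric])
      then show "isCont E y" using nb[of y] nb'[of y] by (simp add: continuous_on_eq_continuous_at)
    qed
    show "smooth_map euclidean_atlas (atlas G) E"
    proof (rule smooth_mapI[OF chart_cover_euclidean c])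
      fix W k V v y assume "(W, k) \<in> euclidean_atlas" and V: "(V, v) \<in> atlas G" and y: "y \<in> W" "E y \<in> V"
      then have Wk: "W = UNIV" "k = id" by (auto simp: euclidean_atlas_def)
      define M where "M = {z. hm (- y) z \<in> ball 0 \<epsilon>} \<inter> E -` V"
      have oM: "open M"
        unfolding M_def by (intro open_Int nb open_continuous_vimage[OF c] chartD(1)[OF cc V])
      have hM: "smooth_on M (\<lambda>z. hm (- y) z)" by (intro smooth_on_hm smooth_on_const smooth_on_id oM)
      have eM: "smooth_on M (\<lambda>z. e (hm (- y) z))"
        by (rule smooth_on_compose[OF oM loc(4) _ hM loc(8)]) (use eb in \<open>auto simp: M_def\<close>)
      have "smooth_on M (\<lambda>z. v (E y \<otimes> \<kappa> (e (hm (- y) z))))"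
      proof (rule smooth_on_compose[OF oM smooth_translate_\<kappa>(1)[OF V] _ eM smooth_translate_\<kappa>(2)[OF V]])
        show "(\<lambda>z. e (hm (- y) z)) ` M \<subseteq> {u \<in> dm. E y \<otimes> \<kappa> u \<in> V}"
          using eb near by (auto simp: M_def)
      qed
      then have "smooth_on M (\<lambda>z. v (E z))"
        by (rule smooth_on_cong[OF oM, rotated]) (simp add: M_def near[symmetric])
      moreover have "y \<in> M" using nb'[of y] y by (simp add: M_def)
      ultimately show "\<exists>T. open T \<and> k y \<in> T \<and> smooth_on T (\<lambda>u. v (E (inv_into W k u)))"
        using oM by (intro exI[of _ M]) (simp add: Wk)
    qed
  qed
  have \<kappa>e: "e y \<in> dm" "\<kappa> (e y) \<in> U" if "y \<in> T" for y using eT[OF that] loc(3) \<kappa>_U by blast+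
  have inj\<epsilon>: "inj_on E (ball 0 \<epsilon>)"
  proof (rule inj_on_inverseI[where g = "\<lambda>a. F (crd a)"])
    fix y :: 'e assume y: "y \<in> ball 0 \<epsilon>"
    then have "y \<in> T" using \<epsilon>(2) by blast
    then show "F (crd (E y)) = y" using y EL[of y] crd_\<kappa>[OF \<kappa>e(1)] eT by simp
  qed
  have op: "open (E ` W)" if W: "open W" "W \<subseteq> ball 0 \<epsilon>" for W
  proof -
    have WT: "W \<subseteq> T" using W(2) \<epsilon>(2) by blast
    have "E ` W = U \<inter> crd -` (S \<inter> F -` W)"
    proof (intro Set.set_eqI iffI)
      fix a assume "a \<in> E ` W"
      then obtain y where y: "y \<in> W" "a = E y" by blast
      then have yT: "y \<in> T" and a: "a = \<kappa> (e y)" using WT W(2) EL by auto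
      show "a \<in> U \<inter> crd -` (S \<inter> F -` W)"
        unfolding a using \<kappa>e[OF yT] crd_\<kappa> eT[OF yT] y(1) by auto
    next
      fix a assume "a \<in> U \<inter> crd -` (S \<inter> F -` W)"
      then have a: "a \<in> U" "crd a \<in> S" "F (crd a) \<in> W" by auto
      have "a = \<kappa> (e (F (crd a)))" using FS(2)[OF a(2)] \<kappa>_crd[OF a(1)] by simp
      also have "\<dots> = E (F (crd a))" using EL a(3) W(2) by (metis mem_ball_0 subsetD)
      finally show "a \<in> E ` W" using a(3) by blast
    qed
    moreover have "open (S \<inter> F -` W)"
      using continuous_open_preimage[OF smooth_on_continuous_on[OF loc(7)] loc(1) W(1)] .
    then have "open (U \<inter> crd -` (S \<inter> F -` W))"
      by (rule continuous_open_preimage[OF continuous_on_crd ch(1)])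
    ultimately show ?thesis by simp
  qed
  have inj: "inj E" by (rule homomorphism_injective[OF sc hom sm(2) \<epsilon>(1) inj\<epsilon> op])
  have surj: "surj E"
  proof (rule homomorphism_surjective[where N = "E ` ball 0 \<epsilon>", OF simply_connected_UNIV_connected[OF sc] hom])
    show "open (E ` ball 0 \<epsilon>)" by (rule op) auto
    show "\<one> \<in> E ` ball 0 \<epsilon>" using E0 \<epsilon>(1) by (metis centre_in_ball imageI)
  qed auto
  have smi: "smooth_map (atlas G) euclidean_atlas (inv_into UNIV E)"
  proof -
    \<comment> \<open>The points that left translation by \<open>inv (E y)\<close> moves into the
      image of the small ball under \<open>E\<close>; on them the inverse of \<open>E\<close> has an
      explicit formula.\<close>
    define D where "D y = (\<lambda>a. inv (E y) \<otimes> a) -` (U \<inter> crd -` (S \<inter> F -` ball 0 \<epsilon>))" for y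
    have oD: "open (D y)" for y
      unfolding D_def
      by (intro open_continuous_vimage continuous_mult continuous_on_const continuous_on_id
          continuous_open_preimage[OF continuous_on_crd ch(1)]
          continuous_open_preimage[OF smooth_on_continuous_on[OF loc(7)] loc(1)] open_ball)
    have ED: "E y \<in> D y" for y
      using one_U loc(2) \<epsilon>(1) crd_\<kappa>[OF zero_dm] loc(6) by (simp add: D_def)
    have inv_eq: "inv_into UNIV E a = hm y (F (crd (inv (E y) \<otimes> a)))" if "a \<in> D y" for a y
    proof -
      define b where "b = inv (E y) \<otimes> a"
      have b: "b \<in> U" "crd b \<in> S" "F (crd b) \<in> ball 0 \<epsilon>" using that by (auto simp: D_def b_def)
      have "E (F (crd b)) = b" using EL[of "F (crd b)"] b FS(2)[OF b(2)] \<kappa>_crd[OF b(1)] by simp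
      then have "E (hm y (F (crd b))) = a" by (simp add: hom b_def)
      then show ?thesis using inj by (metis b_def inv_into_f_f UNIV_I)
    qed
    have smD: "smooth_on {u \<in> v ` V. inv_into V v u \<in> D y} (\<lambda>u. inv_into UNIV E (inv_into V v u))"
      if V: "(V, v) \<in> atlas G" for V v y
    proof -
      let ?M = "{u \<in> v ` V. inv_into V v u \<in> D y}"
      have oM: "open ?M" by (rule open_chart_preimage[OF cc V oD])
      have "smooth_on ?M (\<lambda>u. crd (inv (E y) \<otimes> inv_into V v u))"
        by (rule smooth_on_subset[OF smooth_crd_translate(2)[OF V]]) (auto simp: D_def)
      from smooth_on_compose[OF oM loc(1) _ this loc(7)]
      have "smooth_on ?M (\<lambda>u. hm y (F (crd (inv (E y) \<otimes> inv_into V v u))))"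
        by (intro smooth_on_hm oM smooth_on_const) (auto simp: D_def)
      then show ?thesis by (rule smooth_on_cong[OF oM, rotated]) (simp add: inv_eq[symmetric])
    qed
    have pt: "\<exists>y. a \<in> D y" for a using ED surj by (metis surjD)
    have ci: "continuous_on UNIV (inv_into UNIV E)"
    proof (rule continuous_at_imp_continuous_on, rule ballI)
      fix a
      obtain y where y: "a \<in> D y" using pt by blast
      have "continuous_on (D y) (\<lambda>a. hm y (F (crd (inv (E y) \<otimes> a))))"
        by (intro continuous_on_hm continuous_on_const
            continuous_on_compose2[OF smooth_on_continuous_on[OF loc(7)]]
            continuous_on_compose2[OF continuous_on_crd] continuous_mult continuous_on_id)
          (auto simp: D_def)
      then have "continuous_on (D y) (inv_into UNIV E)"
        by (rule continuous_on_eq) (simp add: inv_eq[symmetric])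
      then show "isCont (inv_into UNIV E) a" using oD y by (simp add: continuous_on_eq_continuous_at)
    qed
    show ?thesis
    proof (rule smooth_mapI[OF cc ci])
      fix V v a and W :: "'e set" and k
      assume V: "(V, v) \<in> atlas G" and "(W, k) \<in> euclidean_atlas" and a: "a \<in> V"
      then have Wk: "W = UNIV" "k = id" by (auto simp: euclidean_atlas_def)
      obtain y where y: "a \<in> D y" using pt by blast
      have "v a \<in> {u \<in> v ` V. inv_into V v u \<in> D y}" using a y chartD(5)[OF cc V] by simp
      then show "\<exists>T. open T \<and> v a \<in> T \<and> smooth_on T (\<lambda>u. k (inv_into UNIV E (inv_into V v u)))"
        using smD[OF V, of y] open_chart_preimage[OF cc V oD, of y] by (auto simp: Wk)
    qed
  qed
  show thesis
    by (rule that[OF _ hom sm(1) smi]) (use inj surj in \<open>simp add: bij_def\<close>)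
qed

end

section \<open>The Lie algebra of a nilpotent quasi-Sasakian Lie group\<close>

context lie_chart
begin

lemma tau_eq_iff: "tau v = tau w \<longleftrightarrow> v = w"
  by (rule inj_eq[OF inj_tau])

lemma tau_zero: "tau 0 = 0"
  using tau_scaleR[of 0 0] by (simp add: vf_scale_def fun_scale_def fun_eq_iff)

lemma tau_minus: "tau (- v) = - tau v"
  using tau_scaleR[of "-1" v] by (simp add: vf_scale_def fun_scale_def fun_eq_iff)

lemma tau_diff: "tau (v - w) = tau v - tau w"
  using tau_add[of v "- w"] by (simp add: tau_minus)

lemma tau_eqI:
  assumes "\<And>f p. f \<in> SF \<Longrightarrow> tau v f p = tau w f p"
  shows "v = w"
proof -
  have "tau v f = tau w f" for f
    using assms by (cases "f \<in> SF") (auto simp: tau_not_SF)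
  then show ?thesis using tau_eq_iff by blast
qed

lemma tau_lbr_apply: "tau (lbr v w) f p = tau v (tau w f) p - tau w (tau v f) p"
  by (simp add: tau_lbr lie_bracket_def)

lemma lbr_alt: "lbr v w = - lbr w v"
  by (rule tau_eqI) (simp add: tau_lbr_apply tau_minus)

lemma linear_lbr: "linear (lbr u)"
proof (rule linearI)
  show "lbr u (v + w) = lbr u v + lbr u w" for v w
  proof (rule tau_eqI)
    fix f p assume f: "f \<in> SF"
    have "tau u (tau (v + w) f) = (\<lambda>p. tau u (tau v f) p + tau u (tau w f) p)"
      using vector_field_add[OF tau_vector_field tau_SF[OF f] tau_SF[OF f], of u v w]
      by (simp add: tau_add plus_fun_def)
    then show "tau (lbr u (v + w)) f p = tau (lbr u v + lbr u w) f p"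
      by (simp add: tau_lbr_apply tau_add)
  qed
  show "lbr u (c *\<^sub>R v) = c *\<^sub>R lbr u v" for c v
  proof (rule tau_eqI)
    fix f p assume f: "f \<in> SF"
    have "tau u (tau (c *\<^sub>R v) f) = (\<lambda>p. c * tau u (tau v f) p)"
      using vector_field_cmult[OF tau_vector_field tau_SF[OF f], of u c v]
      by (simp add: tau_scaleR vf_scale_def fun_scale_def times_fun_def)
    then show "tau (lbr u (c *\<^sub>R v)) f p = tau (c *\<^sub>R lbr u v) f p"
      by (simp add: tau_lbr_apply tau_scaleR vf_scale_def fun_scale_def algebra_simps)
  qed
qed

lemma lbr_jacobi: "lbr u (lbr v w) = lbr (lbr u v) w + lbr v (lbr u w)"
proof (rule tau_eqI)
  fix f p assume f: "f \<in> SF"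
  have *: "tau a (tau (lbr b c) f) p = tau a (tau b (tau c f)) p - tau a (tau c (tau b f)) p" for a b c
  proof -
    have "tau (lbr b c) f = (\<lambda>p. tau b (tau c f) p - tau c (tau b f) p)"
      by (rule ext) (rule tau_lbr_apply)
    then show ?thesis
      using vector_field_diff(2)[OF cc tau_vector_field tau_SF[OF tau_SF[OF f]] tau_SF[OF tau_SF[OF f]]]
      by simp
  qed
  show "tau (lbr u (lbr v w)) f p = tau (lbr (lbr u v) w + lbr v (lbr u w)) f p"
    by (simp add: tau_add tau_lbr_apply *)
qed

text \<open>On left-invariant fields the tensors of the structure take constant values, so the
  derivative terms of d\<Phi> and d\<eta> drop out and the conditions become identities in the model
  space. There the metric is an inner product \<gamma>; conjugation with an isometry
  \<open>S\<close> replaces it by the standard one, as the algebraic lemma requires.\<close>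

lemma quasi_sasakian_bracket:
  assumes qs: "quasi_sasakian (atlas G) \<phi> \<xi> \<eta> g" and li: "left_invariant_structure G \<phi> \<xi> \<eta> g"
    and nil: "nilpotent_lie_group G"
  obtains \<omega> \<zeta> where "two_step \<omega> \<zeta>" "\<And>v w. lbr v w = \<omega> v w *\<^sub>R \<zeta>"
proof -
  let ?V = "vector_fields (atlas G)"
  note tV = tau_vector_field and tL = tau_lie_algebra
  have endo: "endomorphism_field (atlas G) \<phi>" and \<xi>V: "\<xi> \<in> ?V" and of\<eta>: "one_form (atlas G) \<eta>"
    and rm: "riemannian_metric (atlas G) g" and \<phi>\<phi>: "\<And>X. X \<in> ?V \<Longrightarrow> \<phi> (\<phi> X) = - X + fun_scale (\<eta> X) \<xi>"
    and \<eta>\<xi>: "\<eta> \<xi> = 1"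
    and g\<phi>: "\<And>X Y. X \<in> ?V \<Longrightarrow> Y \<in> ?V \<Longrightarrow> g (\<phi> X) (\<phi> Y) = g X Y - \<eta> X * \<eta> Y"
    using qs by (simp_all add: quasi_sasakian_def almost_contact_metric_def)
  have ofg: "one_form (atlas G) (g X)" and gsym: "Y \<in> ?V \<Longrightarrow> g X Y = g Y X" if "X \<in> ?V" for X Y
    using rm that by (simp_all add: riemannian_metric_def)
  have c_SF: "(\<lambda>p. c) \<in> SF" for c by (rule smooth_functions_const[OF cc])
  have of_add: "\<alpha> (X + Y) = \<alpha> X + \<alpha> Y" and of_scale: "\<alpha> (vf_scale c X) = (\<lambda>p. c) * \<alpha> X"
    if "one_form (atlas G) \<alpha>" "X \<in> ?V" "Y \<in> ?V" for \<alpha> X Y c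
    using that c_SF unfolding one_form_def vf_scale_def by blast+
  have push: "left_push G a X = X" if "X \<in> lie_algebra G" for a X
    using that by (simp add: lie_algebra_def)
  have LV: "X \<in> ?V" if "X \<in> lie_algebra G" for X using that by (simp add: lie_algebra_def)
  have const\<eta>: "\<eta> X p = \<eta> X \<one>" if X: "X \<in> lie_algebra G" for X p
  proof -
    have "\<eta> (left_push G p X) (p \<otimes> \<one>) = \<eta> X \<one>"
      using li LV[OF X] unfolding left_invariant_structure_def by blast
    then show ?thesis by (simp add: push[OF X])
  qed
  have constg: "g X Y p = g X Y \<one>" if X: "X \<in> lie_algebra G" and Y: "Y \<in> lie_algebra G" for X Y p
  proof -
    have "g (left_push G p X) (left_push G p Y) (p \<otimes> \<one>) = g X Y \<one>"
      using li LV[OF X] LV[OF Y] unfolding left_invariant_structure_def by blast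
    then show ?thesis by (simp add: push[OF X] push[OF Y])
  qed
  have \<phi>L: "\<phi> X \<in> lie_algebra G" if X: "X \<in> lie_algebra G" for X
  proof -
    have "left_push G a (\<phi> X) = \<phi> X" for a
      using li LV[OF X] push[OF X] by (metis left_invariant_structure_def)
    moreover have "\<phi> X \<in> ?V" using endo LV[OF X] by (simp add: endomorphism_field_def)
    ultimately show ?thesis by (simp add: lie_algebra_def)
  qed
  define ti where "ti = inv_into UNIV tau"
  have ti: "tau (ti X) = X" if "X \<in> lie_algebra G" for X
    using that unfolding lie_algebra_eq ti_def by (rule f_inv_into_f)
  define ph where "ph v = ti (\<phi> (tau v))" for v
  have ph: "tau (ph v) = \<phi> (tau v)" for v unfolding ph_def by (rule ti[OF \<phi>L[OF tL]])
  define \<zeta> where "\<zeta> = ti \<xi>"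
  have "\<xi> \<in> lie_algebra G" using li \<xi>V by (simp add: left_invariant_structure_def lie_algebra_def)
  then have \<zeta>: "tau \<zeta> = \<xi>" unfolding \<zeta>_def by (rule ti)
  define c where "c v = \<eta> (tau v) \<one>" for v
  define \<gamma> where "\<gamma> v w = g (tau v) (tau w) \<one>" for v w
  have \<eta>c: "\<eta> (tau v) = (\<lambda>p. c v)" for v using const\<eta>[OF tL] by (auto simp: c_def)
  have g\<gamma>: "g (tau v) (tau w) = (\<lambda>p. \<gamma> v w)" for v w using constg[OF tL tL] by (auto simp: \<gamma>_def)
  have lin_c: "linear c"
    by (intro linearI) (simp_all add: c_def tau_add tau_scaleR of_add[OF of\<eta> tV tV] of_scale[OF of\<eta> tV tV])
  have lin_\<gamma>: "linear (\<gamma> v)" for v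
    by (intro linearI) (simp_all add: \<gamma>_def tau_add tau_scaleR of_add[OF ofg[OF tV] tV tV] of_scale[OF ofg[OF tV] tV tV])
  have sym_\<gamma>: "\<gamma> v w = \<gamma> w v" for v w by (simp add: \<gamma>_def gsym[OF tV tV])
  have pos_\<gamma>: "\<gamma> v v > 0" if "v \<noteq> 0" for v
  proof -
    have "tau v \<noteq> 0" using that tau_eq_iff[of v 0] by (simp add: tau_zero)
    then obtain f p where "tau v f p \<noteq> 0" by (auto simp: fun_eq_iff)
    moreover from this have "f \<in> SF" by (metis tau_not_SF zero_fun_apply)
    ultimately have "nonzero_at (atlas G) (tau v) p" by (auto simp: nonzero_at_def)
    then have "g (tau v) (tau v) p > 0" using rm tV by (simp add: riemannian_metric_def)
    then show ?thesis by (simp add: g\<gamma>)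
  qed
  have lin_ph: "linear ph"
  proof (rule linearI)
    show "ph (v + w) = ph v + ph w" for v w
      using endo tV[of v] tV[of w] by (simp add: endomorphism_field_def ph tau_add flip: tau_eq_iff)
    show "ph (b *\<^sub>R v) = b *\<^sub>R ph v" for b v
      using endo tV[of v] c_SF[of b]
      by (simp add: endomorphism_field_def ph tau_scaleR vf_scale_def flip: tau_eq_iff)
  qed
  have phph: "ph (ph v) = - v + c v *\<^sub>R \<zeta>" for v
    using \<phi>\<phi>[OF tV] by (simp add: ph tau_add tau_minus tau_diff tau_scaleR \<zeta> \<eta>c vf_scale_def flip: tau_eq_iff)
  have c\<zeta>: "c \<zeta> = 1" by (simp add: c_def \<zeta> \<eta>\<xi>)
  have \<gamma>ph: "\<gamma> (ph v) (ph w) = \<gamma> v w - c v * c w" for v w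
    using fun_cong[OF g\<phi>[OF tV tV], of v w \<one>] by (simp add: \<gamma>_def c_def ph)
  have ph0: "ph 0 = 0" by (rule linear_0[OF lin_ph])
  have \<zeta>0: "\<zeta> \<noteq> 0" using c\<zeta> linear_0[OF lin_c] by auto
  have ph\<zeta>: "ph \<zeta> = 0"
  proof -
    have 1: "ph (ph \<zeta>) = 0" by (simp add: phph c\<zeta>)
    have "ph (ph (ph \<zeta>)) = - ph \<zeta> + c (ph \<zeta>) *\<^sub>R \<zeta>" by (rule phph)
    then have 2: "ph \<zeta> = c (ph \<zeta>) *\<^sub>R \<zeta>" by (simp add: 1 ph0 add_eq_0_iff)
    then have "ph (ph \<zeta>) = c (ph \<zeta>) *\<^sub>R ph \<zeta>" by (metis linear_cmul[OF lin_ph])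
    then show ?thesis using 1 2 by (metis scale_eq_0_iff scaleR_zero_left)
  qed
  \<comment> \<open>Compatibility of the metric with \<phi>, taken at \<zeta> where \<phi> vanishes:
    \<eta> is the metric dual of \<xi>.\<close>
  have c_\<gamma>: "c v = \<gamma> v \<zeta>" for v
    using \<gamma>ph[of v \<zeta>] linear_0[OF lin_\<gamma>] by (simp add: ph\<zeta> c\<zeta>)
  have closed: "\<gamma> (lbr u v) (ph w) + \<gamma> (lbr v w) (ph u) + \<gamma> (lbr w u) (ph v) = 0" for u v w
  proof -
    have "ext_deriv2 (fundamental_form \<phi> g) (tau u) (tau v) (tau w) \<one> = 0"
      using qs tV by (simp add: quasi_sasakian_def)
    moreover have "fundamental_form \<phi> g (tau a) (tau b) = (\<lambda>p. \<gamma> a (ph b))" for a b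
      by (simp add: fundamental_form_def g\<gamma> flip: ph)
    ultimately have "- \<gamma> (lbr u v) (ph w) + \<gamma> (lbr u w) (ph v) - \<gamma> (lbr v w) (ph u) = 0"
      by (simp add: ext_deriv2_def vector_field_const[OF cc tV] flip: tau_lbr)
    moreover have "\<gamma> (lbr u w) (ph v) = - \<gamma> (lbr w u) (ph v)"
      unfolding lbr_alt[of u w] using linear_neg[OF lin_\<gamma>] sym_\<gamma> by metis
    ultimately show ?thesis by simp
  qed
  have normal: "lbr (ph v) (ph w) + ph (ph (lbr v w)) - ph (lbr v (ph w)) - ph (lbr (ph v) w)
      - c (lbr v w) *\<^sub>R \<zeta> = 0" for v w
  proof -
    have "nijenhuis \<phi> (tau v) (tau w) + fun_scale (ext_deriv1 \<eta> (tau v) (tau w)) \<xi> = 0"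
      using qs tV by (simp add: quasi_sasakian_def)
    moreover have "ext_deriv1 \<eta> (tau v) (tau w) = (\<lambda>p. - c (lbr v w))"
      by (auto simp: ext_deriv1_def \<eta>c vector_field_const[OF cc tV] simp flip: tau_lbr)
    ultimately have "tau (lbr (ph v) (ph w) + ph (ph (lbr v w)) - ph (lbr v (ph w)) - ph (lbr (ph v) w)
      + (- c (lbr v w)) *\<^sub>R \<zeta>) = 0"
      by (simp only: tau_add tau_diff tau_scaleR \<zeta> vf_scale_def nijenhuis_def ph tau_lbr)
    then show ?thesis using tau_eq_iff[of _ 0] by (simp add: tau_zero)
  qed
  obtain S :: "'e \<Rightarrow> 'e" where S: "linear S" "bij S" "\<And>x y. \<gamma> (S x) (S y) = x \<bullet> y"
    by (rule inner_product_isometry[OF lin_\<gamma> sym_\<gamma> pos_\<gamma>]) blast+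
  define R where "R = inv_into UNIV S"
  have SR: "S (R v) = v" and RS: "R (S v) = v" for v
    using S(2) by (simp_all add: R_def bij_is_surj surj_f_inv_f bij_is_inj)
  have R: "linear R"
  proof (rule linearI)
    show "R (u + v) = R u + R v" for u v
      using RS[of "R u + R v"] by (simp add: linear_add[OF S(1)] SR)
    show "R (b *\<^sub>R v) = b *\<^sub>R R v" for b v
      using RS[of "b *\<^sub>R R v"] by (simp add: linear_cmul[OF S(1)] SR)
  qed
  note R_simps = linear_add[OF R] linear_diff[OF R] linear_neg[OF R] linear_cmul[OF R] linear_0[OF R]
  have inner: "x \<bullet> R v = \<gamma> (S x) v" "R v \<bullet> x = \<gamma> v (S x)" for x v
    using S(3)[of x "R v"] S(3)[of "R v" x] by (simp_all add: SR)
  obtain N where N: "lower_central (lie_algebra G) N = {0}" using nil by (auto simp: nilpotent_lie_group_def)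
  define C where "C j = {x. tau (S x) \<in> lower_central (lie_algebra G) j}" for j
  let ?br = "\<lambda>x y. R (lbr (S x) (S y))"
  have c_inner: "x \<bullet> R \<zeta> = c (S x)" for x by (simp add: inner c_\<gamma>)
  have alt_br: "?br x y = - ?br y x" for x y
    using arg_cong[OF lbr_alt[of "S x" "S y"], of R] by (simp only: R_simps(3))
  have hyps: "linear (?br x)" "?br x (?br y z) = ?br (?br x y) z + ?br y (?br x z)"
    "linear (\<lambda>x. R (ph (S x)))" "R (ph (S (R (ph (S x))))) = - x + (x \<bullet> R \<zeta>) *\<^sub>R R \<zeta>"
    "R (ph (S x)) \<bullet> R (ph (S y)) = x \<bullet> y - (x \<bullet> R \<zeta>) * (y \<bullet> R \<zeta>)"
    "R \<zeta> \<bullet> R \<zeta> = 1" for x y z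
    using linear_compose[OF linear_compose[OF S(1) linear_lbr] R]
      linear_compose[OF linear_compose[OF S(1) lin_ph] R] lbr_jacobi[of "S x" "S y" "S z"]
    by (simp_all add: o_def SR RS R_simps phph c_inner inner \<gamma>ph S(3) c\<zeta> c_\<gamma>[symmetric])
  have normal': "?br (R (ph (S x))) (R (ph (S y))) + R (ph (S (R (ph (S (?br x y))))))
      - R (ph (S (?br x (R (ph (S y)))))) - R (ph (S (?br (R (ph (S x))) y))) - (?br x y \<bullet> R \<zeta>) *\<^sub>R R \<zeta> = 0" for x y
    using arg_cong[OF normal[of "S x" "S y"], of R] by (simp add: SR R_simps c_inner)
  have closed': "?br x y \<bullet> R (ph (S z)) + ?br y z \<bullet> R (ph (S x)) + ?br z x \<bullet> R (ph (S y)) = 0" for x y z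
    using closed by (simp add: inner SR)
  have filt: "C 0 = UNIV" "y \<in> C j \<Longrightarrow> ?br x y \<in> C (Suc j)" "C N = {0}" for x y j
  proof -
    show "C 0 = UNIV" by (auto simp: C_def tL)
    show "?br x y \<in> C (Suc j)" if "y \<in> C j"
      using that tL by (auto simp: C_def SR tau_lbr intro!: vf.span_base)
    have "tau (S x) = 0 \<longleftrightarrow> x = 0" for x
      using tau_eq_iff[of "S x" 0] RS[of x] linear_0[OF S(1)] linear_0[OF R] by (metis tau_zero)
    then show "C N = {0}" by (auto simp: C_def N)
  qed
  note result = nilpotent_quasi_sasakian_bracket[OF hyps(1) alt_br hyps(2-6) normal' closed' filt]
  have lbr_c: "lbr v w = c (lbr v w) *\<^sub>R \<zeta>" for v w
  proof -
    have "R (lbr v w) = (R (lbr v w) \<bullet> R \<zeta>) *\<^sub>R R \<zeta>"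
      using result(2)[of "R v" "R w"] by (simp only: SR)
    then have "S (R (lbr v w)) = S ((R (lbr v w) \<bullet> R \<zeta>) *\<^sub>R R \<zeta>)" by simp
    then show ?thesis unfolding linear_cmul[OF S(1)] c_inner SR .
  qed
  have \<zeta>_central: "lbr \<zeta> w = 0" for w
    using result(1)[of "R w"] SR[of "lbr \<zeta> w"] linear_0[OF S(1)] by (simp add: SR)
  show thesis
  proof (rule that[OF _ lbr_c])
    show "two_step (\<lambda>v w. c (lbr v w)) \<zeta>"
    proof (rule two_step.intro)
      have lin: "linear (\<lambda>w. c (lbr v w))" for v
        using linear_compose[OF linear_lbr lin_c] by (simp add: o_def)
      have alt: "c (lbr v w) = - c (lbr w v)" for v w
        using lbr_alt[of v w] linear_neg[OF lin_c] by simp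
      have "bilinear (\<lambda>v w. c (lbr v w))"
        unfolding bilinear_def using lin linear_compose_neg[OF lin] alt by (metis (no_types, lifting) ext)
      then show "bounded_bilinear (\<lambda>v w. c (lbr v w))" by (simp add: bilinear_conv_bounded_bilinear)
      show "c (lbr v w) = - c (lbr w v)" for v w by (rule alt)
      show "c (lbr \<zeta> v) = 0" for v by (simp add: \<zeta>_central linear_0[OF lin_c])
    qed (rule \<zeta>0)
  qed
qed

end

section \<open>The Heisenberg group\<close>

lemma heisenberg_form_std_basis:
  assumes "DIM('e) = 2 * n + 1" "i \<le> 2 * n" "j \<le> 2 * n"
  shows "heisenberg_form n w (std_basis i :: 'e::euclidean_space) (std_basis j) =
    (\<Sum>r\<in>{1..n}. if (i, j) = (r, n + r) then 2 * w r else if (i, j) = (n + r, r) then - 2 * w r else 0)"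
  unfolding heisenberg_form_def
  by (rule sum.cong[OF refl]) (use assms in \<open>auto simp: inner_std_basis\<close>)

lemma two_step_heisenberg:
  assumes "DIM('e) = 2 * n + 1"
  shows "two_step (heisenberg_form n w) (std_basis 0 :: 'e::euclidean_space)"
proof (rule two_step.intro)
  have "linear (\<lambda>y. heisenberg_form n w x y)" "linear (\<lambda>x. heisenberg_form n w x y)" for x y :: 'e
    by (intro linearI; simp add: heisenberg_form_def inner_add_left sum_distrib_left algebra_simps
        flip: sum.distrib)+
  then have "bilinear (heisenberg_form n w :: 'e \<Rightarrow> _)" by (simp add: bilinear_def)
  then show "bounded_bilinear (heisenberg_form n w :: 'e \<Rightarrow> _)"
    by (simp add: bilinear_conv_bounded_bilinear)
  show "heisenberg_form n w x y = - heisenberg_form n w y x" for x y :: 'e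
    unfolding heisenberg_form_def sum_negf[symmetric] by (rule sum.cong) (auto simp: algebra_simps)
  show "heisenberg_form n w (std_basis 0) y = 0" for y :: 'e
    unfolding heisenberg_form_def
    by (rule sum.neutral) (use assms in \<open>auto simp: inner_std_basis\<close>)
  show "(std_basis 0 :: 'e) \<noteq> 0"
    using inner_std_basis[of 0 0, where 'e = 'e] assms by auto
qed

lemma heisenberg_group_simps:
  "carrier (heisenberg_group n w) = UNIV" "\<one>\<^bsub>heisenberg_group n w\<^esub> = 0"
  "atlas (heisenberg_group n w) = euclidean_atlas"
  "u \<otimes>\<^bsub>heisenberg_group n w\<^esub> v = hmul (heisenberg_form n w) (std_basis 0) u v"
  by (simp_all add: heisenberg_group_def hmul_def heisenberg_form_def sum_divide_distrib)

lemma smooth_map_euclidean: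
  assumes "smooth_on UNIV f"
  shows "smooth_map euclidean_atlas euclidean_atlas f"
  using assms smooth_on_continuous_on[OF assms] by (simp add: smooth_map_def euclidean_atlas_def o_def)

lemma smooth_atlas_euclidean: "smooth_atlas euclidean_atlas"
  using chart_cover_euclidean smooth_on_id[OF open_UNIV]
  by (simp add: smooth_atlas_def chart_cover_def euclidean_atlas_def o_def id_def)

lemma heisenberg_lie_group:
  assumes "DIM('e) = 2 * n + 1"
  shows "lie_group (heisenberg_group n w :: ('e, 'e::euclidean_space) smooth_group)"
proof -
  let ?H = "heisenberg_group n w :: ('e, 'e) smooth_group"
  interpret two_step "heisenberg_form n w" "std_basis 0 :: 'e" by (rule two_step_heisenberg[OF assms])
  have grp: "group ?H"
  proof (rule groupI)
    show "\<exists>v\<in>carrier ?H. v \<otimes>\<^bsub>?H\<^esub> u = \<one>\<^bsub>?H\<^esub>" for u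
      by (intro bexI[of _ "- u"]) (simp_all add: heisenberg_group_simps)
  qed (simp_all add: heisenberg_group_simps hm_assoc)
  have inv: "inv\<^bsub>?H\<^esub> u = - u" for u
    by (rule group.inv_equality[OF grp]) (simp_all add: heisenberg_group_simps)
  have "smooth_map (prod_atlas euclidean_atlas euclidean_atlas) euclidean_atlas (\<lambda>(u, v). u \<otimes>\<^bsub>?H\<^esub> v)"
  proof (rule smooth_mapI[OF chart_cover_prod(1)[OF chart_cover_euclidean chart_cover_euclidean]])
    have sm: "smooth_on UNIV (\<lambda>u. hm (fst u) (snd u))"
      by (intro smooth_on_hm smooth_on_linear bounded_linear_fst bounded_linear_snd open_UNIV)
    then show "continuous_on UNIV (\<lambda>(u, v). u \<otimes>\<^bsub>?H\<^esub> v)"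
      using smooth_on_continuous_on by (fastforce simp: heisenberg_group_simps case_prod_unfold)
    fix U V :: "('e \<times> 'e) set" and x p and W :: "'e set" and y
    assume "(U, x) \<in> prod_atlas euclidean_atlas (euclidean_atlas :: ('e, 'e) chart set)" "(W, y) \<in> euclidean_atlas"
    then have *: "U = UNIV" "x = id" "W = UNIV" "y = id" by (auto simp: prod_atlas_def euclidean_atlas_def map_prod.id)
    show "\<exists>T. open T \<and> x p \<in> T \<and> smooth_on T (\<lambda>u. y ((\<lambda>(u, v). u \<otimes>\<^bsub>?H\<^esub> v) (inv_into U x u)))"
      using sm by (intro exI[of _ UNIV]) (simp add: * heisenberg_group_simps case_prod_unfold)
  qed
  moreover have "smooth_map euclidean_atlas euclidean_atlas (\<lambda>u. inv\<^bsub>?H\<^esub> u)"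
    unfolding inv
    by (intro smooth_map_euclidean smooth_on_linear[OF bounded_linear_minus[OF bounded_linear_ident]] open_UNIV)
  ultimately show ?thesis
    using grp smooth_atlas_euclidean by (simp add: lie_group_def heisenberg_group_simps)
qed

section \<open>Transport of the Lie algebra\<close>

text \<open>The push-forward of a vector field along a diffeomorphism \<open>F\<close>. Its inverse
  \<open>E\<close> is an explicit argument, so that transport back is simply
  \<open>push E F\<close>.\<close>

definition push :: "('g \<Rightarrow> 'h) \<Rightarrow> ('h \<Rightarrow> 'g) \<Rightarrow> 'g vfield \<Rightarrow> 'h vfield" where
  "push F E X = (\<lambda>f b. X (\<lambda>a. f (F a)) (E b))"

lemma push_push: "(\<And>a. E (F a) = a) \<Longrightarrow> push E F (push F E X) = X"
  by (simp add: push_def)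

lemma push_lie_bracket:
  "(\<And>a. E (F a) = a) \<Longrightarrow> push F E (lie_bracket X Y) = lie_bracket (push F E X) (push F E Y)"
  by (simp add: push_def lie_bracket_def fun_eq_iff)

lemma push_vector_field:
  assumes A: "chart_cover A" and B: "chart_cover B" and F: "smooth_map A B F" and E: "smooth_map B A E"
    and FE: "\<And>b. F (E b) = b" and X: "X \<in> vector_fields A"
  shows "push F E X \<in> vector_fields B"
proof -
  have SF: "(\<lambda>a. f (F a)) \<in> smooth_functions A \<longleftrightarrow> f \<in> smooth_functions B" for f
    using smooth_functions_compose[OF A B F, of f] smooth_functions_compose[OF B A E, of "\<lambda>a. f (F a)"] FE
    by auto
  show ?thesis
    unfolding vector_fields_def mem_Collect_eq push_def
  proof (intro conjI ballI allI impI)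
    fix f assume f: "f \<in> smooth_functions B"
    then have f': "(\<lambda>a. f (F a)) \<in> smooth_functions A" by (simp add: SF)
    show "(\<lambda>b. X (\<lambda>a. f (F a)) (E b)) \<in> smooth_functions B"
      by (rule smooth_functions_compose[OF B A E vector_field_SF[OF X f']])
    show "(\<lambda>b. X (\<lambda>a. c * f (F a)) (E b)) = (\<lambda>p. c * X (\<lambda>a. f (F a)) (E p))" for c
      by (simp add: vector_field_cmult[OF X f'])
    fix h assume "h \<in> smooth_functions B"
    then have h': "(\<lambda>a. h (F a)) \<in> smooth_functions A" by (simp add: SF)
    show "(\<lambda>b. X (\<lambda>a. (f + h) (F a)) (E b)) = (\<lambda>b. X (\<lambda>a. f (F a)) (E b)) + (\<lambda>b. X (\<lambda>a. h (F a)) (E b))"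
      by (simp add: vector_field_add[OF X f' h'] fun_eq_iff)
    show "(\<lambda>b. X (\<lambda>a. (f * h) (F a)) (E b)) = (\<lambda>b. X (\<lambda>a. f (F a)) (E b)) * h + f * (\<lambda>b. X (\<lambda>a. h (F a)) (E b))"
      by (simp add: vector_field_mult[OF X f' h'] fun_eq_iff FE)
  next
    fix f assume "f \<notin> smooth_functions B"
    then show "(\<lambda>b. X (\<lambda>a. f (F a)) (E b)) = 0"
      using vector_field_not_SF[OF X] SF[of f] by (simp add: fun_eq_iff)
  qed
qed

lemma push_lie_algebra:
  assumes G: "lie_group G" and H: "lie_group H"
    and F: "smooth_map (atlas G) (atlas H) F" and E: "smooth_map (atlas H) (atlas G) E"
    and FE: "\<And>b. F (E b) = b" and EF: "\<And>a. E (F a) = a"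
    and hom: "\<And>a b. F (a \<otimes>\<^bsub>G\<^esub> b) = F a \<otimes>\<^bsub>H\<^esub> F b" and X: "X \<in> lie_algebra G"
  shows "push F E X \<in> lie_algebra H"
proof -
  interpret G: group G using G by (simp add: lie_group_def)
  interpret H: group H using H by (simp add: lie_group_def)
  have [simp]: "carrier G = UNIV" "carrier H = UNIV" using G H by (auto simp: lie_group_def)
  have cov: "chart_cover (atlas G)" "chart_cover (atlas H)"
    using G H by (auto simp: lie_group_def smooth_atlas_chart_cover)
  have F1: "F \<one>\<^bsub>G\<^esub> = \<one>\<^bsub>H\<^esub>" using hom[of "\<one>\<^bsub>G\<^esub>" "\<one>\<^bsub>G\<^esub>"] by simp
  have homE: "E (c \<otimes>\<^bsub>H\<^esub> b) = E c \<otimes>\<^bsub>G\<^esub> E b" for c b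
    using arg_cong[OF hom[of "E c" "E b"], of E] by (simp add: FE EF)
  have invE: "E (inv\<^bsub>H\<^esub> c) = inv\<^bsub>G\<^esub> (E c)" for c
    using homE[of "inv\<^bsub>H\<^esub> c" c] arg_cong[OF F1, of E]
    by (intro G.inv_equality[symmetric]) (simp_all add: EF)
  have "left_push H c (push F E X) = push F E X" for c
  proof (intro ext)
    fix f b
    have "left_push H c (push F E X) f b = left_push G (E c) X (\<lambda>a. f (F a)) (E b)"
      by (simp add: left_push_def push_def homE invE hom FE)
    also have "\<dots> = push F E X f b" using X by (simp add: lie_algebra_def push_def)
    finally show "left_push H c (push F E X) f b = push F E X f b" .
  qed
  moreover have "push F E X \<in> vector_fields (atlas H)"
    by (rule push_vector_field[OF cov F E FE]) (use X in \<open>simp add: lie_algebra_def\<close>)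
  ultimately show ?thesis by (simp add: lie_algebra_def)
qed

context lie_chart_two_step
begin

lemma isomorphic_to_heisenberg_group:
  assumes sc: "simply_connected (UNIV :: 'g set)" and dim: "DIM('e) = 2 * n + 1"
  shows "\<exists>w :: nat \<Rightarrow> real.
    weighted_heisenberg_lie_group n w (heisenberg_group n w :: ('e, 'e) smooth_group) \<and>
    lie_group_isomorphic G (heisenberg_group n w :: ('e, 'e) smooth_group)"
proof -
  have lin: "linear (\<omega> v)" for v
    using bounded_bilinear.bounded_linear_right[OF bil] bounded_linear.linear by blast
  obtain S :: "'e \<Rightarrow> 'e" and w where S: "linear S" "bij S" "S (std_basis 0) = \<xi>"
    "\<And>u v. \<omega> (S u) (S v) = heisenberg_form n w u v"
    by (rule alternating_form_normal_form[OF lin alt \<omega>_\<xi> \<xi>_nz dim]) blast+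
  let ?H = "heisenberg_group n w :: ('e, 'e) smooth_group"
  have H: "lie_group ?H" by (rule heisenberg_lie_group[OF dim])
  obtain E where E: "bij E" "\<And>y z. E (hm y z) = E y \<otimes> E z"
    "smooth_map euclidean_atlas (atlas G) E" "smooth_map (atlas G) euclidean_atlas (inv_into UNIV E)"
    by (rule global_isomorphism[OF sc]) blast
  \<comment> \<open>\<open>S\<close> is a linear bijection that takes \<open>std_basis 0\<close> to
    \<xi> and pulls \<omega> back to \<open>heisenberg_form\<close>. It therefore carries the
    product of \<open>?H\<close> to \<open>hm\<close>.\<close>
  define E' where "E' u = E (S u)" for u
  define F where "F a = inv_into UNIV S (inv_into UNIV E a)" for a
  have SR: "S (inv_into UNIV S v) = v" and RS: "inv_into UNIV S (S v) = v" for v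
    using S(2) by (simp_all add: bij_is_surj surj_f_inv_f bij_is_inj)
  have EF: "E' (F a) = a" and FE: "F (E' u) = u" for a u
    using E(1) by (simp_all add: E'_def F_def SR RS bij_is_surj surj_f_inv_f bij_is_inj)
  have smE: "smooth_map (atlas ?H) (atlas G) E'"
    unfolding E'_def heisenberg_group_simps
    by (rule smooth_map_compose[OF chart_cover_euclidean chart_cover_euclidean cc _ E(3)])
      (intro smooth_map_euclidean smooth_on_linear linear_conv_bounded_linear[THEN iffD1] S open_UNIV)
  have R: "linear (inv_into UNIV S)"
  proof (rule linearI)
    show "inv_into UNIV S (u + v) = inv_into UNIV S u + inv_into UNIV S v" for u v
      using RS[of "inv_into UNIV S u + inv_into UNIV S v"] by (simp add: linear_add[OF S(1)] SR)
    show "inv_into UNIV S (b *\<^sub>R v) = b *\<^sub>R inv_into UNIV S v" for b v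
      using RS[of "b *\<^sub>R inv_into UNIV S v"] by (simp add: linear_cmul[OF S(1)] SR)
  qed
  have smF: "smooth_map (atlas G) (atlas ?H) F"
    unfolding F_def heisenberg_group_simps
    by (rule smooth_map_compose[OF cc chart_cover_euclidean chart_cover_euclidean E(4)])
      (intro smooth_map_euclidean smooth_on_linear linear_conv_bounded_linear[THEN iffD1] R open_UNIV)
  have homE: "E' (u \<otimes>\<^bsub>?H\<^esub> v) = E' u \<otimes> E' v" for u v
  proof -
    have "S (u \<otimes>\<^bsub>?H\<^esub> v) = hm (S u) (S v)"
      by (simp add: heisenberg_group_simps hmul_def linear_add[OF S(1)] linear_cmul[OF S(1)] S(3,4))
    then show ?thesis by (simp add: E'_def E(2))
  qed
  have homF: "F (a \<otimes> b) = F a \<otimes>\<^bsub>?H\<^esub> F b" for a b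
    using arg_cong[OF homE[of "F a" "F b"], of F] by (simp add: EF FE)
  have bijF: "bij F" by (rule o_bij[of E']) (auto simp: EF FE o_def)
  have "inv_into (carrier G) F = E'"
  proof
    show "inv_into (carrier G) F u = E' u" for u
      using inv_into_f_f[OF bij_is_inj[OF bijF], of "E' u"] by (simp add: FE)
  qed
  then have iso: "lie_group_isomorphic G ?H"
    unfolding lie_group_isomorphic_def
    using smE smF bijF homF by (intro bexI[of _ F]) (auto simp: iso_def hom_def heisenberg_group_simps)
  \<comment> \<open>The Lie algebra of \<open>?H\<close> is obtained by transport from
    \<open>G\<close>: \<Psi> is a linear bijection from the model space onto it, and its brackets
    come from \<open>lbr_\<omega>\<close>. The basis sought is the image of the standard
    one.\<close>
  define \<Psi> where "\<Psi> v = push F E' (tau (S v))" for v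
  have \<Psi>_add: "\<Psi> (u + v) = \<Psi> u + \<Psi> v" for u v
    by (simp add: \<Psi>_def linear_add[OF S(1)] tau_add push_def fun_eq_iff)
  have \<Psi>_scale: "\<Psi> (c *\<^sub>R v) = vf_scale c (\<Psi> v)" for c v
    by (simp add: \<Psi>_def linear_cmul[OF S(1)] tau_scaleR push_def vf_scale_def fun_scale_def fun_eq_iff)
  interpret \<Psi>: Vector_Spaces.linear "(*\<^sub>R)" "vf_scale :: real \<Rightarrow> 'e vfield \<Rightarrow> 'e vfield" \<Psi>
    by unfold_locales (rule \<Psi>_add \<Psi>_scale)+
  have inj\<Psi>: "inj \<Psi>"
  proof (rule injI)
    fix u v assume "\<Psi> u = \<Psi> v"
    then have "push E' F (\<Psi> u) = push E' F (\<Psi> v)" by simp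
    then show "u = v" using EF RS by (metis \<Psi>_def push_push tau_eq_iff)
  qed
  have range\<Psi>: "lie_algebra ?H = range \<Psi>"
  proof
    show "range \<Psi> \<subseteq> lie_algebra ?H"
      unfolding \<Psi>_def using push_lie_algebra[OF lie H smF smE FE EF homF tau_lie_algebra] by auto
    show "lie_algebra ?H \<subseteq> range \<Psi>"
    proof
      fix Y assume "Y \<in> lie_algebra ?H"
      then have "push E' F Y \<in> range tau"
        using push_lie_algebra[OF H lie smE smF EF FE homE] lie_algebra_eq by blast
      then obtain v where "push E' F Y = tau v" by blast
      then have "Y = \<Psi> (inv_into UNIV S v)" using push_push[of F E' Y] FE by (simp add: \<Psi>_def SR)
      then show "Y \<in> range \<Psi>" by simp
    qed
  qed
  have br\<Psi>: "lie_bracket (\<Psi> u) (\<Psi> v) = vf_scale (heisenberg_form n w u v) (\<Psi> (std_basis 0))" for u v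
  proof -
    have "lie_bracket (\<Psi> u) (\<Psi> v) = push F E' (tau (lbr (S u) (S v)))"
      by (simp add: \<Psi>_def tau_lbr push_lie_bracket[of E' F] EF)
    also have "\<dots> = \<Psi> (heisenberg_form n w u v *\<^sub>R std_basis 0)"
      by (simp add: \<Psi>_def lbr_\<omega> S(3,4) linear_cmul[OF S(1)])
    finally show ?thesis by (simp add: \<Psi>_scale)
  qed
  have sb: "(std_basis :: nat \<Rightarrow> 'e) ` {0..2 * n} = Basis" "inj_on (std_basis :: nat \<Rightarrow> 'e) {0..2 * n}"
  proof -
    have "{0..2 * n} = {..<DIM('e)}" using dim by auto
    then show "(std_basis :: nat \<Rightarrow> 'e) ` {0..2 * n} = Basis" "inj_on (std_basis :: nat \<Rightarrow> 'e) {0..2 * n}"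
      using bij_betw_std_basis[where 'e = 'e] by (simp_all add: bij_betw_def)
  qed
  have "weighted_heisenberg_algebra n w (lie_algebra ?H)"
    unfolding weighted_heisenberg_algebra_def
  proof (intro exI[of _ "\<lambda>i. \<Psi> (std_basis i)"] conjI ballI impI)
    have im: "(\<lambda>i. \<Psi> (std_basis i)) ` {0..2 * n} = \<Psi> ` Basis"
      unfolding sb(1)[symmetric] by (simp add: image_image)
    show "inj_on (\<lambda>i. \<Psi> (std_basis i)) {0..2 * n}"
      using comp_inj_on[OF sb(2) inj_on_subset[OF inj\<Psi> subset_UNIV]] by (simp add: o_def)
    show "vf.independent ((\<lambda>i. \<Psi> (std_basis i)) ` {0..2 * n})"
      unfolding im
      by (rule \<Psi>.independent_injective_image)
        (use independent_Basis inj_on_subset[OF inj\<Psi> subset_UNIV] in \<open>auto simp: dependent_raw_def\<close>)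
    show "vf.span ((\<lambda>i. \<Psi> (std_basis i)) ` {0..2 * n}) = lie_algebra ?H"
      unfolding im \<Psi>.span_image range\<Psi> using span_Basis[where 'a = 'e] by (simp add: span_raw_def)
    show "lie_bracket (\<Psi> (std_basis r)) (\<Psi> (std_basis (n + r))) = vf_scale (2 * w r) (\<Psi> (std_basis 0))"
      if r: "r \<in> {1..n}" for r
    proof -
      have "heisenberg_form n w (std_basis r :: 'e) (std_basis (n + r)) = (\<Sum>s\<in>{1..n}. if s = r then 2 * w r else 0)"
        using r by (subst heisenberg_form_std_basis[OF dim]) (simp, simp, rule sum.cong, auto)
      then show ?thesis using r by (simp add: br\<Psi>)
    qed
    show "lie_bracket (\<Psi> (std_basis i)) (\<Psi> (std_basis j)) = 0"
      if "i \<in> {0..2 * n}" "j \<in> {0..2 * n}" "\<forall>r\<in>{1..n}. (i, j) \<noteq> (r, n + r) \<and> (i, j) \<noteq> (n + r, r)" for i j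
    proof -
      have "heisenberg_form n w (std_basis i :: 'e) (std_basis j) = 0"
        using that by (subst heisenberg_form_std_basis[OF dim]) (auto intro!: sum.neutral)
      then show ?thesis by (simp add: br\<Psi> vf_scale_def fun_scale_def fun_eq_iff)
    qed
  qed
  then show ?thesis
    using iso H convex_imp_simply_connected[OF convex_UNIV]
    unfolding weighted_heisenberg_lie_group_def by blast
qed

end

theorem theorem4p6:
  fixes G :: "('g::{t2_space,second_countable_topology}, 'e::euclidean_space) smooth_group"
    and n :: nat
    and \<phi> :: "'g vfield \<Rightarrow> 'g vfield"
    and \<xi> :: "'g vfield"
    and \<eta> :: "'g vfield \<Rightarrow> 'g \<Rightarrow> real"
    and g :: "'g vfield \<Rightarrow> 'g vfield \<Rightarrow> 'g \<Rightarrow> real"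
  assumes "lie_group G"
    and "DIM('e) = 2 * n + 1"
    and "simply_connected (UNIV :: 'g set)"
    and "nilpotent_lie_group G"
    and "quasi_sasakian (atlas G) \<phi> \<xi> \<eta> g"
    and "left_invariant_structure G \<phi> \<xi> \<eta> g"
    and "maximal_rank (atlas G) n \<eta>"
  shows "\<exists>w :: nat \<Rightarrow> real.
           weighted_heisenberg_lie_group n w (heisenberg_group n w :: ('e, 'e) smooth_group) \<and>
           lie_group_isomorphic G (heisenberg_group n w :: ('e, 'e) smooth_group)"
proof -
  have "chart_cover (atlas G)" using assms(1) by (simp add: lie_group_def smooth_atlas_chart_cover)
  then obtain U x where Ux: "(U, x) \<in> atlas G" "\<one>\<^bsub>G\<^esub> \<in> U" by (rule chart_coverE)
  interpret lie_chart G U x by (rule lie_chart.intro[OF assms(1) Ux])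
  obtain \<omega> \<zeta> where *: "two_step \<omega> \<zeta>" "\<And>v w. lbr v w = \<omega> v w *\<^sub>R \<zeta>"
    by (rule quasi_sasakian_bracket[OF assms(5,6,4)]) blast
  interpret lie_chart_two_step G U x \<omega> \<zeta>
    by (intro lie_chart_two_step.intro lie_chart_two_step_axioms.intro lie_chart_axioms *)
  show ?thesis by (rule isomorphic_to_heisenberg_group[OF assms(3,2)])
qed

end
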